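(* Let $D\in\mathbb{N}$, let $p\geq n\geq 2$, $K\geq 1$, $\sigma>0$, $\bar\Delta>0$, and set $$\zeta_{n}:=\frac{\bar\Delta^{4}D^{8}(1+D)^{4}}{p}\max\left(\frac{n}{K^{2}},1\right).$$ If $\zeta_n<1$, then under the Bayesian model described in the context, $$MMSE_{\leq D}\ \geq\ \frac{1}{K}-\frac{1}{K^{2}}\left(1+\frac{\zeta_n}{(1-\sqrt{\zeta_n})^3}\right).$$ In particular, along any sequence of parameters $(n,p,K,D,\bar\Delta)$ with $p\geq n$ and $D\ge 1$ such that $\bar\Delta^2\ll D^{-6}\min\left(\sqrt{pK^2/n},\sqrt{p}\right)$ (i.e. the ratio of the left-hand side to the right-hand side tends to $0$), one has $MMSE_{\leq D}=\frac{1}{K}-\frac{1+o(1)}{K^{2}}$.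
   Context: Bayesian model: $k_1,\ldots,k_n$ are drawn i.i.d. uniformly on $\{1,\ldots,K\}$. Independently, $\mu_1,\ldots,\mu_K\in\mathbb{R}^p$ are drawn i.i.d. uniformly on the hypercube $\{+\varepsilon,-\varepsilon\}^p$, with $\varepsilon^2=\frac{1}{p}\bar\Delta^2\sigma^2$. Conditionally on $(k_i)_i$ and $(\mu_k)_k$, the vectors $Y_1,\ldots,Y_n\in\mathbb{R}^p$ are independent with $Y_i\sim\mathcal{N}(\mu_{k_i},\sigma^2I_p)$. Set $M^*_{ij}=\mathbf{1}_{k_i=k_j}$ for $1\le i,j\le n$. Let $\mathbb{R}_D[Y]$ be the set of all real polynomials of degree at most $D$ in the $np$ observed entries $(Y_{ij})_{1\le i\le n,1\le j\le p}$ ($Y_{ij}$ is the $j$-th coordinate of $Y_i$). The degree-$D$ minimum mean squared error is $$MMSE_{\leq D}:=\inf_{f_{ij}\in\mathbb{R}_D[Y]}\ \frac{1}{n(n-1)}\sum_{1\le i\neq j\le n}\mathbb{E}\left[(f_{ij}(Y)-M^*_{ij})^2\right].$$ *)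

theory Defs
  imports "HOL-Probability.Probability"
begin

text \<open>Points are labelled by \<open>{1..n}\<close>, coordinates by \<open>{1..p}\<close> and clusters by \<open>{1..K}\<close>.
  A vector of \<open>\<real>\<^sup>p\<close> is a function on \<open>{1..p}\<close>, extended by \<open>undefined\<close>.\<close>

definition centre_eps :: "nat \<Rightarrow> real \<Rightarrow> real \<Rightarrow> real" where
  "centre_eps p \<sigma> \<Delta> = sqrt (1 / real p * \<Delta>\<^sup>2 * \<sigma>\<^sup>2)"

definition labels_pmf :: "nat \<Rightarrow> nat \<Rightarrow> (nat \<Rightarrow> nat) pmf" where
  "labels_pmf n K = Pi_pmf {1..n} undefined (\<lambda>_. pmf_of_set {1..K})"

definition centres_pmf :: "nat \<Rightarrow> nat \<Rightarrow> real \<Rightarrow> real \<Rightarrow> (nat \<Rightarrow> nat \<Rightarrow> real) pmf" where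
  "centres_pmf p K \<sigma> \<Delta> =
     Pi_pmf {1..K} undefined
       (\<lambda>_. pmf_of_set ({1..p} \<rightarrow>\<^sub>E {centre_eps p \<sigma> \<Delta>, - centre_eps p \<sigma> \<Delta>}))"

text \<open>The Gaussian law \<open>N(m, \<sigma>\<^sup>2 I\<^sub>p)\<close>; note that the second parameter of
  \<^const>\<open>normal_density\<close> is the standard deviation.\<close>

definition gaussian_vec :: "nat \<Rightarrow> real \<Rightarrow> (nat \<Rightarrow> real) \<Rightarrow> (nat \<Rightarrow> real) measure" where
  "gaussian_vec p \<sigma> m =
     (\<Pi>\<^sub>M j\<in>{1..p}. density lborel (\<lambda>x. ennreal (normal_density (m j) \<sigma> x)))"

text \<open>The conditional law of the data \<open>Y\<close> given the labels \<open>k\<close> and the centres \<open>\<mu>\<close>.\<close>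

definition data_law ::
    "nat \<Rightarrow> nat \<Rightarrow> real \<Rightarrow> (nat \<Rightarrow> nat) \<Rightarrow> (nat \<Rightarrow> nat \<Rightarrow> real) \<Rightarrow> (nat \<Rightarrow> nat \<Rightarrow> real) measure" where
  "data_law n p \<sigma> k \<mu> = (\<Pi>\<^sub>M i\<in>{1..n}. gaussian_vec p \<sigma> (\<mu> (k i)))"

text \<open>The joint law of \<open>((k, \<mu>), Y)\<close>.\<close>

definition model ::
    "nat \<Rightarrow> nat \<Rightarrow> nat \<Rightarrow> real \<Rightarrow> real \<Rightarrow>
       (((nat \<Rightarrow> nat) \<times> (nat \<Rightarrow> nat \<Rightarrow> real)) \<times> (nat \<Rightarrow> nat \<Rightarrow> real)) measure" where
  "model n p K \<sigma> \<Delta> =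
     measure_pmf (pair_pmf (labels_pmf n K) (centres_pmf p K \<sigma> \<Delta>)) \<bind>
       (\<lambda>(k, \<mu>). return (count_space UNIV) (k, \<mu>) \<Otimes>\<^sub>M data_law n p \<sigma> k \<mu>)"

definition Mstar :: "(nat \<Rightarrow> nat) \<Rightarrow> nat \<Rightarrow> nat \<Rightarrow> real" where
  "Mstar k i j = of_bool (k i = k j)"

text \<open>Exponents of the monomials of total degree at most \<open>D\<close> in the variables
  \<open>Y i j\<close>, \<open>1 \<le> i \<le> n\<close>, \<open>1 \<le> j \<le> p\<close>. Over the infinite field \<open>\<real>\<close>, polynomials are
  identified with the functions they induce.\<close>

definition exponents_le :: "nat \<Rightarrow> nat \<Rightarrow> nat \<Rightarrow> (nat \<times> nat \<Rightarrow> nat) set" where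
  "exponents_le n p D =
     {\<alpha> \<in> ({1..n} \<times> {1..p}) \<rightarrow>\<^sub>E {..D}. (\<Sum>v\<in>{1..n} \<times> {1..p}. \<alpha> v) \<le> D}"

definition polys_le :: "nat \<Rightarrow> nat \<Rightarrow> nat \<Rightarrow> ((nat \<Rightarrow> nat \<Rightarrow> real) \<Rightarrow> real) set" where
  "polys_le n p D =
     {f. \<exists>c :: (nat \<times> nat \<Rightarrow> nat) \<Rightarrow> real. f =
       (\<lambda>Y. \<Sum>\<alpha>\<in>exponents_le n p D. c \<alpha> * (\<Prod>(i, j)\<in>{1..n} \<times> {1..p}. Y i j ^ \<alpha> (i, j)))}"

text \<open>The infimum is over families of polynomials. It is taken in \<open>\<real>\<close>: the values are
  nonnegative, and all the integrands are integrable, as Gaussian laws have finite moments.\<close>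

definition MMSE_le :: "nat \<Rightarrow> nat \<Rightarrow> nat \<Rightarrow> nat \<Rightarrow> real \<Rightarrow> real \<Rightarrow> real" where
  "MMSE_le D n p K \<sigma> \<Delta> =
     (INF f \<in> {f :: nat \<Rightarrow> nat \<Rightarrow> (nat \<Rightarrow> nat \<Rightarrow> real) \<Rightarrow> real. \<forall>i j. f i j \<in> polys_le n p D}.
        1 / (real n * (real n - 1)) *
        (\<Sum>(i, j)\<in>{(i, j) \<in> {1..n} \<times> {1..n}. i \<noteq> j}.
           \<integral>((k, \<mu>), Y). (f i j Y - Mstar k i j)\<^sup>2 \<partial>model n p K \<sigma> \<Delta>))"

definition zeta :: "nat \<Rightarrow> nat \<Rightarrow> nat \<Rightarrow> nat \<Rightarrow> real \<Rightarrow> real" where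
  "zeta D n p K \<Delta> =
     \<Delta> ^ 4 * real D ^ 8 * (1 + real D) ^ 4 / real p * max (real n / (real K)\<^sup>2) 1"

end

theory Submission
  imports Defs
begin

text \<open>
  The lower bound is a duality argument. Fix two points \<open>a \<noteq> b\<close>, let \<open>x\<close> be the indicator that
  they share a label, let \<open>X = E[Y | k, \<mu>] / \<sigma>\<close> be the normalised signal and
  \<open>Z = Y / \<sigma> - X\<close> the standard Gaussian noise. If a random variable \<open>W\<close> satisfies
  \<open>E[W f(Y)] = E[x f(Y)]\<close> for all polynomials \<open>f\<close> of degree at most \<open>D\<close>, then
  \<open>0 \<le> E (f - W)\<^sup>2\<close> turns into \<open>E (f - x)\<^sup>2 \<ge> E x\<^sup>2 - E W\<^sup>2\<close>. Following Schramm and Wein, the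
  certificate is \<open>W = \<Sum>\<^sub>\<alpha> \<kappa>\<^sub>\<alpha> / \<alpha>! He\<^sub>\<alpha>(Z)\<close>, a function of the noise alone. Integrating
  \<open>W He\<^sub>\<alpha>(X + Z)\<close> over the noise shows that the requirement on \<open>W\<close> is the triangular system
  \<open>\<Sum>\<^sub>\<beta>\<^sub>\<le>\<^sub>\<alpha> binom(\<alpha>, \<beta>) \<kappa>\<^sub>\<beta> E X\<^bsup>\<alpha>-\<beta>\<^esup> = E[x X\<^sup>\<alpha>]\<close>, so that \<open>\<kappa>\<^sub>\<alpha>\<close> is the joint cumulant of
  \<open>x\<close> with the entries of \<open>X\<close> listed by \<open>\<alpha>\<close>, while orthogonality of Hermite polynomials gives
  \<open>E W\<^sup>2 = \<Sum>\<^sub>\<alpha> \<kappa>\<^sub>\<alpha>\<^sup>2 / \<alpha>!\<close>. This is \<open>mean_square_error_ge\<close>.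

  It remains to bound the cumulants. The index \<open>\<alpha>\<close> is a bipartite multigraph with
  \<open>m = |\<alpha>|\<close> edges between points and coordinates. Given the labels, the mean of a product of
  signs is 1 or 0 according to a parity condition, and it expands over the set partitions \<open>P\<close> of
  the edges into blocks that use a single coordinate and whose points carry the same label; each
  block is weighted by a cumulant of one random sign (\<open>even_classes_eq_sum_partitions\<close>). The
  cumulant \<open>\<kappa>\<^sub>\<alpha>\<close> expands accordingly, with the joint cumulant of \<open>x\<close> and the agreement events of
  the blocks as coefficient of \<open>P\<close>. That coefficient vanishes unless the blocks and the link
  \<open>a\<close>-\<open>b\<close> connect all points involved (\<open>block_cumulant_disconnected\<close>), and otherwise it is at
  most a combinatorial factor times the probability that all the events occur, because agreement
  events are positively correlated (\<open>agree_prob_mult_le\<close>). If \<open>r\<close> points are involved, \<open>a\<close>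
  and \<open>b\<close> included, this probability is \<open>K\<^bsup>-(r-1)\<^esup>\<close>.

  Odd cumulants of a sign vanish, so blocks have even size. Hence \<open>m\<close> is even and the number
  \<open>c\<close> of coordinates is at most \<open>m / 2\<close>; connectedness forces \<open>r - 2 + c \<le> m\<close>. There are about
  \<open>n\<^bsup>r-2\<^esup> p\<^sup>c\<close> multigraphs with these parameters, each contributing about
  \<open>K\<^bsup>-2(r-1)\<^esup> (\<Delta>\<^sup>2 / p)\<^sup>m\<close>. Since \<open>n \<le> p\<close>, the product is at most
  \<open>K\<^bsup>-2\<^esup> (\<Delta>\<^sup>4 / p max(n / K\<^sup>2, 1))\<^bsup>m/2\<^esup>\<close> (\<open>scaling_weight_le\<close>), and the factor
  \<open>D\<^sup>8 (1 + D)\<^sup>4\<close> in \<open>\<zeta>\<close> absorbs all combinatorial constants. Level \<open>m\<close> therefore contributes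
  at most \<open>\<zeta>\<^bsup>m/2\<^esup> / K\<^sup>2\<close> to \<open>E W\<^sup>2\<close>, the empty multigraph contributes exactly \<open>1 / K\<^sup>2\<close>, and a
  geometric series gives the first claim (\<open>cumulant_norm_le\<close>). The count of points compares
  powers of \<open>K\<close> and needs \<open>K \<ge> 2\<close>; for \<open>K = 1\<close> the bound is trivial.

  For the asymptotic claim, the constant estimator \<open>1 / K\<close> has error \<open>1 / K - 1 / K\<^sup>2\<close>. The
  relative error term is thus squeezed between 0 and \<open>\<zeta> / (1 - \<surd>\<zeta>)\<^sup>3\<close>, and \<open>\<zeta>\<close> is at most 16 times
  the square of the ratio that is assumed to vanish (\<open>zeta_le_ratio_square\<close>).
\<close>

section \<open>Set partitions and the cumulants of a random sign\<close>

text \<open>Choosing a partition of \<open>T\<close> and a subfamily \<open>Q\<close> of its blocks is the same as choosing the part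
  \<open>U\<close> of \<open>T\<close> covered by \<open>Q\<close> together with partitions of \<open>U\<close> and of \<open>T - U\<close>. This is what makes
  sums over partitions multiplicative for convolution over subsets.\<close>

lemma sum_partitions_split:
  fixes F G :: "'a set set \<Rightarrow> real"
  assumes T: "finite T"
  shows "(\<Sum>P | partition_on T P. \<Sum>Q\<in>Pow P. F Q * G (P - Q)) =
         (\<Sum>U\<in>Pow T. (\<Sum>Q | partition_on U Q. F Q) * (\<Sum>R | partition_on (T - U) R. G R))"
proof -
  have fin: "finite {P. partition_on U P}" if "U \<subseteq> T" for U
    using that T by (intro finitely_many_partition_on) (rule finite_subset)
  have finP: "finite P" if "partition_on T P" for P
    using that T by (metis finite_elements)
  have "(\<Sum>P | partition_on T P. \<Sum>Q\<in>Pow P. F Q * G (P - Q)) =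
        (\<Sum>(P,Q)\<in>(SIGMA P:{P. partition_on T P}. Pow P). F Q * G (P - Q))"
    using fin[of T] finP by (intro sum.Sigma) auto
  also have "\<dots> = (\<Sum>(U,Q,R)\<in>(SIGMA U:Pow T. {Q. partition_on U Q} \<times> {R. partition_on (T-U) R}). F Q * G R)"
  proof (rule sum.reindex_bij_witness[where i="\<lambda>(U,Q,R). (Q \<union> R, Q)" and j="\<lambda>(P,Q). (\<Union>Q, Q, P - Q)"], goal_cases)
    case (1 a) then show ?case by auto
  next
    case (2 a)
    obtain P Q where a: "a = (P,Q)" and P: "partition_on T P" and Q: "Q \<subseteq> P" using 2 by auto
    have *: "\<Union>(P - Q) = T - \<Union>Q"
    proof
      show "T - \<Union>Q \<subseteq> \<Union>(P - Q)" using P unfolding partition_on_def by auto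
      show "\<Union>(P - Q) \<subseteq> T - \<Union>Q"
      proof
        fix t assume "t \<in> \<Union>(P - Q)"
        then obtain B where B: "B \<in> P" "B \<notin> Q" "t \<in> B" by auto
        have "t \<notin> C" if "C \<in> Q" for C
        proof
          assume "t \<in> C"
          then have "C = B" using B that Q P unfolding partition_on_def disjoint_def by blast
          then show False using that B by simp
        qed
        then show "t \<in> T - \<Union>Q" using B P unfolding partition_on_def by auto
      qed
    qed
    have "disjoint Q" "disjoint (P - Q)" "{} \<notin> Q" "{} \<notin> P - Q"
      using P Q pairwise_subset[of disjnt P Q] pairwise_subset[of disjnt P "P - Q"]
      unfolding partition_on_def by auto
    then have "partition_on (\<Union>Q) Q" "partition_on (T - \<Union>Q) (P - Q)"
      using * unfolding partition_on_def by auto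
    moreover have "\<Union>Q \<subseteq> T" using P Q unfolding partition_on_def by auto
    ultimately show ?case using a by simp
  next
    case (3 b)
    obtain U Q R where b: "b = (U,Q,R)" and U: "U \<subseteq> T" and Q: "partition_on U Q" and R: "partition_on (T-U) R"
      using 3 by auto
    have 1: "\<Union>Q = U" "\<Union>R = T-U" using Q R unfolding partition_on_def by auto
    have "x \<notin> R" if x: "x \<in> Q" for x
    proof
      assume "x \<in> R"
      then have "x \<subseteq> U \<inter> (T-U)" using x 1 by auto
      then show False using Q x unfolding partition_on_def by auto
    qed
    then have "Q \<inter> R = {}" by auto
    then show ?case using b 1 by auto
  next
    case (4 b)
    obtain U Q R where b: "b = (U,Q,R)" and U: "U \<subseteq> T" and Q: "partition_on U Q" and R: "partition_on (T-U) R"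
      using 4 by auto
    have "disjoint (Q \<union> R)" using Q R by (intro disjoint_union) (auto simp: partition_on_def)
    then have "partition_on (U \<union> (T-U)) (Q \<union> R)"
      using Q R by (auto simp: partition_on_def)
    moreover have "U \<union> (T-U) = T" using U by auto
    ultimately show ?case using b by auto
  next
    case (5 a) then show ?case by auto
  qed
  also have "\<dots> = (\<Sum>U\<in>Pow T. \<Sum>(Q,R)\<in>{Q. partition_on U Q} \<times> {R. partition_on (T-U) R}. F Q * G R)"
    using T fin by (subst sum.Sigma) (auto simp: finite_subset)
  also have "\<dots> = (\<Sum>U\<in>Pow T. (\<Sum>Q | partition_on U Q. F Q) * (\<Sum>R | partition_on (T - U) R. G R))"
    by (simp add: sum_product sum.cartesian_product)
  finally show ?thesis .
qed

text \<open>Splitting off the block that contains a fixed element \<open>e\<close> gives the recursion behind all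
  inductions on partitions below.\<close>

lemma sum_partitions_rooted:
  fixes g :: "'a set \<Rightarrow> real"
  assumes T: "finite T" and e: "e \<in> T"
  shows "(\<Sum>P | partition_on T P. \<Prod>B\<in>P. g B) =
         (\<Sum>B | e \<in> B \<and> B \<subseteq> T. g B * (\<Sum>P | partition_on (T - B) P. \<Prod>B\<in>P. g B))"
proof -
  have fin: "finite {P. partition_on U P}" if "U \<subseteq> T" for U
    using that T by (intro finitely_many_partition_on) (rule finite_subset)
  define blk where "blk P = (THE B. B \<in> P \<and> e \<in> B)" for P :: "'a set set"
  have blk: "blk P = B" if "partition_on T P" "B \<in> P" "e \<in> B" for P B
    unfolding blk_def using that unfolding partition_on_def disjoint_def
    by (intro the_equality) auto
  have ex: "\<exists>B\<in>P. e \<in> B" if "partition_on T P" for P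
    using that e unfolding partition_on_def by auto
  have "(\<Sum>P | partition_on T P. \<Prod>B\<in>P. g B) =
        (\<Sum>(B,P)\<in>(SIGMA B:{B. e \<in> B \<and> B \<subseteq> T}. {P. partition_on (T-B) P}). g B * (\<Prod>B\<in>P. g B))"
  proof (rule sum.reindex_bij_witness[where i="\<lambda>(B,P). insert B P" and j="\<lambda>P. (blk P, P - {blk P})"], goal_cases)
    case (1 P)
    then have P: "partition_on T P" by simp
    obtain B where B: "B \<in> P" "e \<in> B" using ex[OF P] by auto
    show ?case using blk[OF P B] B by auto
  next
    case (2 P)
    then have P: "partition_on T P" by simp
    obtain B where B: "B \<in> P" "e \<in> B" using ex[OF P] by auto
    have bB: "blk P = B" by (rule blk[OF P B])
    have "partition_on (T - B) (P - {B})" using P B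
      unfolding partition_on_def disjoint_def by auto
    moreover have "B \<subseteq> T" using P B unfolding partition_on_def by auto
    ultimately show ?case using bB B by auto
  next
    case (3 x)
    obtain B P where x: "x = (B,P)" and B: "e \<in> B" "B \<subseteq> T" and P: "partition_on (T-B) P" using 3 by auto
    have I: "partition_on T (insert B P)"
      using P B unfolding partition_on_def disjoint_def by auto
    have "B \<notin> P" using P B unfolding partition_on_def by auto
    then show ?case using x blk[OF I _ B(1)] by auto
  next
    case (4 x)
    obtain B P where x: "x = (B,P)" and B: "e \<in> B" "B \<subseteq> T" and P: "partition_on (T-B) P" using 4 by auto
    have I: "partition_on T (insert B P)"
      using P B unfolding partition_on_def disjoint_def by auto
    then show ?case using x by auto
  next
    case (5 P)
    then have P: "partition_on T P" by simp
    obtain B where B: "B \<in> P" "e \<in> B" using ex[OF P] by auto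
    have bB: "blk P = B" by (rule blk[OF P B])
    have "finite P" using P T by (metis finite_elements)
    then show ?case using B bB by (simp add: prod.remove[of P B])
  qed
  also have "\<dots> = (\<Sum>B | e \<in> B \<and> B \<subseteq> T. \<Sum>P | partition_on (T-B) P. g B * (\<Prod>B\<in>P. g B))"
    using T fin by (subst sum.Sigma) auto
  finally show ?thesis by (simp add: sum_distrib_left)
qed

lemma sum_subsets_containing_card:
  fixes f :: "nat \<Rightarrow> real"
  assumes T: "finite T" and e: "e \<in> T"
  shows "(\<Sum>B | e \<in> B \<and> B \<subseteq> T. f (card B)) =
         (\<Sum>b=1..card T. of_nat ((card T - 1) choose (b - 1)) * f b)"
proof -
  have fin: "finite {B. e \<in> B \<and> B \<subseteq> T}" using T by (auto intro: finite_subset[of _ "Pow T"])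
  have cnt: "card {B. (e \<in> B \<and> B \<subseteq> T) \<and> card B = b} = (card T - 1) choose (b-1)" if b: "b \<ge> 1" for b
  proof -
    have "bij_betw (insert e) {B. B \<subseteq> T - {e} \<and> card B = b - 1} {B. (e \<in> B \<and> B \<subseteq> T) \<and> card B = b}"
    proof (rule bij_betw_byWitness[where f'="\<lambda>B. B - {e}"], goal_cases)
      case 1 then show ?case by auto
    next
      case 2 then show ?case by auto
    next
      case 3 
      show ?case
      proof clarify
        fix B assume B: "B \<subseteq> T - {e}" "card B = b - 1"
        then have "finite B" "e \<notin> B" using T finite_subset by auto
        then show "(e \<in> insert e B \<and> insert e B \<subseteq> T) \<and> card (insert e B) = b" using B b e by auto
      qed
    next
      case 4 then show ?case using T by (auto simp: finite_subset)
    qed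
    then have "card {B. (e \<in> B \<and> B \<subseteq> T) \<and> card B = b} = card {B. B \<subseteq> T - {e} \<and> card B = b - 1}"
      by (rule bij_betw_same_card[symmetric])
    also have "\<dots> = card (T - {e}) choose (b-1)" using T by (intro n_subsets) auto
    finally show ?thesis using T e by simp
  qed
  have "(\<Sum>B | e \<in> B \<and> B \<subseteq> T. f (card B)) = 
        (\<Sum>b\<in>{1..card T}. \<Sum>B | B \<in> {B. e \<in> B \<and> B \<subseteq> T} \<and> card B = b. f (card B))"
  proof (rule sum.group[symmetric])
    show "card ` {B. e \<in> B \<and> B \<subseteq> T} \<subseteq> {1..card T}"
    proof clarify
      fix B assume B: "e \<in> B" "B \<subseteq> T"
      then have "finite B" using T finite_subset by auto
      then have "card B \<noteq> 0" using B by auto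
      then show "card B \<in> {1..card T}" using B T card_mono[of T B] by auto
    qed
  qed (use fin in auto)
  also have "\<dots> = (\<Sum>b\<in>{1..card T}. of_nat ((card T - 1) choose (b - 1)) * f b)"
  proof (rule sum.cong[OF refl])
    fix b assume "b \<in> {1..card T}"
    then have "card {B. (e \<in> B \<and> B \<subseteq> T) \<and> card B = b} = (card T - 1) choose (b-1)" using cnt by auto
    then show "(\<Sum>B | B \<in> {B. e \<in> B \<and> B \<subseteq> T} \<and> card B = b. f (card B)) = of_nat ((card T - 1) choose (b - 1)) * f b"
      by simp
  qed
  finally show ?thesis .
qed

text \<open>The cumulants of a uniform random sign: the recursion inverts the moment-cumulant formula for
  the moments \<open>1, 0, 1, 0, \<dots>\<close>, with \<open>b\<close> the size of the block of a distinguished element.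
  They are the derivatives of \<open>ln (cosh t)\<close> at 0, that is, tangent numbers with signs.\<close>

function sign_cumulant :: "nat \<Rightarrow> real" where
  "sign_cumulant q = of_bool (even q) -
     (\<Sum>b\<in>{1..<q}. of_nat ((q - 1) choose (b - 1)) * sign_cumulant b * of_bool (even (q - b)))"
  by auto
termination by (relation less_than) auto
declare sign_cumulant.simps[simp del]

lemma sign_cumulant_odd: "odd q \<Longrightarrow> sign_cumulant q = 0"
proof (induction q rule: less_induct)
  case (less q)
  have "(\<Sum>b\<in>{1..<q}. of_nat ((q - 1) choose (b - 1)) * sign_cumulant b * of_bool (even (q - b))) = 0"
  proof (rule sum.neutral, rule ballI)
    fix b assume b: "b \<in> {1..<q}"
    show "of_nat ((q - 1) choose (b - 1)) * sign_cumulant b * of_bool (even (q - b)) = 0"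
      using less b by (cases "even b") auto
  qed
  then show ?case using less.prems by (subst sign_cumulant.simps) auto
qed

lemma sign_cumulant_recursion:
  assumes "q \<ge> 1"
  shows "(\<Sum>b=1..q. of_nat ((q - 1) choose (b - 1)) * (sign_cumulant b * of_bool (even (q - b)))) = of_bool (even q)"
proof -
  have "{1..q} = insert q {1..<q}" using assms by auto
  then have "(\<Sum>b=1..q. of_nat ((q - 1) choose (b - 1)) * (sign_cumulant b * of_bool (even (q - b)))) =
     sign_cumulant q + (\<Sum>b\<in>{1..<q}. of_nat ((q - 1) choose (b - 1)) * sign_cumulant b * of_bool (even (q - b)))"
    by (simp add: mult.assoc)
  then show ?thesis using sign_cumulant.simps[of q] by linarith
qed

lemma fact_ge_two_power: "2 ^ n \<le> (fact (n + 1) :: real)"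
proof (induction n)
  case (Suc n)
  have "2 * 2 ^ n \<le> (real (n+2)) * fact (n+1)" using Suc by (intro mult_mono) auto
  also have "\<dots> = fact (Suc n + 1)" by simp
  finally show ?case by simp
qed simp

lemma sum_power_half: "(\<Sum>j=1..<J. (1/2) ^ j :: real) = 1 - (1/2) ^ (J - 1)" if "J \<ge> 1" for J
  using that
proof (induction J rule: dec_induct)
  case (step n)
  then have "{1..<Suc n} = insert n {1..<n}" by auto
  moreover have "(1/2::real) ^ (n - 1) = 2 * (1/2) ^ n" using step(1) by (cases n) auto
  ultimately show ?case using step by simp
qed simp

text \<open>By induction the recursion is dominated by \<open>1 + (q - 1)! \<Sum>\<^sub>j 1 / (2j)!\<close> with \<open>1 \<le> j < q / 2\<close>.
  Using \<open>(2j)! \<ge> 2\<^sup>j\<close>, the sum falls short of 1 by at least \<open>2\<^bsup>-(q/2-1)\<^esup>\<close>, which leaves room for the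
  leading 1.\<close>

lemma abs_sign_cumulant_le: "q \<ge> 1 \<Longrightarrow> \<bar>sign_cumulant q\<bar> \<le> fact (q - 1)"
proof (induction q rule: less_induct)
  case (less q)
  show ?case
  proof (cases "even q")
    case False then show ?thesis using sign_cumulant_odd[of q] by simp
  next
    case True
    then obtain h where q: "q = 2 * h" by (elim evenE)
    have h: "h \<ge> 1" using less.prems q by auto
    have "\<bar>\<Sum>b\<in>{1..<q}. of_nat ((q - 1) choose (b - 1)) * sign_cumulant b * of_bool (even (q - b))\<bar>
      \<le> (\<Sum>b\<in>{1..<q}. fact (q-1) / fact (q-b) * of_bool (even (q - b)))"
    proof (rule order_trans[OF sum_abs], rule sum_mono)
      fix b assume b: "b \<in> {1..<q}"
      have 1: "\<bar>sign_cumulant b\<bar> \<le> fact (b-1)" using less b by auto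
      have 2: "real ((q - 1) choose (b - 1)) * fact (b-1) = fact (q-1) / fact (q-b)"
        using b by (subst binomial_fact) (auto simp: field_simps)
      show "\<bar>of_nat ((q - 1) choose (b - 1)) * sign_cumulant b * of_bool (even (q - b))\<bar>
         \<le> fact (q-1) / fact (q-b) * of_bool (even (q - b))"
        unfolding 2[symmetric] abs_mult using 1 by (intro mult_right_mono mult_mono) auto
    qed
    also have "\<dots> = (\<Sum>b\<in>{b\<in>{1..<q}. even (q-b)}. fact (q-1) / fact (q-b))"
      by (subst sum.inter_filter) (auto intro!: sum.cong)
    also have "\<dots> = (\<Sum>j\<in>{1..<h}. fact (q-1) / fact (2*j))"
      by (rule sum.reindex_bij_witness[where i="\<lambda>j. q - 2*j" and j="\<lambda>b. (q-b) div 2"])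
         (auto simp: q)
    also have "\<dots> \<le> (\<Sum>j\<in>{1..<h}. fact (q-1) * (1/2)^j)"
    proof (rule sum_mono)
      fix j assume j: "j \<in> {1..<h}"
      have "2*j-1+1 = 2*j" using j by simp
      have "(2::real)^j \<le> 2^(2*j-1)" using j by (intro power_increasing) auto
      also have "\<dots> \<le> fact (2*j)" using fact_ge_two_power[of "2*j-1"] \<open>2*j-1+1 = 2*j\<close> by metis
      finally show "fact (q-1) / fact (2*j) \<le> (fact (q-1) * (1/2)^j :: real)"
        by (simp add: field_simps power_divide)
    qed
    also have "\<dots> = fact (q-1) * (1 - (1/2) ^ (h - 1))"
      using sum_power_half[OF h] by (simp add: sum_distrib_left[symmetric])
    finally have A: "\<bar>\<Sum>b\<in>{1..<q}. of_nat ((q - 1) choose (b - 1)) * sign_cumulant b * of_bool (even (q - b))\<bar>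
      \<le> fact (q-1) - fact (q-1) * (1/2) ^ (h - 1)" by (simp add: algebra_simps)
    have "(2::real) ^ (h-1) \<le> 2 ^ (q-2)" using q by (intro power_increasing) auto
    also have "\<dots> \<le> fact (q-1)" using fact_ge_two_power[of "q-2"] q h by (simp add: Suc_diff_Suc numeral_2_eq_2)
    finally have B: "1 \<le> fact (q-1) * (1/2::real) ^ (h - 1)" by (simp add: field_simps power_divide)
    show ?thesis using A B True by (subst sign_cumulant.simps) (simp add: abs_le_iff)
  qed
qed

text \<open>The moment-cumulant formula for a product of independent signs, one sign per colour: the
  right-hand side is the mean of the product over \<open>T\<close> of the sign of the colour of \<open>t\<close>.
  A block may not mix colours because joint cumulants of independent variables vanish; in the
  induction, the block of \<open>e\<close> stays inside the colour class of \<open>e\<close> and leaves the other classes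
  untouched.\<close>

lemma even_classes_eq_sum_partitions:
  fixes clr :: "'a \<Rightarrow> 'c"
  assumes "finite T"
  shows "(\<Sum>P | partition_on T P. \<Prod>B\<in>P. sign_cumulant (card B) * of_bool (\<forall>s\<in>B. \<forall>t\<in>B. clr s = clr t)) =
    of_bool (\<forall>c. even (card {t\<in>T. clr t = c}))"
  using assms
proof (induction "card T" arbitrary: T rule: less_induct)
  case less
  let ?g = "\<lambda>B. sign_cumulant (card B) * of_bool (\<forall>s\<in>B. \<forall>t\<in>B. clr s = clr t)"
  note T = \<open>finite T\<close>
  show ?case
  proof (cases "T = {}")
    case True
    have "{P. partition_on {} P} = {{}}" by (auto simp: partition_on_empty)
    then have "{P. partition_on T P} = {{}}" using True by simp
    then show ?thesis using True by simp
  next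
    case False
    then obtain e where e: "e \<in> T" by auto
    have split_off: "(\<forall>c. Q c) \<longleftrightarrow> Q c0 \<and> (\<forall>c. c \<noteq> c0 \<longrightarrow> Q c)" for Q :: "'c \<Rightarrow> bool" and c0
      by metis
    define C where "C = {t\<in>T. clr t = clr e}"
    have C: "finite C" "e \<in> C" "C \<subseteq> T" using T e by (auto simp: C_def)
    define others where "others = (\<forall>c. c \<noteq> clr e \<longrightarrow> even (card {t\<in>T. clr t = c}))"
    have "(\<Sum>P | partition_on T P. \<Prod>B\<in>P. ?g B) =
       (\<Sum>B | e \<in> B \<and> B \<subseteq> T. ?g B * (\<Sum>P | partition_on (T - B) P. \<Prod>B\<in>P. ?g B))"
      by (rule sum_partitions_rooted[OF T e])
    also have "\<dots> = (\<Sum>B | e \<in> B \<and> B \<subseteq> T. ?g B * of_bool (\<forall>c. even (card {t\<in>T-B. clr t = c})))"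
    proof (rule sum.cong[OF refl])
      fix B assume B: "B \<in> {B. e \<in> B \<and> B \<subseteq> T}"
      then have "card (T - B) < card T" using T e by (intro psubset_card_mono) auto
      then show "?g B * (\<Sum>P | partition_on (T - B) P. \<Prod>B\<in>P. ?g B) = ?g B * of_bool (\<forall>c. even (card {t\<in>T-B. clr t = c}))"
        using less.hyps[of "T-B"] T by simp
    qed
    also have "\<dots> = (\<Sum>B | e \<in> B \<and> B \<subseteq> C. ?g B * of_bool (\<forall>c. even (card {t\<in>T-B. clr t = c})))"
      using T by (intro sum.mono_neutral_right) (auto simp: C_def intro: finite_subset[of _ "Pow T"])
    also have "\<dots> = (\<Sum>B | e \<in> B \<and> B \<subseteq> C. sign_cumulant (card B) * of_bool (even (card C - card B)) * of_bool others)"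
    proof (rule sum.cong[OF refl])
      fix B assume B: "B \<in> {B. e \<in> B \<and> B \<subseteq> C}"
      have "clr s = clr e" if "s \<in> B" for s using B that by (auto simp: C_def)
      then have 1: "(\<forall>s\<in>B. \<forall>t\<in>B. clr s = clr t) \<longleftrightarrow> True" by simp
      have 2: "{t\<in>T-B. clr t = clr e} = C - B" by (auto simp: C_def)
      have 3: "{t\<in>T-B. clr t = c} = {t\<in>T. clr t = c}" if "c \<noteq> clr e" for c using B that by (auto simp: C_def)
      have fB: "finite B" using B C(1) finite_subset by auto
      from split_off[of "\<lambda>c. even (card {t\<in>T-B. clr t = c})" "clr e"]
      have "(\<forall>c. even (card {t\<in>T-B. clr t = c})) \<longleftrightarrow>
          even (card {t\<in>T-B. clr t = clr e}) \<and> (\<forall>c. c \<noteq> clr e \<longrightarrow> even (card {t\<in>T-B. clr t = c}))" .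
      also have "\<dots> \<longleftrightarrow> even (card (C - B)) \<and> others"
        unfolding others_def using 2 3 by simp
      also have "card (C - B) = card C - card B" using card_Diff_subset[OF fB, of C] B by blast
      finally have "(\<forall>c. even (card {t\<in>T-B. clr t = c})) \<longleftrightarrow> even (card C - card B) \<and> others" .
      then show "?g B * of_bool (\<forall>c. even (card {t\<in>T-B. clr t = c})) =
         sign_cumulant (card B) * of_bool (even (card C - card B)) * of_bool others"
        unfolding 1 by simp
    qed
    also have "\<dots> = (\<Sum>B | e \<in> B \<and> B \<subseteq> C. (\<lambda>b. sign_cumulant b * of_bool (even (card C - b))) (card B)) * of_bool others"
      by (simp add: sum_distrib_right)
    also have "\<dots> = of_bool (even (card C)) * of_bool others"
    proof -
      have "card C \<ge> 1" using C by (auto simp: Suc_le_eq card_gt_0_iff)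
      then show ?thesis
        using sum_subsets_containing_card[OF C(1,2), of "\<lambda>b. sign_cumulant b * of_bool (even (card C - b))"]
        by (simp only: sign_cumulant_recursion)
    qed
    also have "\<dots> = of_bool (even (card C) \<and> others)" by simp
    also have "even (card C) \<and> others \<longleftrightarrow> (\<forall>c. even (card {t\<in>T. clr t = c}))"
      unfolding others_def C_def by (rule split_off[of "\<lambda>c. even (card {t\<in>T. clr t = c})", symmetric])
    finally show ?thesis .
  qed
qed

text \<open>With block weights at most \<open>(b - 1)!\<close> and the induction hypothesis, each size \<open>b\<close> of the root
  block contributes at most \<open>(q - 1)!\<close> for \<open>q = card T\<close>, and there are \<open>q\<close> sizes.\<close>

lemma sum_partitions_abs_sign_cumulant_le:
  assumes "finite T"
  shows "(\<Sum>P | partition_on T P. \<Prod>B\<in>P. \<bar>sign_cumulant (card B)\<bar>) \<le> fact (card T)"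
  using assms
proof (induction "card T" arbitrary: T rule: less_induct)
  case less
  note T = \<open>finite T\<close>
  show ?case
  proof (cases "T = {}")
    case True
    have "{P. partition_on {} P} = {{}}" by (auto simp: partition_on_empty)
    then have "{P. partition_on T P} = {{}}" using True by simp
    then show ?thesis using True by simp
  next
    case False
    then obtain e where e: "e \<in> T" by auto
    then have q: "card T \<ge> 1" using T by (auto simp: Suc_le_eq card_gt_0_iff)
    have "(\<Sum>P | partition_on T P. \<Prod>B\<in>P. \<bar>sign_cumulant (card B)\<bar>) =
       (\<Sum>B | e \<in> B \<and> B \<subseteq> T. \<bar>sign_cumulant (card B)\<bar> * (\<Sum>P | partition_on (T - B) P. \<Prod>B\<in>P. \<bar>sign_cumulant (card B)\<bar>))"
      by (rule sum_partitions_rooted[OF T e])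
    also have "\<dots> \<le> (\<Sum>B | e \<in> B \<and> B \<subseteq> T. (\<lambda>b. fact (b - 1) * fact (card T - b)) (card B))"
    proof (rule sum_mono)
      fix B assume B: "B \<in> {B. e \<in> B \<and> B \<subseteq> T}"
      have fB: "finite B" using B T finite_subset by auto
      have c: "card B \<ge> 1" using B fB by (auto simp: Suc_le_eq card_gt_0_iff)
      have "card (T - B) < card T" using B T e by (intro psubset_card_mono) auto
      then have "(\<Sum>P | partition_on (T - B) P. \<Prod>B\<in>P. \<bar>sign_cumulant (card B)\<bar>) \<le> fact (card (T-B))"
        using less.hyps[of "T-B"] T by simp
      also have "card (T-B) = card T - card B" using card_Diff_subset[OF fB, of T] B by auto
      finally have 1: "(\<Sum>P | partition_on (T - B) P. \<Prod>B\<in>P. \<bar>sign_cumulant (card B)\<bar>) \<le> fact (card T - card B)" .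
      show "\<bar>sign_cumulant (card B)\<bar> * (\<Sum>P | partition_on (T - B) P. \<Prod>B\<in>P. \<bar>sign_cumulant (card B)\<bar>)
         \<le> (\<lambda>b. fact (b - 1) * fact (card T - b)) (card B)"
        using abs_sign_cumulant_le[OF c] 1 by (simp, intro mult_mono) (auto intro!: sum_nonneg prod_nonneg)
    qed
    also have "\<dots> = (\<Sum>b=1..card T. of_nat ((card T - 1) choose (b - 1)) * (fact (b - 1) * fact (card T - b)))"
      by (rule sum_subsets_containing_card[OF T e])
    also have "\<dots> = (\<Sum>b=1..card T. fact (card T - 1))"
    proof (rule sum.cong[OF refl])
      fix b assume b: "b \<in> {1..card T}"
      then show "of_nat ((card T - 1) choose (b - 1)) * (fact (b - 1) * fact (card T - b)) = (fact (card T - 1) :: real)"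
        by (subst binomial_fact) (auto simp: field_simps)
    qed
    also have "\<dots> = fact (card T)" using q by (cases "card T") auto
    finally show ?thesis .
  qed
qed

section \<open>Agreement events of uniform labellings\<close>

definition labellings :: "nat \<Rightarrow> nat \<Rightarrow> (nat \<Rightarrow> nat) set" where
  "labellings n K = {1..n} \<rightarrow>\<^sub>E {1..K}"

definition respecting :: "nat \<Rightarrow> nat \<Rightarrow> (nat \<times> nat) set \<Rightarrow> (nat \<Rightarrow> nat) set" where
  "respecting n K R = {k \<in> labellings n K. \<forall>(i, j) \<in> R. k i = k j}"

definition agree_prob :: "nat \<Rightarrow> nat \<Rightarrow> (nat \<times> nat) set \<Rightarrow> real" where
  "agree_prob n K R = real (card (respecting n K R)) / real K ^ n"

lemma card_eq_sum_fibres: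
  assumes "finite S" "finite T" "f ` S \<subseteq> T"
  shows "card S = (\<Sum>y\<in>T. card {x \<in> S. f x = y})"
  using sum.group[OF assms, of "\<lambda>_. 1::nat"] by simp

lemma finite_labellings [simp]: "finite (labellings n K)"
  by (simp add: labellings_def finite_PiE)

lemma card_labellings: "card (labellings n K) = K ^ n"
  by (simp add: labellings_def card_PiE)

lemma finite_respecting [simp]: "finite (respecting n K R)"
  by (simp add: respecting_def)

lemma agree_prob_empty: "K \<ge> 1 \<Longrightarrow> agree_prob n K {} = 1"
  by (simp add: agree_prob_def respecting_def card_labellings)

lemma agree_prob_nonneg: "agree_prob n K R \<ge> 0"
  by (simp add: agree_prob_def)

lemma agree_prob_forced:
  assumes "\<And>k. k \<in> respecting n K R \<Longrightarrow> k i = k j"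
  shows "agree_prob n K (insert (i, j) R) = agree_prob n K R"
proof -
  have "respecting n K (insert (i, j) R) = respecting n K R"
    using assms unfolding respecting_def by auto
  then show ?thesis by (simp add: agree_prob_def)
qed

text \<open>If the pairs in \<open>R\<close> do not force \<open>i\<close> and \<open>j\<close> to agree, some labelling \<open>k0\<close> separates them, and
  its level set \<open>U\<close> through \<open>i\<close> is a union of connected components of \<open>R\<close>. Swapping two labels on
  \<open>U\<close> alone preserves \<open>R\<close>, so given the label of \<open>j\<close> all labels of \<open>i\<close> are equally likely.\<close>

lemma agree_prob_free:
  assumes R: "R \<subseteq> {1..n} \<times> {1..n}" and ij: "i \<in> {1..n}" "j \<in> {1..n}"
    and K: "K \<ge> 1" and k0: "k0 \<in> respecting n K R" "k0 i \<noteq> k0 j"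
  shows "agree_prob n K (insert (i, j) R) = agree_prob n K R / K"
proof -
  \<comment> \<open>a union of components of \<open>R\<close> that contains \<open>i\<close> but not \<open>j\<close>\<close>
  define U where "U = {l\<in>{1..n}. k0 l = k0 i}"
  define N where "N c d = card {k \<in> respecting n K R. k i = c \<and> k j = d}" for c d
  define sw where "sw c d k = (\<lambda>l. if l \<in> U then (if k l = c then d else if k l = d then c else k l) else k l)" for c d :: nat and k :: "nat \<Rightarrow> nat"
  have iU: "i \<in> U" "j \<notin> U" using ij k0 by (auto simp: U_def)
  have UR: "l \<in> U \<longleftrightarrow> l' \<in> U" if "(l, l') \<in> R" for l l'
    using that R k0 unfolding U_def respecting_def by auto
  have inv: "sw c d (sw c d k) = k" for c d k by (auto simp: sw_def)
  have sw_i: "sw c d k i = (if k i = c then d else if k i = d then c else k i)" for c d k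
    using iU by (simp add: sw_def)
  have sw_j: "sw c d k j = k j" for c d k using iU by (simp add: sw_def)
  have resp: "sw c d k \<in> respecting n K R" if "k \<in> respecting n K R" "c \<in> {1..K}" "d \<in> {1..K}" for c d k
  proof -
    have "sw c d k \<in> labellings n K"
      using that unfolding sw_def respecting_def labellings_def U_def
      by (auto simp: PiE_iff extensional_def)
    moreover have "\<forall>(l, l') \<in> R. sw c d k l = sw c d k l'"
      using that(1) UR unfolding sw_def respecting_def by auto
    ultimately show ?thesis by (simp add: respecting_def)
  qed
  have N: "N c d = N d d" if "c \<in> {1..K}" "d \<in> {1..K}" for c d
  proof -
    have "bij_betw (sw c d) {k \<in> respecting n K R. k i = c \<and> k j = d} {k \<in> respecting n K R. k i = d \<and> k j = d}"
    proof (rule bij_betw_byWitness[where f'="sw c d"], goal_cases)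
      case 3 show ?case using resp[OF _ that] sw_i sw_j by fastforce
    next
      case 4 show ?case using resp[OF _ that] sw_i sw_j by fastforce
    qed (simp_all add: inv)
    then show ?thesis unfolding N_def by (rule bij_betw_same_card)
  qed
  have im: "k i \<in> {1..K}" "k j \<in> {1..K}" if "k \<in> respecting n K R" for k
    using that ij by (auto simp: respecting_def labellings_def PiE_iff)
  have "card (respecting n K R) = (\<Sum>d\<in>{1..K}. card {k \<in> respecting n K R. k j = d})"
    by (rule card_eq_sum_fibres) (use im in auto)
  also have "\<dots> = (\<Sum>d\<in>{1..K}. \<Sum>c\<in>{1..K}. N c d)"
  proof (rule sum.cong[OF refl])
    fix d
    have "card {k \<in> respecting n K R. k j = d} = (\<Sum>c\<in>{1..K}. card {k \<in> {k \<in> respecting n K R. k j = d}. k i = c})"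
      by (rule card_eq_sum_fibres) (use im in auto)
    also have "\<dots> = (\<Sum>c\<in>{1..K}. N c d)"
      unfolding N_def by (intro sum.cong refl arg_cong[where f=card]) blast
    finally show "card {k \<in> respecting n K R. k j = d} = (\<Sum>c\<in>{1..K}. N c d)" .
  qed
  also have "\<dots> = (\<Sum>d\<in>{1..K}. \<Sum>c\<in>{1..K}. N d d)"
    by (intro sum.cong refl) (rule N, auto)
  also have "\<dots> = K * (\<Sum>d\<in>{1..K}. N d d)" by (simp add: sum_distrib_left)
  also have "(\<Sum>d\<in>{1..K}. N d d) = (\<Sum>d\<in>{1..K}. card {k \<in> respecting n K (insert (i,j) R). k i = d})"
    unfolding N_def by (intro sum.cong refl arg_cong[where f=card]) (auto simp: respecting_def)
  also have "\<dots> = card (respecting n K (insert (i,j) R))"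
    by (rule card_eq_sum_fibres[symmetric]) (use im in \<open>auto simp: respecting_def\<close>)
  finally show ?thesis using K by (simp add: agree_prob_def field_simps)
qed

lemma agree_prob_insert_ge:
  assumes R: "R \<subseteq> {1..n} \<times> {1..n}" and ij: "i \<in> {1..n}" "j \<in> {1..n}" and K: "K \<ge> 1"
  shows "agree_prob n K (insert (i, j) R) \<ge> agree_prob n K R / K"
proof (cases "\<exists>k0\<in>respecting n K R. k0 i \<noteq> k0 j")
  case True then show ?thesis using agree_prob_free[OF R ij K] by auto
next
  case False
  then have "agree_prob n K (insert (i, j) R) = agree_prob n K R" by (intro agree_prob_forced) auto
  moreover have "agree_prob n K R / K \<le> agree_prob n K R / 1"
    using K agree_prob_nonneg by (intro divide_left_mono) auto
  ultimately show ?thesis by simp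
qed

lemma agree_prob_ge_card:
  assumes "finite R" "R \<subseteq> {1..n} \<times> {1..n}" "K \<ge> 1"
  shows "agree_prob n K R \<ge> 1 / real K ^ card R"
  using assms(1,2)
proof (induction R rule: finite_induct)
  case empty then show ?case using agree_prob_empty[OF assms(3)] by simp
next
  case (insert x R)
  obtain i j where x: "x = (i, j)" by (cases x)
  have "1 / real K ^ card (insert x R) = 1 / real K ^ card R / K" using insert by simp
  also have "\<dots> \<le> agree_prob n K R / K" using insert by (intro divide_right_mono) auto
  also have "\<dots> \<le> agree_prob n K (insert x R)"
    unfolding x using insert.prems x assms(3) by (intro agree_prob_insert_ge) auto
  finally show ?case .
qed

text \<open>Positive correlation of agreement events. Adding a pair to \<open>T\<close> either changes nothing, because it
  is forced, or divides the probability of \<open>T\<close> by exactly \<open>K\<close>, whereas it never divides the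
  probability of \<open>S \<union> T\<close> by more than \<open>K\<close>.\<close>

lemma agree_prob_mult_le:
  assumes "finite T" "T \<subseteq> {1..n} \<times> {1..n}" "S \<subseteq> {1..n} \<times> {1..n}" "K \<ge> 1"
  shows "agree_prob n K S * agree_prob n K T \<le> agree_prob n K (S \<union> T)"
  using assms(1,2)
proof (induction T rule: finite_induct)
  case empty then show ?case using agree_prob_empty[OF assms(4)] by simp
next
  case (insert x T)
  obtain i j where x: "x = (i, j)" by (cases x)
  have ij: "i \<in> {1..n}" "j \<in> {1..n}" using insert.prems x by auto
  have T: "T \<subseteq> {1..n} \<times> {1..n}" using insert.prems by auto
  show ?case
  proof (cases "\<exists>k0\<in>respecting n K T. k0 i \<noteq> k0 j")
    case True
    then obtain k0 where k0: "k0 \<in> respecting n K T" "k0 i \<noteq> k0 j" by auto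
    have "agree_prob n K S * agree_prob n K (insert x T) = agree_prob n K S * agree_prob n K T / K"
      using agree_prob_free[OF T ij assms(4) k0] x by simp
    also have "\<dots> \<le> agree_prob n K (S \<union> T) / K"
      using insert by (intro divide_right_mono) auto
    also have "\<dots> \<le> agree_prob n K (insert x (S \<union> T))"
      unfolding x using assms T ij by (intro agree_prob_insert_ge) auto
    finally show ?thesis by simp
  next
    case False
    have "agree_prob n K (insert (i, j) T) = agree_prob n K T"
      using False by (intro agree_prob_forced) auto
    moreover have "agree_prob n K (insert (i, j) (S \<union> T)) = agree_prob n K (S \<union> T)"
      using False by (intro agree_prob_forced) (auto simp: respecting_def)
    ultimately show ?thesis using insert x by simp
  qed
qed

text \<open>Independence: a pair outside \<open>U\<close> is forced by \<open>S \<union> T\<close> iff it is forced by \<open>T\<close>, since a labelling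
  that separates it can be made constant on \<open>U\<close>.\<close>

lemma agree_prob_disjoint:
  assumes "finite T" "T \<subseteq> ({1..n} - U) \<times> ({1..n} - U)" "S \<subseteq> U \<times> U" "U \<subseteq> {1..n}" "K \<ge> 1"
  shows "agree_prob n K (S \<union> T) = agree_prob n K S * agree_prob n K T"
  using assms(1,2)
proof (induction T rule: finite_induct)
  case empty then show ?case using agree_prob_empty[OF assms(5)] by simp
next
  case (insert x T)
  obtain i j where x: "x = (i, j)" by (cases x)
  have ij: "i \<in> {1..n}" "j \<in> {1..n}" "i \<notin> U" "j \<notin> U" using insert.prems x by auto
  have T: "T \<subseteq> {1..n} \<times> {1..n}" "T \<subseteq> ({1..n} - U) \<times> ({1..n} - U)" using insert.prems by auto
  have S: "S \<subseteq> {1..n} \<times> {1..n}" using assms by auto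
  show ?case
  proof (cases "\<exists>k0\<in>respecting n K T. k0 i \<noteq> k0 j")
    case True
    then obtain k0 where k0: "k0 \<in> respecting n K T" "k0 i \<noteq> k0 j" by auto
    \<comment> \<open>still separates \<open>i\<close> from \<open>j\<close>, and respects \<open>S\<close> because it is constant on \<open>U\<close>\<close>
    define k1 where "k1 = (\<lambda>l. if l \<in> U then 1 else k0 l)"
    have "k1 \<in> labellings n K" using k0 assms(4,5) unfolding k1_def respecting_def labellings_def
      by (auto simp: PiE_iff extensional_def)
    moreover have "\<forall>(l, l') \<in> S \<union> T. k1 l = k1 l'"
      using k0 T assms(3) unfolding k1_def respecting_def by auto
    ultimately have k1: "k1 \<in> respecting n K (S \<union> T)" by (simp add: respecting_def)
    have k1': "k1 i \<noteq> k1 j" using k0 ij by (simp add: k1_def)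
    have "agree_prob n K (insert (i,j) (S \<union> T)) = agree_prob n K (S \<union> T) / K"
      using T S ij k1' by (intro agree_prob_free[OF _ _ _ assms(5) k1]) auto
    then show ?thesis
      using agree_prob_free[OF T(1) ij(1,2) assms(5) k0] x insert.IH[OF T(2)] by simp
  next
    case False
    have "agree_prob n K (insert (i, j) T) = agree_prob n K T"
      using False by (intro agree_prob_forced) auto
    moreover have "agree_prob n K (insert (i, j) (S \<union> T)) = agree_prob n K (S \<union> T)"
      using False by (intro agree_prob_forced) (auto simp: respecting_def)
    ultimately show ?thesis using insert.IH[OF T(2)] x by simp
  qed
qed

text \<open>A labelling that is constant on \<open>U\<close> is determined by its values outside \<open>U\<close> and at \<open>u\<close>.\<close>

lemma agree_prob_connected_le:
  assumes U: "U \<subseteq> {1..n}" "u \<in> U" and K: "K \<ge> 1"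
    and const: "\<And>k l. k \<in> respecting n K R \<Longrightarrow> l \<in> U \<Longrightarrow> k l = k u"
  shows "agree_prob n K R \<le> 1 / real K ^ (card U - 1)"
proof -
  define V where "V = {1..n} - (U - {u})"
  have fU: "finite U" using U(1) finite_subset by blast
  have cU: "card U \<ge> 1" "card U \<le> n" using U fU card_mono[of "{1..n}" U]
    by (auto simp: Suc_le_eq card_gt_0_iff)
  have "card V = n - card (U - {u})" unfolding V_def using U fU by (subst card_Diff_subset) auto
  then have V: "card V = n - (card U - 1)" using U by simp
  have "inj_on (\<lambda>k. restrict k V) (respecting n K R)"
  proof (rule inj_onI)
    fix k k' assume k: "k \<in> respecting n K R" "k' \<in> respecting n K R" and eq: "restrict k V = restrict k' V"
    have V: "k l = k' l" if "l \<in> V" for l using fun_cong[OF eq, of l] that by simp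
    show "k = k'"
    proof
      fix l
      consider "l \<notin> {1..n}" | "l \<in> V" | "l \<in> U" unfolding V_def by auto
      then show "k l = k' l"
      proof cases
        case 1 then show ?thesis using k unfolding respecting_def labellings_def
          by (auto simp: PiE_iff extensional_def)
      next
        case 2 then show ?thesis by (rule V)
      next
        case 3
        have "u \<in> V" using U by (auto simp: V_def)
        then show ?thesis using const[OF k(1) 3] const[OF k(2) 3] V[of u] by simp
      qed
    qed
  qed
  moreover have "(\<lambda>k. restrict k V) ` respecting n K R \<subseteq> V \<rightarrow>\<^sub>E {1..K}"
  proof clarify
    fix k assume "k \<in> respecting n K R"
    then have "k \<in> {1..n} \<rightarrow> {1..K}" by (auto simp: respecting_def labellings_def)
    then show "restrict k V \<in> V \<rightarrow>\<^sub>E {1..K}" by (auto simp: V_def)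
  qed
  ultimately have "card (respecting n K R) \<le> card (V \<rightarrow>\<^sub>E {1..K})"
    by (rule card_inj_on_le) (auto simp: V_def finite_PiE)
  also have "\<dots> = K ^ (n - (card U - 1))" using V by (simp add: card_PiE V_def)
  finally have "real (card (respecting n K R)) \<le> real K ^ (n - (card U - 1))"
    by (metis of_nat_le_iff of_nat_power)
  then have "agree_prob n K R \<le> real K ^ (n - (card U - 1)) / real K ^ n"
    unfolding agree_prob_def by (rule divide_right_mono) simp
  also have "\<dots> = 1 / real K ^ (card U - 1)"
    using K cU by (simp add: field_simps power_add[symmetric])
  finally show ?thesis .
qed

section \<open>Cumulants of agreement events\<close>

text \<open>If \<open>A S\<close> is the moment of the variables in \<open>S\<close> and \<open>F S\<close> the moment of these variables times one
  further variable \<open>x\<close>, this is the joint cumulant of \<open>x\<close> and the variables in \<open>S\<close>.\<close>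

function relative_cumulant :: "('a set \<Rightarrow> real) \<Rightarrow> ('a set \<Rightarrow> real) \<Rightarrow> 'a set \<Rightarrow> real" where
  "relative_cumulant F A S = (if finite S then F S - (\<Sum>Q | Q \<subset> S. relative_cumulant F A Q * A (S - Q)) else 0)"
  by auto
termination by (relation "inv_image less_than (\<lambda>(F, A, S). card S)") (auto intro: psubset_card_mono)
declare relative_cumulant.simps [simp del]

lemma Pow_eq_insert_psubsets: "Pow S = insert S {Q. Q \<subset> S}" by auto

lemma finite_psubsets: "finite S \<Longrightarrow> finite {Q. Q \<subset> S}"
  by (rule finite_subset[of _ "Pow S"]) auto

lemma sum_Pow_psubsets:
  "finite S \<Longrightarrow> (\<Sum>Q\<in>Pow S. f Q) = f S + (\<Sum>Q | Q \<subset> S. f Q)" for f :: "'a set \<Rightarrow> real"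
  unfolding Pow_eq_insert_psubsets by (subst sum.insert) (auto simp: finite_psubsets)

lemma relative_cumulant_convolution:
  assumes "finite S" "A {} = 1"
  shows "(\<Sum>Q\<in>Pow S. relative_cumulant F A Q * A (S - Q)) = F S"
  using assms by (simp add: sum_Pow_psubsets relative_cumulant.simps[of F A S])

lemma convolution_unique:
  fixes f g A :: "'a set \<Rightarrow> real"
  assumes E: "finite E" and A: "A {} = 1"
    and eq: "\<And>S. S \<subseteq> E \<Longrightarrow> (\<Sum>Q\<in>Pow S. f Q * A (S - Q)) = (\<Sum>Q\<in>Pow S. g Q * A (S - Q))"
    and S: "S \<subseteq> E"
  shows "f S = g S"
proof -
  have "finite S" using S E finite_subset by auto
  then show ?thesis using S
  proof (induction S rule: finite_psubset_induct)
    case (psubset S)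
    have "(\<Sum>Q | Q \<subset> S. f Q * A (S - Q)) = (\<Sum>Q | Q \<subset> S. g Q * A (S - Q))"
      using psubset by (intro sum.cong) auto
    with eq[OF psubset.prems] show ?case using psubset(1) A by (simp add: sum_Pow_psubsets)
  qed
qed

lemma sum_Pow_power_card:
  fixes x :: real
  shows "finite S \<Longrightarrow> (\<Sum>Q\<in>Pow S. x ^ card Q) = (1 + x) ^ card S"
  using prod_add[of S "\<lambda>_. x" "\<lambda>_. 1"] by (simp add: add.commute)

lemma sum_card_blocks:
  assumes "finite T" "partition_on T P"
  shows "(\<Sum>B\<in>P. card B) = card T"
proof -
  have "finite B" if "B \<in> P" for B
    using that assms finite_subset[of B T] unfolding partition_on_def by auto
  then show ?thesis using assms card_Union_disjoint[of P] unfolding partition_on_def by auto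
qed

definition block_pairs :: "('e \<Rightarrow> nat) \<Rightarrow> 'e set set \<Rightarrow> (nat \<times> nat) set" where
  "block_pairs pt P = (\<Union>B\<in>P. (\<lambda>(s, t). (pt s, pt t)) ` (B \<times> B))"

lemma block_pairs_Un: "block_pairs pt (P \<union> Q) = block_pairs pt P \<union> block_pairs pt Q"
  by (auto simp: block_pairs_def)

lemma block_pairs_empty [simp]: "block_pairs pt {} = {}"
  by (simp add: block_pairs_def)

lemma respecting_block_pairs:
  "k \<in> respecting n K (block_pairs pt P) \<longleftrightarrow>
     k \<in> labellings n K \<and> (\<forall>B\<in>P. \<forall>s\<in>B. \<forall>t\<in>B. k (pt s) = k (pt t))"
  by (simp add: respecting_def block_pairs_def ball_UN ball_simps split_beta)

lemma respecting_insert: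
  "k \<in> respecting n K (insert (i, j) R) \<longleftrightarrow> k \<in> respecting n K R \<and> k i = k j"
  unfolding respecting_def by auto

text \<open>An edge \<open>t\<close> joins the point \<open>pt t\<close> to the coordinate \<open>col t\<close>. The two distinguished points \<open>a\<close>
  and \<open>b\<close> are those whose co-membership is to be estimated.\<close>

locale linked_edges =
  fixes n K a b :: nat and E :: "'e set" and pt col :: "'e \<Rightarrow> nat"
  assumes K: "K \<ge> 1" and ab: "a \<in> {1..n}" "b \<in> {1..n}"
    and finE: "finite E" and ptE: "pt ` E \<subseteq> {1..n}"
begin

definition blocks_prob :: "'e set set \<Rightarrow> real" where
  "blocks_prob P = agree_prob n K (block_pairs pt P)"

definition linked_prob :: "'e set set \<Rightarrow> real" where
  "linked_prob P = agree_prob n K (insert (a, b) (block_pairs pt P))"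

text \<open>The joint cumulant of the event that \<open>a\<close> and \<open>b\<close> agree and the events, one per block, that all
  points of the block agree.\<close>

definition block_cumulant :: "'e set set \<Rightarrow> real" where
  "block_cumulant = relative_cumulant linked_prob blocks_prob"

lemma block_pairs_range: "\<Union>P \<subseteq> E \<Longrightarrow> block_pairs pt P \<subseteq> {1..n} \<times> {1..n}"
  using ptE unfolding block_pairs_def by (auto simp: image_subset_iff Union_eq subset_iff)

lemma finite_block_pairs: "\<Union>P \<subseteq> E \<Longrightarrow> finite (block_pairs pt P)"
  by (rule finite_subset[OF block_pairs_range]) auto

lemma finite_blocks: "\<Union>P \<subseteq> E \<Longrightarrow> finite P"
  using finE by (metis finite_UnionD finite_subset)

lemma blocks_prob_empty: "blocks_prob {} = 1"
  unfolding blocks_prob_def using agree_prob_empty[OF K] by simp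

lemma linked_prob_nonneg: "linked_prob P \<ge> 0"
  by (simp add: linked_prob_def agree_prob_nonneg)

lemma block_cumulant_convolution:
  "\<Union>P \<subseteq> E \<Longrightarrow> (\<Sum>Q\<in>Pow P. block_cumulant Q * blocks_prob (P - Q)) = linked_prob P"
  unfolding block_cumulant_def
  by (rule relative_cumulant_convolution) (auto simp: blocks_prob_empty finite_blocks)

lemma block_cumulant_rec:
  assumes "\<Union>P \<subseteq> E"
  shows "block_cumulant P = linked_prob P - (\<Sum>Q | Q \<subset> P. block_cumulant Q * blocks_prob (P - Q))"
  using block_cumulant_convolution[OF assms] finite_blocks[OF assms]
  by (simp add: sum_Pow_psubsets blocks_prob_empty)

lemma linked_prob_mult_le:
  assumes "\<Union>P \<subseteq> E" "Q \<subseteq> P"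
  shows "linked_prob Q * blocks_prob (P - Q) \<le> linked_prob P"
proof -
  have sub: "\<Union>Q \<subseteq> E" "\<Union>(P - Q) \<subseteq> E" using assms by auto
  have "P = Q \<union> (P - Q)" using assms by auto
  then have eq: "insert (a,b) (block_pairs pt P) = insert (a,b) (block_pairs pt Q) \<union> block_pairs pt (P - Q)"
    using block_pairs_Un[of pt Q "P - Q"] by simp
  show ?thesis unfolding linked_prob_def blocks_prob_def eq
    using sub[THEN block_pairs_range] finite_block_pairs[OF sub(2)] ab K
    by (intro agree_prob_mult_le) auto
qed

text \<open>In the recursion, positive correlation bounds every product of probabilities by the
  probability of the whole configuration. The remaining numerical recursion is dominated by
  \<open>(s + 1)\<^sup>s\<close>, because \<open>\<Sum>\<^sub>Q s\<^bsup>|Q|\<^esup>\<close> over proper subfamilies of \<open>s\<close> blocks is \<open>(s + 1)\<^sup>s - s\<^sup>s\<close>.\<close>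

lemma abs_block_cumulant_le:
  assumes "\<Union>P \<subseteq> E"
  shows "\<bar>block_cumulant P\<bar> \<le> (real (card P) + 1) ^ card P * linked_prob P"
  using finite_blocks[OF assms] assms
proof (induction P rule: finite_psubset_induct)
  case (psubset P)
  show ?case
  proof (cases "P = {}")
    case True
    then show ?thesis using block_cumulant_rec[of "{}"] linked_prob_nonneg[of "{}"] by simp
  next
    case False
    let ?s = "real (card P)"
    \<comment> \<open>the term \<open>s\<^sup>s \<ge> 1\<close> missing from the sum over proper subfamilies pays for the first term\<close>
    have s: "?s \<ge> 1" using False psubset(1) by (simp add: Suc_le_eq card_gt_0_iff)
    have "\<bar>block_cumulant P\<bar> \<le> linked_prob P + \<bar>\<Sum>Q | Q \<subset> P. block_cumulant Q * blocks_prob (P - Q)\<bar>"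
      unfolding block_cumulant_rec[OF psubset.prems] using linked_prob_nonneg[of P] by linarith
    also have "\<bar>\<Sum>Q | Q \<subset> P. block_cumulant Q * blocks_prob (P - Q)\<bar> \<le> (\<Sum>Q | Q \<subset> P. ?s ^ card Q * linked_prob P)"
    proof (rule order_trans[OF sum_abs], rule sum_mono)
      fix Q assume "Q \<in> {Q. Q \<subset> P}"
      then have Q: "Q \<subset> P" by simp
      then have QE: "\<Union>Q \<subseteq> E" using psubset.prems by auto
      have "card Q < card P" using Q psubset(1) by (intro psubset_card_mono) auto
      then have c: "real (card Q) + 1 \<le> ?s" by simp
      have nn: "blocks_prob (P - Q) \<ge> 0" by (simp add: blocks_prob_def agree_prob_nonneg)
      have "\<bar>block_cumulant Q * blocks_prob (P - Q)\<bar> \<le> (real (card Q) + 1) ^ card Q * linked_prob Q * blocks_prob (P - Q)"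
        unfolding abs_mult using psubset.IH[OF Q QE] nn by (simp add: mult_right_mono)
      also have "\<dots> = (real (card Q) + 1) ^ card Q * (linked_prob Q * blocks_prob (P - Q))" by simp
      also have "\<dots> \<le> ?s ^ card Q * linked_prob P"
        using c linked_prob_mult_le[OF psubset.prems, of Q] Q linked_prob_nonneg nn
        by (intro mult_mono power_mono) auto
      finally show "\<bar>block_cumulant Q * blocks_prob (P - Q)\<bar> \<le> ?s ^ card Q * linked_prob P" .
    qed
    also have "\<dots> = (\<Sum>Q | Q \<subset> P. ?s ^ card Q) * linked_prob P" by (simp add: sum_distrib_right)
    also have "(\<Sum>Q | Q \<subset> P. ?s ^ card Q) = (1 + ?s) ^ card P - ?s ^ card P"
      using sum_Pow_power_card[of P ?s] sum_Pow_psubsets[of P "\<lambda>Q. ?s ^ card Q"] psubset(1) by simp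
    finally have "\<bar>block_cumulant P\<bar> \<le> (1 + ?s) ^ card P * linked_prob P + (1 - ?s ^ card P) * linked_prob P"
      by (simp add: algebra_simps)
    moreover have "(1 - ?s ^ card P) * linked_prob P \<le> 0"
      using one_le_power[OF s, of "card P"] linked_prob_nonneg[of P] by (intro mult_nonpos_nonneg) auto
    ultimately show ?thesis by (simp add: add.commute)
  qed
qed

lemma block_pairs_subset: "(\<And>B. B \<in> P \<Longrightarrow> pt ` B \<subseteq> U) \<Longrightarrow> block_pairs pt P \<subseteq> U \<times> U"
  unfolding block_pairs_def by (auto simp: image_subset_iff)

text \<open>A joint cumulant vanishes when the variables split into two independent groups. By induction
  only the subfamilies of the blocks inside \<open>U\<close> contribute to the recursion; there the
  probability of the blocks outside \<open>U\<close> factors out and the recursion closes.\<close>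

lemma block_cumulant_disconnected:
  assumes U: "U \<subseteq> {1..n}" "a \<in> U" "b \<in> U" and P: "\<Union>P \<subseteq> E"
    and sep: "\<And>B. B \<in> P \<Longrightarrow> pt ` B \<subseteq> U \<or> pt ` B \<inter> U = {}"
    and ex: "\<exists>B\<in>P. \<not> pt ` B \<subseteq> U"
  shows "block_cumulant P = 0"
  using finite_blocks[OF P] P sep ex
proof (induction P rule: finite_psubset_induct)
  case (psubset P)
  define P1 where "P1 = {B\<in>P. pt ` B \<subseteq> U}"
  define P2 where "P2 = {B\<in>P. \<not> pt ` B \<subseteq> U}"
  have P12: "P = P1 \<union> P2" "P1 \<inter> P2 = {}" "P2 \<noteq> {}" "P1 \<subset> P"
    using psubset.prems(3) by (auto simp: P1_def P2_def)
  have E12: "\<Union>P1 \<subseteq> E" "\<Union>P2 \<subseteq> E" using psubset.prems(1) by (auto simp: P1_def P2_def)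
  have bp2: "block_pairs pt P2 \<subseteq> ({1..n} - U) \<times> ({1..n} - U)"
  proof (rule block_pairs_subset)
    fix B assume B: "B \<in> P2"
    then have "pt ` B \<inter> U = {}" using psubset.prems(2)[of B] by (auto simp: P2_def)
    moreover have "pt ` B \<subseteq> {1..n}" using B E12 ptE by blast
    ultimately show "pt ` B \<subseteq> {1..n} - U" by auto
  qed
  have bp1: "block_pairs pt Q \<subseteq> U \<times> U" if "Q \<subseteq> P1" for Q
    using that by (intro block_pairs_subset) (auto simp: P1_def)
  note dis = agree_prob_disjoint[OF finite_block_pairs[OF E12(2)] bp2 _ U(1) K]
  have split: "blocks_prob (P - Q) = blocks_prob (P1 - Q) * blocks_prob P2" if "Q \<subseteq> P1" for Q
  proof -
    have "P - Q = (P1 - Q) \<union> P2" using that P12 by auto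
    then show ?thesis using dis[OF bp1[of "P1 - Q"]] by (simp add: blocks_prob_def block_pairs_Un)
  qed
  have splitx: "linked_prob P = linked_prob P1 * blocks_prob P2"
    using dis[of "insert (a,b) (block_pairs pt P1)"] bp1[of P1] U P12(1)
    by (simp add: linked_prob_def blocks_prob_def block_pairs_Un)
  have "(\<Sum>Q | Q \<subset> P. block_cumulant Q * blocks_prob (P - Q)) = (\<Sum>Q\<in>Pow P1. block_cumulant Q * blocks_prob (P - Q))"
  proof (rule sum.mono_neutral_right)
    show "finite {Q. Q \<subset> P}" using psubset(1) by (rule finite_psubsets)
    show "Pow P1 \<subseteq> {Q. Q \<subset> P}" using P12 by auto
    show "\<forall>Q\<in>{Q. Q \<subset> P} - Pow P1. block_cumulant Q * blocks_prob (P - Q) = 0"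
    proof
      fix Q assume Q: "Q \<in> {Q. Q \<subset> P} - Pow P1"
      have "block_cumulant Q = 0"
      proof (rule psubset.IH)
        show "Q \<subset> P" using Q by simp
        show "\<Union>Q \<subseteq> E" using Q psubset.prems(1) by auto
        show "\<exists>B\<in>Q. \<not> pt ` B \<subseteq> U" using Q unfolding P1_def by blast
        show "pt ` B \<subseteq> U \<or> pt ` B \<inter> U = {}" if "B \<in> Q" for B
          using psubset.prems(2)[of B] that Q by auto
      qed
      then show "block_cumulant Q * blocks_prob (P - Q) = 0" by simp
    qed
  qed
  also have "\<dots> = (\<Sum>Q\<in>Pow P1. block_cumulant Q * blocks_prob (P1 - Q)) * blocks_prob P2"
    unfolding sum_distrib_right by (intro sum.cong refl) (simp add: split)
  also have "\<dots> = linked_prob P" using block_cumulant_convolution[OF E12(1)] splitx by simp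
  finally show ?case using block_cumulant_rec[OF psubset.prems(1)] by simp
qed

text \<open>For a labelling that respects all constraints, the level set of the label of \<open>a\<close> cuts no block.
  As the cumulant does not vanish, this level set contains all blocks, so the labelling is
  constant on all points involved.\<close>

lemma linked_prob_connected_le:
  assumes P: "\<Union>P \<subseteq> E" and nz: "block_cumulant P \<noteq> 0"
  shows "linked_prob P \<le> 1 / real K ^ (card (pt ` \<Union>P \<union> {a, b}) - 1)"
  unfolding linked_prob_def
proof (rule agree_prob_connected_le[OF _ _ K])
  show "pt ` \<Union>P \<union> {a, b} \<subseteq> {1..n}" using P ptE ab by blast
  show "a \<in> pt ` \<Union>P \<union> {a, b}" by simp
  fix k l assume k: "k \<in> respecting n K (insert (a, b) (block_pairs pt P))" and l: "l \<in> pt ` \<Union>P \<union> {a, b}"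
  define U where "U = {i\<in>{1..n}. k i = k a}"
  have kab: "k a = k b" and kB: "\<And>B s t. B \<in> P \<Longrightarrow> s \<in> B \<Longrightarrow> t \<in> B \<Longrightarrow> k (pt s) = k (pt t)"
    using k unfolding respecting_insert respecting_block_pairs by blast+
  have "pt ` B \<subseteq> U \<or> pt ` B \<inter> U = {}" if B: "B \<in> P" for B
  proof (rule ccontr)
    assume "\<not> ?thesis"
    then obtain s t where st: "s \<in> B" "t \<in> B" "pt s \<notin> U" "pt t \<in> U" by auto
    have "pt s \<in> {1..n}" using st(1) B P ptE by blast
    then show False using st kB[OF B st(1,2)] by (auto simp: U_def)
  qed
  moreover have "U \<subseteq> {1..n}" "a \<in> U" "b \<in> U" using ab kab by (auto simp: U_def)
  ultimately have "\<forall>B\<in>P. pt ` B \<subseteq> U"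
    using block_cumulant_disconnected[OF _ _ _ P, of U] nz by blast
  then have "pt ` \<Union>P \<subseteq> U" by auto
  then have "l \<in> U" using l \<open>a \<in> U\<close> \<open>b \<in> U\<close> by auto
  then show "k l = k a" by (simp add: U_def)
qed

text \<open>Each block \<open>B\<close> is enforced by \<open>card B - 1\<close> pairs, namely those joining a representative to the
  other elements, and every pair costs at most a factor \<open>K\<close>. Compared with
  \<open>linked_prob_connected_le\<close>, this bounds the number of points of a connected configuration.\<close>

lemma linked_prob_spanning_ge:
  assumes P: "partition_on T P" and T: "T \<subseteq> E"
  shows "linked_prob P \<ge> 1 / real K ^ (1 + (card T - card P))"
proof -
  define rep where "rep B = (SOME t. t \<in> B)" for B :: "'e set"
  have rep: "rep B \<in> B" if "B \<in> P" for B
    using that P unfolding rep_def partition_on_def by (metis ex_in_conv someI_ex)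
  define S where "S = (\<Union>B\<in>P. (\<lambda>t. (pt (rep B), pt t)) ` (B - {rep B}))"
  define R where "R = insert (a, b) S"
  have PE: "\<Union>P \<subseteq> E" using P T unfolding partition_on_def by auto
  have finP: "finite P" using finite_blocks[OF PE] .
  have finB: "finite B" if "B \<in> P" for B using that PE finE by (meson Union_upper finite_subset)
  have cB: "card B \<ge> 1" if "B \<in> P" for B
    using finB[OF that] rep[OF that] by (auto simp: Suc_le_eq card_gt_0_iff)
  have "respecting n K R = respecting n K (insert (a, b) (block_pairs pt P))"
  proof (rule set_eqI)
    fix k
    have "k \<in> respecting n K R \<longleftrightarrow> k \<in> labellings n K \<and> k a = k b \<and> (\<forall>B\<in>P. \<forall>t\<in>B. k (pt (rep B)) = k (pt t))"
      unfolding R_def S_def respecting_def by auto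
    also have "\<dots> \<longleftrightarrow> k \<in> labellings n K \<and> k a = k b \<and> (\<forall>B\<in>P. \<forall>s\<in>B. \<forall>t\<in>B. k (pt s) = k (pt t))"
    proof -
      have "k (pt s) = k (pt t)"
        if "\<forall>B\<in>P. \<forall>t\<in>B. k (pt (rep B)) = k (pt t)" "B \<in> P" "s \<in> B" "t \<in> B" for B s t
        using that(1)[rule_format, OF that(2,3)] that(1)[rule_format, OF that(2,4)] by simp
      then show ?thesis using rep by blast
    qed
    also have "\<dots> \<longleftrightarrow> k \<in> respecting n K (insert (a, b) (block_pairs pt P))"
      by (auto simp: respecting_insert respecting_block_pairs)
    finally show "k \<in> respecting n K R \<longleftrightarrow> k \<in> respecting n K (insert (a, b) (block_pairs pt P))" .
  qed
  then have eq: "linked_prob P = agree_prob n K R" by (simp add: linked_prob_def agree_prob_def)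
  have "card S \<le> (\<Sum>B\<in>P. card ((\<lambda>t. (pt (rep B), pt t)) ` (B - {rep B})))"
    unfolding S_def by (rule card_UN_le[OF finP])
  also have "\<dots> \<le> (\<Sum>B\<in>P. card B - 1)"
    using rep finB by (intro sum_mono order_trans[OF card_image_le]) auto
  also have "\<dots> = (\<Sum>B\<in>P. card B) - card P"
    using cB by (subst sum_subtractf_nat) auto
  also have "(\<Sum>B\<in>P. card B) = card T"
    using P T finE by (intro sum_card_blocks) (auto intro: finite_subset)
  finally have c1: "card S \<le> card T - card P" .
  have "finite S" unfolding S_def using finP finB by auto
  then have c: "card R \<le> 1 + (card T - card P)" unfolding R_def using c1 by (simp add: card_insert_if)
  have R: "R \<subseteq> {1..n} \<times> {1..n}"
  proof -
    have "pt t \<in> {1..n}" if "t \<in> B" "B \<in> P" for t B using that PE ptE by blast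
    then have "(pt (rep B), pt t) \<in> {1..n} \<times> {1..n}" if "B \<in> P" "t \<in> B" for t B using that rep by blast
    then show ?thesis using ab unfolding R_def S_def by blast
  qed
  have "finite R" using R by (rule finite_subset) auto
  have "1 / real K ^ (1 + (card T - card P)) \<le> 1 / real K ^ card R"
    using K c by (intro divide_left_mono power_increasing) auto
  also have "\<dots> \<le> agree_prob n K R" by (rule agree_prob_ge_card[OF \<open>finite R\<close> R K])
  finally show ?thesis using eq by simp
qed

text \<open>The weights in the moment-cumulant formula for signs indexed by coordinate and label, without
  the condition that labels agree on each block: that condition is averaged over the labels.\<close>

definition partition_weight :: "'e set set \<Rightarrow> real" where
  "partition_weight P = (\<Prod>B\<in>P. sign_cumulant (card B) * of_bool (\<forall>s\<in>B. \<forall>t\<in>B. col s = col t))"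

text \<open>The mean, over labels and centres, of the product of the signs attached to the edges in \<open>T\<close>:
  given the labels it is 1 if every pair of a coordinate and a label is used an even number of
  times, and 0 otherwise.\<close>

definition edge_moment :: "'e set \<Rightarrow> real" where
  "edge_moment T = (\<Sum>k\<in>labellings n K. of_bool (\<forall>c. even (card {t\<in>T. (col t, k (pt t)) = c}))) / real K ^ n"

definition linked_edge_moment :: "'e set \<Rightarrow> real" where
  "linked_edge_moment T = (\<Sum>k\<in>labellings n K. of_bool (k a = k b) * of_bool (\<forall>c. even (card {t\<in>T. (col t, k (pt t)) = c}))) / real K ^ n"

text \<open>The joint cumulant of the agreement of \<open>a\<close> and \<open>b\<close> with the signs attached to the edges in \<open>T\<close>;
  \<open>edge_cumulant_convolution\<close> is the moment-cumulant relation that characterises it.\<close>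

definition edge_cumulant :: "'e set \<Rightarrow> real" where
  "edge_cumulant T = (\<Sum>P | partition_on T P. partition_weight P * block_cumulant P)"

lemma even_classes_labelling:
  assumes T: "T \<subseteq> E" and k: "k \<in> labellings n K"
  shows "of_bool (\<forall>c. even (card {t\<in>T. (col t, k (pt t)) = c})) =
    (\<Sum>P | partition_on T P. partition_weight P * of_bool (k \<in> respecting n K (block_pairs pt P)))"
proof -
  let ?both = "\<lambda>B. \<forall>s\<in>B. \<forall>t\<in>B. (col s, k (pt s)) = (col t, k (pt t))"
  let ?cols = "\<lambda>B. \<forall>s\<in>B. \<forall>t\<in>B. col s = col t"
  let ?labs = "\<lambda>B. \<forall>s\<in>B. \<forall>t\<in>B. k (pt s) = k (pt t)"
  have fT: "finite T" using T finE finite_subset by auto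
  have "of_bool (\<forall>c. even (card {t\<in>T. (col t, k (pt t)) = c})) =
    (\<Sum>P | partition_on T P. \<Prod>B\<in>P. sign_cumulant (card B) * of_bool (?both B))"
    by (rule even_classes_eq_sum_partitions[OF fT, symmetric])
  also have "\<dots> = (\<Sum>P | partition_on T P. partition_weight P * of_bool (k \<in> respecting n K (block_pairs pt P)))"
  proof (rule sum.cong[OF refl])
    fix P assume "P \<in> {P. partition_on T P}"
    then have fP: "finite P" using fT finite_elements by auto
    have "(\<Prod>B\<in>P. sign_cumulant (card B) * of_bool (?both B)) =
       (\<Prod>B\<in>P. (sign_cumulant (card B) * of_bool (?cols B)) * of_bool (?labs B))"
    proof (rule prod.cong[OF refl])
      fix B
      have "?both B \<longleftrightarrow>
        (?cols B) \<and> (?labs B)" by blast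
      then show "sign_cumulant (card B) * of_bool (?both B) =
        (sign_cumulant (card B) * of_bool (?cols B)) * of_bool (?labs B)"
        by (simp only: of_bool_conj mult.assoc)
    qed
    also have "\<dots> = partition_weight P * (\<Prod>B\<in>P. of_bool (?labs B))"
      unfolding partition_weight_def by (rule prod.distrib)
    also have "(\<Prod>B\<in>P. of_bool (?labs B)) = (of_bool (k \<in> respecting n K (block_pairs pt P)) :: real)"
    proof -
      have "(\<Prod>B\<in>P. of_bool (H B)) = (of_bool (\<forall>B\<in>P. H B) :: real)" for H
        using fP by (induction P rule: finite_induct) auto
      then show ?thesis unfolding respecting_block_pairs using k by simp
    qed
    finally show "(\<Prod>B\<in>P. sign_cumulant (card B) * of_bool (?both B)) = 
      partition_weight P * of_bool (k \<in> respecting n K (block_pairs pt P))" .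
  qed
  finally show ?thesis .
qed

lemma labelling_mean_eq_sum_partitions:
  assumes "\<And>k. k \<in> labellings n K \<Longrightarrow> g k = (\<Sum>P | partition_on T P. partition_weight P * of_bool (k \<in> respecting n K (R P)))"
  shows "(\<Sum>k\<in>labellings n K. g k) / real K ^ n = (\<Sum>P | partition_on T P. partition_weight P * agree_prob n K (R P))"
proof -
  have "(\<Sum>k\<in>labellings n K. g k) / real K ^ n =
    (\<Sum>k\<in>labellings n K. \<Sum>P | partition_on T P. partition_weight P * of_bool (k \<in> respecting n K (R P))) / real K ^ n"
    by (intro arg_cong2[where f="(/)"] sum.cong refl assms)
  also have "\<dots> =
    (\<Sum>P | partition_on T P. partition_weight P * ((\<Sum>k\<in>labellings n K. of_bool (k \<in> respecting n K (R P))) / real K ^ n))"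
    by (subst sum.swap) (simp add: sum_distrib_left sum_divide_distrib mult_ac)
  also have "\<dots> = (\<Sum>P | partition_on T P. partition_weight P * agree_prob n K (R P))"
  proof (intro sum.cong refl arg_cong2[where f="(*)"])
    fix P
    have "(\<Sum>k\<in>labellings n K. of_bool (k \<in> respecting n K (R P)) :: real) = real (card (respecting n K (R P)))"
      by (subst sum_of_bool_eq) (auto simp: respecting_def intro!: arg_cong[where f=card])
    then show "(\<Sum>k\<in>labellings n K. of_bool (k \<in> respecting n K (R P))) / real K ^ n = agree_prob n K (R P)"
      by (simp add: agree_prob_def)
  qed
  finally show ?thesis .
qed

lemma edge_moment_eq_sum_partitions:
  "T \<subseteq> E \<Longrightarrow> edge_moment T = (\<Sum>P | partition_on T P. partition_weight P * blocks_prob P)"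
  unfolding edge_moment_def blocks_prob_def
  by (rule labelling_mean_eq_sum_partitions) (rule even_classes_labelling)

lemma linked_edge_moment_eq_sum_partitions:
  assumes T: "T \<subseteq> E"
  shows "linked_edge_moment T = (\<Sum>P | partition_on T P. partition_weight P * linked_prob P)"
  unfolding linked_edge_moment_def linked_prob_def
proof (rule labelling_mean_eq_sum_partitions)
  fix k assume k: "k \<in> labellings n K"
  show "of_bool (k a = k b) * of_bool (\<forall>c. even (card {t\<in>T. (col t, k (pt t)) = c})) =
     (\<Sum>P | partition_on T P. partition_weight P * of_bool (k \<in> respecting n K (insert (a, b) (block_pairs pt P))))"
    unfolding even_classes_labelling[OF T k] respecting_insert by (simp add: sum_distrib_left mult_ac)
qed

text \<open>Both moments are sums over partitions with the same multiplicative weight, so by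
  \<open>sum_partitions_split\<close> the relation reduces to the one for block cumulants, partition by
  partition.\<close>

lemma edge_cumulant_convolution:
  assumes T: "T \<subseteq> E"
  shows "(\<Sum>U\<in>Pow T. edge_cumulant U * edge_moment (T - U)) = linked_edge_moment T"
proof -
  have fT: "finite T" using T finE finite_subset by auto
  have "(\<Sum>U\<in>Pow T. edge_cumulant U * edge_moment (T - U)) =
    (\<Sum>U\<in>Pow T. (\<Sum>Q | partition_on U Q. partition_weight Q * block_cumulant Q) * (\<Sum>R | partition_on (T - U) R. partition_weight R * blocks_prob R))"
    using T by (intro sum.cong refl) (subst edge_moment_eq_sum_partitions, auto simp: edge_cumulant_def)
  also have "\<dots> = (\<Sum>P | partition_on T P. \<Sum>Q\<in>Pow P. partition_weight Q * block_cumulant Q * (partition_weight (P - Q) * blocks_prob (P - Q)))"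
    by (rule sum_partitions_split[OF fT, symmetric])
  also have "\<dots> = (\<Sum>P | partition_on T P. partition_weight P * linked_prob P)"
  proof (rule sum.cong[OF refl])
    fix P assume "P \<in> {P. partition_on T P}"
    then have P: "partition_on T P" by simp
    then have PE: "\<Union>P \<subseteq> E" using T unfolding partition_on_def by auto
    have fP: "finite P" using finite_blocks[OF PE] .
    have "(\<Sum>Q\<in>Pow P. partition_weight Q * block_cumulant Q * (partition_weight (P - Q) * blocks_prob (P - Q))) =
      (\<Sum>Q\<in>Pow P. partition_weight P * (block_cumulant Q * blocks_prob (P - Q)))"
    proof (rule sum.cong[OF refl])
      fix Q assume "Q \<in> Pow P"
      then have "partition_weight P = partition_weight (P - Q) * partition_weight Q"
        unfolding partition_weight_def using fP by (intro prod.subset_diff) auto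
      then show "partition_weight Q * block_cumulant Q * (partition_weight (P - Q) * blocks_prob (P - Q)) = partition_weight P * (block_cumulant Q * blocks_prob (P - Q))"
        by simp
    qed
    also have "\<dots> = partition_weight P * linked_prob P"
      unfolding sum_distrib_left[symmetric] block_cumulant_convolution[OF PE] ..
    finally show "(\<Sum>Q\<in>Pow P. partition_weight Q * block_cumulant Q * (partition_weight (P - Q) * blocks_prob (P - Q))) = partition_weight P * linked_prob P" .
  qed
  finally show ?thesis using linked_edge_moment_eq_sum_partitions[OF T] by simp
qed

lemma edge_moment_empty: "edge_moment {} = 1"
  using K by (simp add: edge_moment_def card_labellings)

lemma abs_partition_weight_le: "\<bar>partition_weight P\<bar> \<le> (\<Prod>B\<in>P. \<bar>sign_cumulant (card B)\<bar>)"
  unfolding partition_weight_def abs_prod by (intro prod_mono) auto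

lemma abs_edge_cumulant_le:
  assumes T: "T \<subseteq> E"
  shows "\<bar>edge_cumulant T\<bar> \<le> fact (card T) * (real (card T) + 1) ^ card T / real K ^ (card (pt ` T \<union> {a, b}) - 1)"
proof -
  have fT: "finite T" using T finE finite_subset by auto
  let ?m = "card T" and ?r = "card (pt ` T \<union> {a, b}) - 1"
  have "\<bar>edge_cumulant T\<bar> \<le> (\<Sum>P | partition_on T P. (\<Prod>B\<in>P. \<bar>sign_cumulant (card B)\<bar>) * ((real ?m + 1) ^ ?m / real K ^ ?r))"
    unfolding edge_cumulant_def
  proof (rule order_trans[OF sum_abs], rule sum_mono)
    fix P assume "P \<in> {P. partition_on T P}"
    then have P: "partition_on T P" by simp
    then have PT: "\<Union>P = T" by (simp add: partition_on_def)
    then have PE: "\<Union>P \<subseteq> E" using T by auto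
    have fP: "finite P" using finite_blocks[OF PE] .
    have cP: "card P \<le> ?m"
    proof -
      have "card B \<ge> 1" if "B \<in> P" for B
        using P that fT unfolding partition_on_def
        by (auto simp: Suc_le_eq card_gt_0_iff intro: finite_subset)
      then have "(\<Sum>B\<in>P. 1) \<le> (\<Sum>B\<in>P. card B)" by (intro sum_mono) auto
      then show ?thesis using sum_card_blocks[OF fT P] by simp
    qed
    have "\<bar>block_cumulant P\<bar> \<le> (real ?m + 1) ^ ?m / real K ^ ?r"
    proof (cases "block_cumulant P = 0")
      case True then show ?thesis by simp
    next
      case False
      have "\<bar>block_cumulant P\<bar> \<le> (real (card P) + 1) ^ card P * linked_prob P" by (rule abs_block_cumulant_le[OF PE])
      also have "\<dots> \<le> (real ?m + 1) ^ ?m * (1 / real K ^ ?r)"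
      proof (rule mult_mono)
        have "(real (card P) + 1) ^ card P \<le> (real ?m + 1) ^ card P" using cP by (intro power_mono) auto
        also have "\<dots> \<le> (real ?m + 1) ^ ?m" using cP by (intro power_increasing) auto
        finally show "(real (card P) + 1) ^ card P \<le> (real ?m + 1) ^ ?m" .
        show "linked_prob P \<le> 1 / real K ^ ?r" using linked_prob_connected_le[OF PE False] PT by simp
      qed (simp_all add: linked_prob_nonneg)
      finally show ?thesis by simp
    qed
    then show "\<bar>partition_weight P * block_cumulant P\<bar> \<le> (\<Prod>B\<in>P. \<bar>sign_cumulant (card B)\<bar>) * ((real ?m + 1) ^ ?m / real K ^ ?r)"
      unfolding abs_mult using abs_partition_weight_le by (intro mult_mono) (auto intro!: prod_nonneg)
  qed
  also have "\<dots> = (\<Sum>P | partition_on T P. (\<Prod>B\<in>P. \<bar>sign_cumulant (card B)\<bar>)) * ((real ?m + 1) ^ ?m / real K ^ ?r)"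
    by (rule sum_distrib_right[symmetric])
  also have "\<dots> \<le> fact ?m * ((real ?m + 1) ^ ?m / real K ^ ?r)"
    using sum_partitions_abs_sign_cumulant_le[OF fT] by (intro mult_right_mono) auto
  finally show ?thesis by simp
qed

text \<open>Some partition has nonzero weight and nonzero block cumulant. The weight forces even blocks
  inside single coordinates, so there are at least as many blocks as coordinates and at most half
  as many blocks as edges. The last bound compares the lower and the upper estimate for the
  probability of the configuration as powers of \<open>K\<close>, which is conclusive as soon as \<open>K \<ge> 2\<close>.\<close>

lemma edge_cumulant_nonzero:
  assumes T: "T \<subseteq> E" and nz: "edge_cumulant T \<noteq> 0" and K2: "K \<ge> 2"
  shows "even (card T)" "2 * card (col ` T) \<le> card T"
    "card (pt ` T \<union> {a, b}) + card (col ` T) \<le> card T + 2"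
proof -
  have fT: "finite T" using T finE finite_subset by auto
  obtain P where P: "partition_on T P" and w: "partition_weight P \<noteq> 0" and c: "block_cumulant P \<noteq> 0"
    using nz unfolding edge_cumulant_def by (metis (mono_tags, lifting) mem_Collect_eq mult_eq_0_iff sum.neutral)
  have PT: "\<Union>P = T" using P by (simp add: partition_on_def)
  then have PE: "\<Union>P \<subseteq> E" using T by auto
  have fP: "finite P" using finite_blocks[OF PE] .
  have B: "even (card B)" "\<forall>s\<in>B. \<forall>t\<in>B. col s = col t" if "B \<in> P" for B
  proof -
    have nz: "sign_cumulant (card B) * of_bool (\<forall>s\<in>B. \<forall>t\<in>B. col s = col t) \<noteq> 0"
      using w that unfolding partition_weight_def prod_zero_iff[OF fP] by blast
    then show "even (card B)" using sign_cumulant_odd[of "card B"] by auto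
    show "\<forall>s\<in>B. \<forall>t\<in>B. col s = col t" using nz by (simp only: mult_eq_0_iff of_bool_eq_0_iff) blast
  qed
  have ne: "B \<noteq> {}" "finite B" if "B \<in> P" for B
    using P that fT unfolding partition_on_def by (auto intro: finite_subset)
  have c2: "card B \<ge> 2" if "B \<in> P" for B
    using B(1)[OF that] ne[OF that] by (metis card_0_eq dvd_imp_le not_gr_zero)
  have cT: "card T = (\<Sum>B\<in>P. card B)"
    using sum_card_blocks[OF fT P] by simp
  show "even (card T)" unfolding cT using B(1) by (rule dvd_sum)
  have P2: "2 * card P \<le> card T"
    unfolding cT using sum_mono[of P "\<lambda>_. 2" card] c2 by simp
  have "col ` T \<subseteq> (\<lambda>B. col (SOME t. t \<in> B)) ` P"
  proof clarify
    fix t assume "t \<in> T"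
    then obtain C where C: "C \<in> P" "t \<in> C" using PT by auto
    have "(SOME t. t \<in> C) \<in> C" using C by (metis someI_ex)
    then have "col t = col (SOME t. t \<in> C)" using B(2)[OF C(1)] C(2) by blast
    then show "col t \<in> (\<lambda>B. col (SOME t. t \<in> B)) ` P" using C(1) by blast
  qed
  then have cc: "card (col ` T) \<le> card P" using fP by (meson surj_card_le)
  then show "2 * card (col ` T) \<le> card T" using P2 by simp
  have "1 / real K ^ (1 + (card T - card P)) \<le> 1 / real K ^ (card (pt ` T \<union> {a, b}) - 1)"
    using linked_prob_spanning_ge[OF P T] linked_prob_connected_le[OF PE c] PT by simp
  then have "real K ^ (card (pt ` T \<union> {a, b}) - 1) \<le> real K ^ (1 + (card T - card P))"
    using K by (simp add: field_simps)
  then have "card (pt ` T \<union> {a, b}) - 1 \<le> 1 + (card T - card P)"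
    using K2 by (subst (asm) power_increasing_iff) auto
  then show "card (pt ` T \<union> {a, b}) + card (col ` T) \<le> card T + 2" using cc P2 by linarith
qed

end

section \<open>Hermite polynomials and the Gaussian moment functional\<close>

fun gauss_moment :: "nat \<Rightarrow> real" where
  "gauss_moment 0 = 1"
| "gauss_moment (Suc 0) = 0"
| "gauss_moment (Suc (Suc m)) = real (Suc m) * gauss_moment m"

lemma gauss_moment_even: "gauss_moment (2 * m) = fact (2 * m) / (2 ^ m * fact m)"
proof (induction m)
  case (Suc m)
  have "fact (2 * Suc m) = real (2 * m + 2) * (real (2 * m + 1) * fact (2 * m))" by simp
  then have "fact (2 * Suc m) / (2 ^ Suc m * fact (Suc m)) = real (2 * m + 1) * (fact (2 * m) / (2 ^ m * fact m))"
    by (subst (2) mult_divide_mult_cancel_left[of "real (2 * m + 2)", symmetric]) (simp_all add: algebra_simps)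
  then show ?case using Suc by simp
qed simp

lemma gauss_moment_odd: "gauss_moment (Suc (2 * m)) = 0"
  by (induction m) auto

text \<open>The integral of a polynomial against the standard normal law, defined algebraically through the
  moments so that identities can be proved by polynomial algebra. The link with integration is
  \<open>normal_poly_integral\<close>.\<close>

definition gauss_fun :: "real poly \<Rightarrow> real" where
  "gauss_fun q = (\<Sum>i\<le>degree q. coeff q i * gauss_moment i)"

lemma gauss_fun_altdef: "degree q \<le> m \<Longrightarrow> gauss_fun q = (\<Sum>i\<le>m. coeff q i * gauss_moment i)"
  unfolding gauss_fun_def by (rule sum.mono_neutral_left) (auto simp: coeff_eq_0)

lemma gauss_fun_add: "gauss_fun (p + q) = gauss_fun p + gauss_fun q"
proof -
  define m where "m = max (degree p) (degree q)"
  have "degree (p + q) \<le> m" "degree p \<le> m" "degree q \<le> m" by (auto simp: m_def degree_add_le)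
  then show ?thesis by (simp add: gauss_fun_altdef algebra_simps sum.distrib)
qed

lemma gauss_fun_smult: "gauss_fun (smult c q) = c * gauss_fun q"
proof -
  have "degree (smult c q) \<le> degree q" by (simp add: degree_smult_le)
  then show ?thesis by (simp add: gauss_fun_altdef[of _ "degree q"] sum_distrib_left mult.assoc)
qed

lemma gauss_fun_diff: "gauss_fun (p - q) = gauss_fun p - gauss_fun q"
  using gauss_fun_add[of p "smult (-1) q"] gauss_fun_smult[of "-1" q] by simp

lemma gauss_fun_1 [simp]: "gauss_fun 1 = 1" by (simp add: gauss_fun_def)

text \<open>Gaussian integration by parts: \<open>E[Z q(Z)] = E[q'(Z)]\<close>.\<close>

lemma gauss_fun_by_parts: "gauss_fun (pCons 0 q) = gauss_fun (pderiv q)"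
proof -
  define m where "m = degree q"
  have d: "degree (pCons 0 q) \<le> Suc m" "degree (pderiv q) \<le> m"
    by (auto simp: m_def degree_pCons_le degree_pderiv)
  have "gauss_fun (pCons 0 q) = (\<Sum>i\<le>Suc m. coeff (pCons 0 q) i * gauss_moment i)"
    by (rule gauss_fun_altdef[OF d(1)])
  also have "\<dots> = (\<Sum>i\<le>m. coeff q i * gauss_moment (Suc i))"
    by (simp add: sum.atMost_Suc_shift del: sum.atMost_Suc)
  also have "\<dots> = (\<Sum>i\<le>m. coeff (pderiv q) i * gauss_moment i)"
  proof (cases m)
    case 0 then show ?thesis using d by (simp add: coeff_pderiv coeff_eq_0 m_def)
  next
    case (Suc l)
    have "(\<Sum>i\<le>m. coeff q i * gauss_moment (Suc i)) = (\<Sum>i\<le>l. coeff q (Suc i) * gauss_moment (Suc (Suc i)))"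
      unfolding Suc sum.atMost_Suc_shift by simp
    also have "\<dots> = (\<Sum>i\<le>l. coeff (pderiv q) i * gauss_moment i)"
      by (intro sum.cong) (auto simp: coeff_pderiv)
    also have "\<dots> = (\<Sum>i\<le>m. coeff (pderiv q) i * gauss_moment i)"
      unfolding Suc by (simp add: coeff_pderiv coeff_eq_0[of q "Suc (Suc l)"] m_def[symmetric] Suc)
    finally show ?thesis .
  qed
  also have "\<dots> = gauss_fun (pderiv q)" by (rule gauss_fun_altdef[OF d(2), symmetric])
  finally show ?thesis .
qed

text \<open>The probabilists' normalisation: monic, and orthogonal for the standard normal law.\<close>

primrec hermite :: "nat \<Rightarrow> real poly" where
  "hermite 0 = 1"
| "hermite (Suc m) = pCons 0 (hermite m) - pderiv (hermite m)"

lemma pderiv_hermite: "pderiv (hermite m) = smult (real m) (hermite (m - 1))"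
proof (induction m rule: less_induct)
  case (less m)
  show ?case
  proof (cases m)
    case 0 then show ?thesis by simp
  next
    case (Suc l)
    have l: "pderiv (hermite l) = smult (real l) (hermite (l - 1))" using less Suc by simp
    show ?thesis
    proof (cases l)
      case 0
      then show ?thesis using Suc by (simp add: pderiv_pCons pderiv_diff)
    next
      case (Suc l')
      have l': "pderiv (hermite l') = smult (real l') (hermite (l' - 1))" using less Suc \<open>m = Suc l\<close> by simp
      have "pderiv (hermite m) = hermite l + pCons 0 (pderiv (hermite l)) - pderiv (pderiv (hermite l))"
        using \<open>m = Suc l\<close> by (simp add: pderiv_pCons pderiv_diff)
      also have "\<dots> = hermite l + smult (real l) (pCons 0 (hermite l') - pderiv (hermite l'))"
        unfolding l using Suc by (simp add: pderiv_smult smult_diff_right)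
      also have "\<dots> = smult (real m) (hermite l)"
      proof -
        have "pCons 0 (hermite l') - pderiv (hermite l') = hermite l" using Suc by simp
        moreover have "real m = 1 + real l" using \<open>m = Suc l\<close> by simp
        ultimately show ?thesis by (simp only: smult_add_left smult_1_left)
      qed
      finally show ?thesis using \<open>m = Suc l\<close> by simp
    qed
  qed
qed

lemma gauss_fun_hermite_Suc_mult: "gauss_fun (hermite (Suc m) * r) = gauss_fun (hermite m * pderiv r)"
proof -
  have "gauss_fun (pCons 0 (hermite m) * r) = gauss_fun (pderiv (hermite m * r))"
    using gauss_fun_by_parts[of "hermite m * r"] by simp
  moreover have "pderiv (hermite m * r) = hermite m * pderiv r + pderiv (hermite m) * r"
    by (simp add: pderiv_mult mult.commute)
  moreover have "hermite (Suc m) * r = pCons 0 (hermite m) * r - pderiv (hermite m) * r"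
    by (simp only: hermite.simps left_diff_distrib)
  ultimately show ?thesis by (simp only: gauss_fun_diff gauss_fun_add)
qed

definition shifted_hermite :: "real \<Rightarrow> nat \<Rightarrow> real poly" where
  "shifted_hermite x m = pcompose (hermite m) [:x, 1:]"

lemma poly_shifted_hermite: "poly (shifted_hermite x m) z = poly (hermite m) (x + z)"
  by (simp add: shifted_hermite_def poly_pcompose)

lemma pderiv_shifted_hermite: "pderiv (shifted_hermite x m) = smult (real m) (shifted_hermite x (m - 1))"
  by (simp add: shifted_hermite_def pderiv_pcompose pderiv_hermite pcompose_smult pderiv_pCons)

lemma gauss_fun_shifted_hermite: "gauss_fun (shifted_hermite x m) = x ^ m"
proof (induction m)
  case 0 then show ?case by (simp add: shifted_hermite_def pcompose_1)
next
  case (Suc m)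
  have "shifted_hermite x (Suc m) = smult x (shifted_hermite x m) + pCons 0 (shifted_hermite x m) - pderiv (shifted_hermite x m)"
    by (simp add: shifted_hermite_def pcompose_diff pcompose_pCons pderiv_pcompose pderiv_pCons)
  then show ?case using Suc gauss_fun_by_parts by (simp add: gauss_fun_add gauss_fun_diff gauss_fun_smult)
qed

text \<open>Integration by parts moves derivatives from \<open>He\<^sub>l\<close> to \<open>He\<^sub>m(x + \<cdot>)\<close>; each lowers the degree
  \<open>m\<close> by one and contributes the factor \<open>m\<close>, and at the end \<open>E[He\<^sub>m(x + Z)] = x\<^sup>m\<close>.\<close>

lemma gauss_fun_hermite_shifted:
  "gauss_fun (hermite l * shifted_hermite x m) = fact l * real (m choose l) * x ^ (m - l)"
proof (induction l arbitrary: m)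
  case 0 then show ?case by (simp add: gauss_fun_shifted_hermite)
next
  case (Suc l)
  have "gauss_fun (hermite (Suc l) * shifted_hermite x m) = real m * gauss_fun (hermite l * shifted_hermite x (m - 1))"
    unfolding gauss_fun_hermite_Suc_mult pderiv_shifted_hermite by (simp add: gauss_fun_smult)
  also have "\<dots> = fact l * (real m * real ((m - 1) choose l)) * x ^ (m - 1 - l)"
    using Suc[of "m-1"] by simp
  also have "real m * real ((m - 1) choose l) = real (Suc l) * real (m choose Suc l)"
    by (metis binomial_absorption of_nat_mult)
  finally show ?case by (simp add: algebra_simps)
qed

lemma gauss_fun_hermite_orthogonal:
  "gauss_fun (hermite l * hermite m) = (if l = m then fact m else 0)"
  using gauss_fun_hermite_shifted[of l 0 m]
  by (auto simp: shifted_hermite_def pcompose_idR not_less_iff_gr_or_eq binomial_eq_0 power_0_left)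

text \<open>Multiplication by \<open>y\<close> acts on Hermite polynomials as \<open>y He\<^sub>l = He\<^sub>l\<^sub>+\<^sub>1 + l He\<^sub>l\<^sub>-\<^sub>1\<close>.\<close>

lemma power_in_hermite_span: "\<exists>h. \<forall>y. y ^ m = (\<Sum>l\<le>m. h l * poly (hermite l) (y :: real))"
proof (induction m)
  case 0 show ?case by (intro exI[of _ "\<lambda>_. 1"]) simp
next
  case (Suc m)
  then obtain h where h: "\<And>y. y ^ m = (\<Sum>l\<le>m. h l * poly (hermite l) (y :: real))" by blast
  \<comment> \<open>the coefficients of \<open>y He\<^sub>l = He\<^sub>l\<^sub>+\<^sub>1 + l He\<^sub>l\<^sub>-\<^sub>1\<close>, collected by degree\<close>
  define h' where "h' l = (if l > 0 then h (l - 1) else 0) + (if l < m then real (l + 1) * h (l + 1) else 0)" for l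
  have "y ^ Suc m = (\<Sum>l\<le>Suc m. h' l * poly (hermite l) y)" for y
  proof -
    have rec: "y * poly (hermite l) y = poly (hermite (Suc l)) y + real l * poly (hermite (l - 1)) y" for l
      by (simp add: pderiv_hermite)
    have "y ^ Suc m = (\<Sum>l\<le>m. h l * (y * poly (hermite l) y))"
      using h[of y] by (simp add: sum_distrib_left mult_ac)
    also have "\<dots> = (\<Sum>l\<le>m. h l * poly (hermite (Suc l)) y) + (\<Sum>l\<le>m. real l * h l * poly (hermite (l - 1)) y)"
      unfolding rec by (simp only: distrib_left sum.distrib) (simp only: mult_ac)
    also have "(\<Sum>l\<le>m. h l * poly (hermite (Suc l)) y) = (\<Sum>l\<le>Suc m. (if l > 0 then h (l - 1) else 0) * poly (hermite l) y)"
      unfolding sum.atMost_Suc_shift by simp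
    also have "(\<Sum>l\<le>m. real l * h l * poly (hermite (l - 1)) y) = (\<Sum>l<m. real (l + 1) * h (l + 1) * poly (hermite l) y)"
      by (cases m) (simp_all add: sum.atMost_Suc_shift lessThan_Suc_atMost del: hermite.simps sum.atMost_Suc)
    also have "\<dots> = (\<Sum>l\<le>Suc m. (if l < m then real (l + 1) * h (l + 1) else 0) * poly (hermite l) y)"
      by (rule sum.mono_neutral_cong_left) auto
    finally show ?thesis unfolding h'_def by (simp only: sum.distrib[symmetric] distrib_right)
  qed
  then show ?case by blast
qed

lemma normal_power_integral:
  assumes s: "s > 0"
  shows "has_bochner_integral (density lborel (\<lambda>x. ennreal (normal_density m s x))) (\<lambda>y. ((y - m) / s) ^ i) (gauss_moment i)"
proof -
  have "has_bochner_integral lborel (\<lambda>x. normal_density m s x * ((x - m) / s) ^ i) (gauss_moment i)"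
  proof (cases "even i")
    case True
    then obtain j where i: "i = 2 * j" by (elim evenE)
    have "has_bochner_integral lborel (\<lambda>x. normal_density m s x * (x - m) ^ (2 * j) * (1 / s ^ (2 * j)))
        (fact (2 * j) / ((2 / s\<^sup>2) ^ j * fact j) * (1 / s ^ (2 * j)))"
      by (intro has_bochner_integral_mult_left normal_moment_even s)
    moreover have "fact (2 * j) / ((2 / s\<^sup>2) ^ j * fact j) * (1 / s ^ (2 * j)) = gauss_moment i"
      unfolding i gauss_moment_even using s by (simp add: field_simps power_mult power2_eq_square power_mult_distrib)
    ultimately show ?thesis unfolding i by (simp add: power_divide)
  next
    case False
    then obtain j where i: "i = Suc (2 * j)" by (elim oddE) simp
    have "has_bochner_integral lborel (\<lambda>x. normal_density m s x * (x - m) ^ (2 * j + 1) * (1 / s ^ (2 * j + 1)))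
        (0 * (1 / s ^ (2 * j + 1)))"
      by (intro has_bochner_integral_mult_left normal_moment_odd s)
    then show ?thesis unfolding i gauss_moment_odd by (simp add: power_divide)
  qed
  then show ?thesis
    by (intro has_bochner_integral_density) auto
qed

lemma normal_poly_integral:
  assumes s: "s > 0"
  shows "has_bochner_integral (density lborel (\<lambda>x. ennreal (normal_density m s x))) (\<lambda>y. poly q ((y - m) / s)) (gauss_fun q)"
proof -
  have "has_bochner_integral (density lborel (\<lambda>x. ennreal (normal_density m s x))) 
     (\<lambda>y. \<Sum>i\<le>degree q. coeff q i * ((y - m) / s) ^ i) (\<Sum>i\<le>degree q. coeff q i * gauss_moment i)"
    by (intro has_bochner_integral_sum has_bochner_integral_mult_right normal_power_integral s)
  then show ?thesis by (simp add: poly_altdef gauss_fun_def)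
qed

section \<open>The model as a finite mixture of product Gaussians\<close>

definition entries :: "nat \<Rightarrow> nat \<Rightarrow> (nat \<times> nat) set" where
  "entries n p = {1..n} \<times> {1..p}"

lemma finite_entries [simp]: "finite (entries n p)" by (simp add: entries_def)

text \<open>The normalised signal \<open>X\<close>; a latent state \<open>\<omega>\<close> is a pair of labels and centres.\<close>

definition signal :: "real \<Rightarrow> (nat \<Rightarrow> nat) \<times> (nat \<Rightarrow> nat \<Rightarrow> real) \<Rightarrow> nat \<times> nat \<Rightarrow> real" where
  "signal \<sigma> \<omega> v = snd \<omega> (fst \<omega> (fst v)) (snd v) / \<sigma>"

lemma prob_space_gaussian_vec: "\<sigma> > 0 \<Longrightarrow> prob_space (gaussian_vec p \<sigma> m)"
  unfolding gaussian_vec_def by (intro prob_space_PiM prob_space_normal_density)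

lemma prob_space_data_law: "\<sigma> > 0 \<Longrightarrow> prob_space (data_law n p \<sigma> k \<mu>)"
  unfolding data_law_def by (intro prob_space_PiM prob_space_gaussian_vec)

lemma sets_gaussian_vec: "sets (gaussian_vec p \<sigma> m) = sets (\<Pi>\<^sub>M j\<in>{1..p}. borel)"
  unfolding gaussian_vec_def by (intro sets_PiM_cong) auto

lemma sets_data_law: "sets (data_law n p \<sigma> k \<mu>) = sets (\<Pi>\<^sub>M i\<in>{1..n}. \<Pi>\<^sub>M j\<in>{1..p}. borel)"
  unfolding data_law_def by (intro sets_PiM_cong refl sets_gaussian_vec)

text \<open>Conditionally on the latent variables, the entries \<open>Y / \<sigma> - X\<close> are independent standard
  normals, so the mean of a product of polynomials, one per entry, factors.\<close>

lemma data_law_product_integral: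
  assumes s: "\<sigma> > 0"
  shows "has_bochner_integral (data_law n p \<sigma> k \<mu>)
    (\<lambda>Y. \<Prod>v\<in>entries n p. poly (q v) (Y (fst v) (snd v) / \<sigma> - signal \<sigma> (k, \<mu>) v))
    (\<Prod>v\<in>entries n p. gauss_fun (q v))"
proof -
  let ?N = "\<lambda>m. density lborel (\<lambda>x. ennreal (normal_density m \<sigma> x))"
  have one: "has_bochner_integral (?N m) (\<lambda>y. poly r (y / \<sigma> - m / \<sigma>)) (gauss_fun r)" for m r
    using normal_poly_integral[OF s, of m r] by (simp add: diff_divide_distrib)
  have row: "has_bochner_integral (gaussian_vec p \<sigma> m) (\<lambda>y. \<Prod>j\<in>{1..p}. poly (r j) (y j / \<sigma> - m j / \<sigma>)) (\<Prod>j\<in>{1..p}. gauss_fun (r j))" for m r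
  proof -
    interpret product_sigma_finite "\<lambda>j. ?N (m j)"
      by (intro product_sigma_finite.intro prob_space_imp_sigma_finite prob_space_normal_density s)
    show ?thesis unfolding gaussian_vec_def has_bochner_integral_iff
      using one[unfolded has_bochner_integral_iff]
      by (intro conjI product_integrable_prod, simp_all) (subst product_integral_prod, auto)
  qed
  interpret product_sigma_finite "\<lambda>i. gaussian_vec p \<sigma> (\<mu> (k i))"
    by (intro product_sigma_finite.intro prob_space_imp_sigma_finite prob_space_gaussian_vec s)
  let ?f = "\<lambda>i y. \<Prod>j\<in>{1..p}. poly (q (i, j)) (y j / \<sigma> - \<mu> (k i) j / \<sigma>)"
  have row_i: "integrable (gaussian_vec p \<sigma> (\<mu> (k i))) (?f i)"
    "integral\<^sup>L (gaussian_vec p \<sigma> (\<mu> (k i))) (?f i) = (\<Prod>j\<in>{1..p}. gauss_fun (q (i, j)))" for i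
    using row[of "\<mu> (k i)" "\<lambda>j. q (i, j)"] by (simp_all add: has_bochner_integral_iff)
  have "has_bochner_integral (data_law n p \<sigma> k \<mu>) (\<lambda>Y. \<Prod>i\<in>{1..n}. ?f i (Y i))
    (\<Prod>i\<in>{1..n}. \<Prod>j\<in>{1..p}. gauss_fun (q (i, j)))"
    unfolding data_law_def has_bochner_integral_iff
    using product_integrable_prod[of "{1..n}" ?f, OF _ row_i(1)] product_integral_prod[of "{1..n}" ?f, OF _ row_i(1)]
    by (simp only: row_i(2) finite_atLeastAtMost)
  then show ?thesis
    by (simp add: entries_def prod.cartesian_product signal_def split_beta)
qed

definition latent_states :: "nat \<Rightarrow> nat \<Rightarrow> nat \<Rightarrow> real \<Rightarrow> ((nat \<Rightarrow> nat) \<times> (nat \<Rightarrow> nat \<Rightarrow> real)) set" where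
  "latent_states n p K e = labellings n K \<times> ({1..K} \<rightarrow>\<^sub>E ({1..p} \<rightarrow>\<^sub>E {e, - e}))"

definition latent_mean :: "nat \<Rightarrow> nat \<Rightarrow> nat \<Rightarrow> real \<Rightarrow> ((nat \<Rightarrow> nat) \<times> (nat \<Rightarrow> nat \<Rightarrow> real) \<Rightarrow> real) \<Rightarrow> real" where
  "latent_mean n p K e g = (\<Sum>\<omega>\<in>latent_states n p K e. g \<omega>) / real (card (latent_states n p K e))"

lemma finite_latent_states: "finite (latent_states n p K e)"
  by (auto simp: latent_states_def intro!: finite_PiE)

lemma latent_states_nonempty: "K \<ge> 1 \<Longrightarrow> latent_states n p K e \<noteq> {}"
  by (auto simp: latent_states_def labellings_def PiE_eq_empty_iff)

lemma PiE_dflt_undefined: "PiE_dflt A undefined B = PiE A B"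
  by (auto simp: PiE_dflt_def PiE_iff extensional_def)

lemma latent_pmf_uniform:
  assumes K: "K \<ge> 1"
  shows "pair_pmf (labels_pmf n K) (centres_pmf p K \<sigma> \<Delta>) = pmf_of_set (latent_states n p K (centre_eps p \<sigma> \<Delta>))"
proof -
  let ?e = "centre_eps p \<sigma> \<Delta>"
  let ?C = "{1..K} \<rightarrow>\<^sub>E ({1..p} \<rightarrow>\<^sub>E {?e, - ?e})"
  have ne: "({1..p} \<rightarrow>\<^sub>E {?e, - ?e}) \<noteq> {}" by (simp add: PiE_eq_empty_iff)
  have l: "labels_pmf n K = pmf_of_set (labellings n K)"
    unfolding labels_pmf_def labellings_def using K
    by (subst Pi_pmf_of_set) (auto simp: PiE_dflt_undefined)
  have c: "centres_pmf p K \<sigma> \<Delta> = pmf_of_set ?C"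
    unfolding centres_pmf_def using ne
    by (subst Pi_pmf_of_set) (auto simp: PiE_dflt_undefined intro!: finite_PiE)
  have fl: "finite (labellings n K)" "labellings n K \<noteq> {}" using K by (simp, auto simp: labellings_def PiE_eq_empty_iff)
  have fc: "finite ?C" "?C \<noteq> {}" using ne by (auto simp: PiE_eq_empty_iff intro!: finite_PiE)
  show ?thesis
  proof (rule pmf_eqI)
    fix \<omega> :: "(nat \<Rightarrow> nat) \<times> (nat \<Rightarrow> nat \<Rightarrow> real)"
    obtain k \<mu> where w: "\<omega> = (k, \<mu>)" by (cases \<omega>)
    have fL: "finite (labellings n K \<times> ?C)" "labellings n K \<times> ?C \<noteq> {}" using fl fc by auto
    show "pmf (pair_pmf (labels_pmf n K) (centres_pmf p K \<sigma> \<Delta>)) \<omega> = pmf (pmf_of_set (latent_states n p K ?e)) \<omega>"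
      unfolding w pmf_pair l c latent_states_def pmf_of_set[OF fl(2,1)] pmf_of_set[OF fc(2,1)] pmf_of_set[OF fL(2,1)]
      by (simp add: card_cartesian_product indicator_times)
  qed
qed

definition observed :: "nat \<Rightarrow> nat \<Rightarrow> (nat \<Rightarrow> nat \<Rightarrow> real) measure" where
  "observed n p = (\<Pi>\<^sub>M i\<in>{1..n}. \<Pi>\<^sub>M j\<in>{1..p}. borel)"

text \<open>Labels and centres are uniform on a finite set, so an expectation under the model is a finite
  average of Gaussian integrals. Nonnegativity of \<open>F\<close> lets the argument go through the nonnegative
  integral, for which integration against the kernel requires no integrability.\<close>

lemma model_integral:
  assumes s: "\<sigma> > 0" and K: "K \<ge> 1"
    and F: "F \<in> borel_measurable (count_space UNIV \<Otimes>\<^sub>M observed n p)"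
    and nonneg: "\<And>z. F z \<ge> 0"
    and int: "\<And>k \<mu>. integrable (data_law n p \<sigma> k \<mu>) (\<lambda>Y. F ((k, \<mu>), Y))"
  shows "(\<integral>z. F z \<partial>model n p K \<sigma> \<Delta>) =
    latent_mean n p K (centre_eps p \<sigma> \<Delta>) (\<lambda>\<omega>. \<integral>Y. F (\<omega>, Y) \<partial>data_law n p \<sigma> (fst \<omega>) (snd \<omega>))"
proof -
  let ?I = "\<lambda>\<omega>. \<integral>Y. F (\<omega>, Y) \<partial>data_law n p \<sigma> (fst \<omega>) (snd \<omega>)"
  let ?B = "count_space UNIV \<Otimes>\<^sub>M observed n p"
  let ?q = "pair_pmf (labels_pmf n K) (centres_pmf p K \<sigma> \<Delta>)"
  let ?N = "\<lambda>(k, \<mu>). return (count_space UNIV) (k, \<mu>) \<Otimes>\<^sub>M data_law n p \<sigma> k \<mu>"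
  let ?L = "latent_states n p K (centre_eps p \<sigma> \<Delta>)"
  have setsD: "sets (data_law n p \<sigma> k \<mu>) = sets (observed n p)" for k \<mu>
    unfolding observed_def by (rule sets_data_law)
  have setsN: "sets (?N \<omega>) = sets ?B" for \<omega>
    by (auto simp: split_beta setsD intro!: sets_pair_measure_cong)
  have probN: "prob_space (?N \<omega>)" for \<omega>
  proof -
    have "prob_space (return (count_space UNIV) \<omega>)" by (rule prob_space_return) simp
    then show ?thesis using prob_space_data_law[OF s] by (auto simp: split_beta intro!: prob_space_pair)
  qed
  have N: "?N \<in> measurable (measure_pmf ?q) (subprob_algebra ?B)"
    using setsN prob_space_imp_subprob_space[OF probN]
    by (auto simp: measurable_pmf_measure1 space_subprob_algebra split_beta)
  have "(\<integral>\<^sup>+z. ennreal (F z) \<partial>model n p K \<sigma> \<Delta>) = (\<integral>\<^sup>+\<omega>. \<integral>\<^sup>+z. ennreal (F z) \<partial>?N \<omega> \<partial>measure_pmf ?q)"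
    unfolding model_def using F by (intro nn_integral_bind[OF _ N]) measurable
  also have "\<dots> = (\<integral>\<^sup>+\<omega>. ennreal (?I \<omega>) \<partial>measure_pmf ?q)"
  proof (rule nn_integral_cong)
    fix \<omega> :: "(nat \<Rightarrow> nat) \<times> (nat \<Rightarrow> nat \<Rightarrow> real)"
    obtain k \<mu> where w: "\<omega> = (k, \<mu>)" by (cases \<omega>)
    interpret D: prob_space "data_law n p \<sigma> k \<mu>" by (rule prob_space_data_law[OF s])
    have F': "(\<lambda>z. ennreal (F z)) \<in> borel_measurable (return (count_space UNIV) (k, \<mu>) \<Otimes>\<^sub>M data_law n p \<sigma> k \<mu>)"
      using F setsN[of \<omega>] w by (subst measurable_cong_sets[OF _ refl, of _ ?B]) auto
    have "(\<integral>\<^sup>+z. ennreal (F z) \<partial>?N \<omega>) = (\<integral>\<^sup>+x. \<integral>\<^sup>+Y. ennreal (F (x, Y)) \<partial>data_law n p \<sigma> k \<mu> \<partial>return (count_space UNIV) (k, \<mu>))"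
      using D.nn_integral_fst[OF F'] w by simp
    also have "\<dots> = (\<integral>\<^sup>+Y. ennreal (F ((k, \<mu>), Y)) \<partial>data_law n p \<sigma> k \<mu>)"
      by (subst nn_integral_return) auto
    also have "\<dots> = ennreal (\<integral>Y. F ((k, \<mu>), Y) \<partial>data_law n p \<sigma> k \<mu>)"
      by (rule nn_integral_eq_integral[OF int]) (simp add: nonneg)
    finally show "(\<integral>\<^sup>+z. ennreal (F z) \<partial>?N \<omega>) = ennreal (?I \<omega>)"
      by (simp add: w)
  qed
  also have "\<dots> = ennreal (\<integral>\<omega>. ?I \<omega> \<partial>measure_pmf ?q)"
    unfolding latent_pmf_uniform[OF K]
    by (intro nn_integral_eq_integral integrable_measure_pmf_finite)
      (auto simp: set_pmf_of_set[OF latent_states_nonempty[OF K] finite_latent_states] finite_latent_states nonneg intro!: integral_nonneg_AE)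
  also have "(\<integral>\<omega>. ?I \<omega> \<partial>measure_pmf ?q) =
     latent_mean n p K (centre_eps p \<sigma> \<Delta>) ?I"
    unfolding latent_pmf_uniform[OF K] latent_mean_def
    by (rule integral_pmf_of_set[OF latent_states_nonempty[OF K] finite_latent_states])
  finally have nn: "(\<integral>\<^sup>+z. ennreal (F z) \<partial>model n p K \<sigma> \<Delta>) = ennreal (latent_mean n p K (centre_eps p \<sigma> \<Delta>) ?I)" .
  have "sets (model n p K \<sigma> \<Delta>) = sets ?B"
    unfolding model_def by (rule sets_bind_measurable[OF N]) simp
  then have FM: "F \<in> borel_measurable (model n p K \<sigma> \<Delta>)"
    using F by (subst measurable_cong_sets[OF _ refl, of _ ?B])
  have "(\<integral>z. F z \<partial>model n p K \<sigma> \<Delta>) = enn2real (\<integral>\<^sup>+z. ennreal (F z) \<partial>model n p K \<sigma> \<Delta>)"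
    using FM nonneg by (intro integral_eq_nn_integral) auto
  also have "\<dots> = latent_mean n p K (centre_eps p \<sigma> \<Delta>) ?I"
    unfolding nn by (intro enn2real_ennreal) (auto simp: latent_mean_def nonneg intro!: divide_nonneg_nonneg sum_nonneg integral_nonneg_AE)
  finally show ?thesis .
qed

section \<open>A dual certificate for low-degree estimators\<close>

text \<open>Joint cumulants with repetitions: \<open>\<alpha> v\<close> copies of the variable \<open>v\<close>, where \<open>A\<close> gives the moments
  and \<open>B\<close> the moments multiplied by the further variable. The binomials count the ways to choose
  the copies. Only arguments in \<open>extensional V\<close> appear in the recursion, so that the sum is finite.\<close>

function multi_cumulant ::
    "'v set \<Rightarrow> (('v \<Rightarrow> nat) \<Rightarrow> real) \<Rightarrow> (('v \<Rightarrow> nat) \<Rightarrow> real) \<Rightarrow> ('v \<Rightarrow> nat) \<Rightarrow> real" where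
  "multi_cumulant V A B \<alpha> = (if finite V then B \<alpha> -
     (\<Sum>\<beta>\<in>{\<beta>\<in>V \<rightarrow>\<^sub>E UNIV. (\<forall>v\<in>V. \<beta> v \<le> \<alpha> v) \<and> (\<exists>v\<in>V. \<beta> v < \<alpha> v)}.
        multi_cumulant V A B \<beta> * ((\<Prod>v\<in>V. of_nat (\<alpha> v choose \<beta> v)) * A (\<lambda>v. \<alpha> v - \<beta> v))) else 0)"
  by auto
termination
  by (relation "inv_image less_than (\<lambda>(V, A, B, \<alpha>). \<Sum>v\<in>V. \<alpha> v)") (auto intro!: sum_strict_mono_ex1)
declare multi_cumulant.simps [simp del]

lemma multi_cumulant_convolution:
  assumes V: "finite V" and \<alpha>: "\<alpha> \<in> extensional V" and A: "A (\<lambda>v. 0) = 1"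
  shows "(\<Sum>\<beta>\<in>(\<Pi>\<^sub>E v\<in>V. {..\<alpha> v}). multi_cumulant V A B \<beta> * ((\<Prod>v\<in>V. of_nat (\<alpha> v choose \<beta> v)) * A (\<lambda>v. \<alpha> v - \<beta> v))) = B \<alpha>"
proof -
  have fin: "finite (\<Pi>\<^sub>E v\<in>V. {..\<alpha> v})" using V by (intro finite_PiE) auto
  have \<alpha>': "\<alpha> \<in> (\<Pi>\<^sub>E v\<in>V. {..\<alpha> v})" using \<alpha> by (auto simp: PiE_iff)
  have eq: "{\<beta>\<in>V \<rightarrow>\<^sub>E UNIV. (\<forall>v\<in>V. \<beta> v \<le> \<alpha> v) \<and> (\<exists>v\<in>V. \<beta> v < \<alpha> v)} = (\<Pi>\<^sub>E v\<in>V. {..\<alpha> v}) - {\<alpha>}"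
  proof (intro set_eqI iffI)
    fix \<beta> assume \<beta>: "\<beta> \<in> (\<Pi>\<^sub>E v\<in>V. {..\<alpha> v}) - {\<alpha>}"
    have "\<exists>v\<in>V. \<beta> v \<noteq> \<alpha> v"
    proof (rule ccontr)
      assume "\<not> ?thesis"
      then have "\<beta> = \<alpha>" using \<beta> \<alpha> by (intro extensionalityI[of \<beta> V \<alpha>]) (auto simp: PiE_iff)
      then show False using \<beta> by simp
    qed
    then show "\<beta> \<in> {\<beta>\<in>V \<rightarrow>\<^sub>E UNIV. (\<forall>v\<in>V. \<beta> v \<le> \<alpha> v) \<and> (\<exists>v\<in>V. \<beta> v < \<alpha> v)}"
      using \<beta> by (auto simp: PiE_iff less_le)
  qed (auto simp: PiE_iff)
  show ?thesis
    using V A unfolding sum.remove[OF fin \<alpha>'] eq[symmetric]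
    by (subst multi_cumulant.simps) simp
qed

lemma has_bochner_integral_sum_mult_sum:
  fixes g :: "'i \<Rightarrow> 'a \<Rightarrow> real" and h :: "'j \<Rightarrow> 'a \<Rightarrow> real"
  assumes "\<And>i j. i \<in> I \<Longrightarrow> j \<in> J \<Longrightarrow> has_bochner_integral M (\<lambda>x. g i x * h j x) (s i j)"
  shows "has_bochner_integral M (\<lambda>x. (\<Sum>i\<in>I. c i * g i x) * (\<Sum>j\<in>J. d j * h j x))
    (\<Sum>i\<in>I. \<Sum>j\<in>J. c i * d j * s i j)"
proof -
  have "has_bochner_integral M (\<lambda>x. \<Sum>i\<in>I. \<Sum>j\<in>J. c i * d j * (g i x * h j x)) (\<Sum>i\<in>I. \<Sum>j\<in>J. c i * d j * s i j)"
    by (intro has_bochner_integral_sum has_bochner_integral_mult_right assms)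
  then show ?thesis by (simp add: sum_product mult_ac)
qed

lemma exponents_le_entries:
  "\<alpha> \<in> exponents_le n p D \<longleftrightarrow> \<alpha> \<in> extensional (entries n p) \<and> (\<Sum>v\<in>entries n p. \<alpha> v) \<le> D"
proof -
  have "\<alpha> v \<le> D" if "(\<Sum>v\<in>entries n p. \<alpha> v) \<le> D" "v \<in> entries n p" for v
    using member_le_sum[of v "entries n p" \<alpha>] that by simp
  then show ?thesis unfolding exponents_le_def entries_def[symmetric] by (auto simp: PiE_iff)
qed

lemma finite_exponents_le: "finite (exponents_le n p D)"
  by (rule finite_subset[of _ "({1..n} \<times> {1..p}) \<rightarrow>\<^sub>E {..D}"]) (auto simp: exponents_le_def intro!: finite_PiE)

lemma exponents_le_downward:
  assumes "\<alpha> \<in> exponents_le n p D"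
  shows "{\<beta> \<in> exponents_le n p D. \<forall>v\<in>entries n p. \<beta> v \<le> \<alpha> v} = (\<Pi>\<^sub>E v\<in>entries n p. {..\<alpha> v})"
proof -
  have "(\<Sum>v\<in>entries n p. \<beta> v) \<le> D" if "\<forall>v\<in>entries n p. \<beta> v \<le> \<alpha> v" for \<beta>
    using that assms sum_mono[of "entries n p" \<beta> \<alpha>] by (auto simp: exponents_le_entries)
  then show ?thesis by (auto simp: exponents_le_entries PiE_iff dest: extensional_arb)
qed

definition hermite_prod :: "nat \<Rightarrow> nat \<Rightarrow> real \<Rightarrow> (nat \<times> nat \<Rightarrow> nat) \<Rightarrow> (nat \<Rightarrow> nat \<Rightarrow> real) \<Rightarrow> real" where
  "hermite_prod n p \<sigma> \<gamma> Y = (\<Prod>v\<in>entries n p. poly (hermite (\<gamma> v)) (Y (fst v) (snd v) / \<sigma>))"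

lemma polys_le_hermite_span:
  assumes s: "\<sigma> > 0" and f: "f \<in> polys_le n p D"
  obtains d where "f = (\<lambda>Y. \<Sum>\<gamma>\<in>exponents_le n p D. d \<gamma> * hermite_prod n p \<sigma> \<gamma> Y)"
proof -
  obtain h where h: "\<And>m y. y ^ m = (\<Sum>l\<le>m. h m l * poly (hermite l) (y :: real))"
    using power_in_hermite_span by metis
  obtain c where c: "f = (\<lambda>Y. \<Sum>\<alpha>\<in>exponents_le n p D. c \<alpha> * (\<Prod>(i, j)\<in>{1..n} \<times> {1..p}. Y i j ^ \<alpha> (i, j)))"
    using f unfolding polys_le_def by blast
  define H where "H \<alpha> \<gamma> = (if \<forall>v\<in>entries n p. \<gamma> v \<le> \<alpha> v then \<Prod>v\<in>entries n p. \<sigma> ^ \<alpha> v * h (\<alpha> v) (\<gamma> v) else 0)" for \<alpha> \<gamma>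
  have mono: "(\<Prod>(i, j)\<in>{1..n} \<times> {1..p}. Y i j ^ \<alpha> (i, j)) = (\<Sum>\<gamma>\<in>exponents_le n p D. H \<alpha> \<gamma> * hermite_prod n p \<sigma> \<gamma> Y)"
    if \<alpha>: "\<alpha> \<in> exponents_le n p D" for \<alpha> Y
  proof -
    have "(\<Prod>(i, j)\<in>{1..n} \<times> {1..p}. Y i j ^ \<alpha> (i, j)) = (\<Prod>v\<in>entries n p. \<Sum>l\<in>{..\<alpha> v}. \<sigma> ^ \<alpha> v * h (\<alpha> v) l * poly (hermite l) (Y (fst v) (snd v) / \<sigma>))"
      unfolding entries_def
    proof (rule prod.cong[OF refl], clarify)
      fix i j
      have "Y i j ^ \<alpha> (i, j) = \<sigma> ^ \<alpha> (i, j) * (Y i j / \<sigma>) ^ \<alpha> (i, j)" using s by (simp add: power_divide)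
      then show "Y i j ^ \<alpha> (i, j) = (\<Sum>l\<in>{..\<alpha> (i, j)}. \<sigma> ^ \<alpha> (i, j) * h (\<alpha> (i, j)) l * poly (hermite l) (Y (fst (i, j)) (snd (i, j)) / \<sigma>))"
        unfolding h[of "Y i j / \<sigma>"] by (simp add: sum_distrib_left mult.assoc)
    qed
    also have "\<dots> = (\<Sum>\<gamma>\<in>(\<Pi>\<^sub>E v\<in>entries n p. {..\<alpha> v}). \<Prod>v\<in>entries n p. \<sigma> ^ \<alpha> v * h (\<alpha> v) (\<gamma> v) * poly (hermite (\<gamma> v)) (Y (fst v) (snd v) / \<sigma>))"
      by (rule prod_sum_PiE) auto
    also have "\<dots> = (\<Sum>\<gamma>\<in>{\<gamma> \<in> exponents_le n p D. \<forall>v\<in>entries n p. \<gamma> v \<le> \<alpha> v}. H \<alpha> \<gamma> * hermite_prod n p \<sigma> \<gamma> Y)"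
      unfolding exponents_le_downward[OF \<alpha>]
      by (intro sum.cong refl) (auto simp: H_def hermite_prod_def prod.distrib PiE_iff)
    also have "\<dots> = (\<Sum>\<gamma>\<in>exponents_le n p D. H \<alpha> \<gamma> * hermite_prod n p \<sigma> \<gamma> Y)"
      by (rule sum.mono_neutral_left) (auto simp: finite_exponents_le H_def)
    finally show ?thesis .
  qed
  have "f Y = (\<Sum>\<gamma>\<in>exponents_le n p D. (\<Sum>\<alpha>\<in>exponents_le n p D. c \<alpha> * H \<alpha> \<gamma>) * hermite_prod n p \<sigma> \<gamma> Y)" for Y
  proof -
    have "f Y = (\<Sum>\<alpha>\<in>exponents_le n p D. \<Sum>\<gamma>\<in>exponents_le n p D. c \<alpha> * H \<alpha> \<gamma> * hermite_prod n p \<sigma> \<gamma> Y)"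
      unfolding c by (intro sum.cong refl) (simp only: mono sum_distrib_left mult.assoc)
    also have "\<dots> = (\<Sum>\<gamma>\<in>exponents_le n p D. \<Sum>\<alpha>\<in>exponents_le n p D. c \<alpha> * H \<alpha> \<gamma> * hermite_prod n p \<sigma> \<gamma> Y)"
      by (rule sum.swap)
    finally show ?thesis by (simp only: sum_distrib_right)
  qed
  then show ?thesis by (intro that[of "\<lambda>\<gamma>. \<Sum>\<alpha>\<in>exponents_le n p D. c \<alpha> * H \<alpha> \<gamma>"] ext)
qed

lemma latent_mean_add: "latent_mean n p K e (\<lambda>\<omega>. g \<omega> + h \<omega>) = latent_mean n p K e g + latent_mean n p K e h"
  by (simp add: latent_mean_def sum.distrib add_divide_distrib)

lemma latent_mean_diff: "latent_mean n p K e (\<lambda>\<omega>. g \<omega> - h \<omega>) = latent_mean n p K e g - latent_mean n p K e h"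
  by (simp add: latent_mean_def sum_subtractf diff_divide_distrib)

lemma latent_mean_cmult: "latent_mean n p K e (\<lambda>\<omega>. c * g \<omega>) = c * latent_mean n p K e g"
  by (simp add: latent_mean_def sum_distrib_left[symmetric])

lemma latent_mean_sum: "latent_mean n p K e (\<lambda>\<omega>. \<Sum>i\<in>I. g i \<omega>) = (\<Sum>i\<in>I. latent_mean n p K e (g i))"
  unfolding latent_mean_def by (subst sum.swap) (simp add: sum_divide_distrib)

lemma latent_mean_mono: "(\<And>\<omega>. g \<omega> \<le> h \<omega>) \<Longrightarrow> latent_mean n p K e g \<le> latent_mean n p K e h"
  unfolding latent_mean_def by (intro divide_right_mono sum_mono) auto

lemma latent_mean_const: "K \<ge> 1 \<Longrightarrow> latent_mean n p K e (\<lambda>_. c) = c"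
  using latent_states_nonempty[of K n p e] finite_latent_states[of n p K e] by (simp add: latent_mean_def)

locale latent_gaussian =
  fixes n p K :: nat and \<sigma> e :: real and a b :: nat
  assumes s: "\<sigma> > 0" and K: "K \<ge> 1"
begin

abbreviation V where "V \<equiv> entries n p"
abbreviation law where "law \<omega> \<equiv> data_law n p \<sigma> (fst \<omega>) (snd \<omega>)"
abbreviation mean where "mean \<equiv> latent_mean n p K e"

text \<open>The multivariate Hermite polynomial at the noise \<open>Y / \<sigma> - X\<close>, whereas \<open>hermite_prod\<close>
  evaluates it at \<open>Y / \<sigma>\<close>.\<close>

definition noise_prod :: "(nat \<times> nat \<Rightarrow> nat) \<Rightarrow> (nat \<Rightarrow> nat) \<times> (nat \<Rightarrow> nat \<Rightarrow> real) \<Rightarrow> (nat \<Rightarrow> nat \<Rightarrow> real) \<Rightarrow> real" where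
  "noise_prod \<beta> \<omega> Y = (\<Prod>v\<in>V. poly (hermite (\<beta> v)) (Y (fst v) (snd v) / \<sigma> - signal \<sigma> \<omega> v))"

definition signal_moment :: "(nat \<times> nat \<Rightarrow> nat) \<Rightarrow> real" where
  "signal_moment \<gamma> = mean (\<lambda>\<omega>. \<Prod>v\<in>V. signal \<sigma> \<omega> v ^ \<gamma> v)"

definition target_moment :: "(nat \<times> nat \<Rightarrow> nat) \<Rightarrow> real" where
  "target_moment \<gamma> = mean (\<lambda>\<omega>. Mstar (fst \<omega>) a b * (\<Prod>v\<in>V. signal \<sigma> \<omega> v ^ \<gamma> v))"

definition cumulant :: "(nat \<times> nat \<Rightarrow> nat) \<Rightarrow> real" where
  "cumulant = multi_cumulant V signal_moment target_moment"

lemma product_integral: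
  "has_bochner_integral (law \<omega>) (\<lambda>Y. \<Prod>v\<in>V. poly (q v) (Y (fst v) (snd v) / \<sigma> - signal \<sigma> \<omega> v)) (\<Prod>v\<in>V. gauss_fun (q v))"
  using data_law_product_integral[OF s, of n p "fst \<omega>" "snd \<omega>" q] by simp

lemma hermite_prod_altdef:
  "hermite_prod n p \<sigma> \<gamma> Y = (\<Prod>v\<in>V. poly (shifted_hermite (signal \<sigma> \<omega> v) (\<gamma> v)) (Y (fst v) (snd v) / \<sigma> - signal \<sigma> \<omega> v))"
  by (simp add: hermite_prod_def poly_shifted_hermite)

lemma hermite_prod_integral:
  "has_bochner_integral (law \<omega>) (hermite_prod n p \<sigma> \<gamma>) (\<Prod>v\<in>V. signal \<sigma> \<omega> v ^ \<gamma> v)"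
  using product_integral[of \<omega> "\<lambda>v. shifted_hermite (signal \<sigma> \<omega> v) (\<gamma> v)"]
  by (simp add: gauss_fun_shifted_hermite hermite_prod_altdef[of _ _ \<omega>, abs_def])

lemma hermite_prod_mult_integrable:
  "integrable (law \<omega>) (\<lambda>Y. hermite_prod n p \<sigma> \<gamma> Y * hermite_prod n p \<sigma> \<gamma>' Y)"
  using product_integral[of \<omega> "\<lambda>v. shifted_hermite (signal \<sigma> \<omega> v) (\<gamma> v) * shifted_hermite (signal \<sigma> \<omega> v) (\<gamma>' v)"]
  by (simp add: has_bochner_integral_iff hermite_prod_altdef[of _ _ \<omega>] prod.distrib)

lemma noise_hermite_integral:
  "has_bochner_integral (law \<omega>) (\<lambda>Y. noise_prod \<beta> \<omega> Y * hermite_prod n p \<sigma> \<gamma> Y)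
    ((\<Prod>v\<in>V. fact (\<beta> v)) * ((\<Prod>v\<in>V. real (\<gamma> v choose \<beta> v)) * (\<Prod>v\<in>V. signal \<sigma> \<omega> v ^ (\<gamma> v - \<beta> v))))"
  using product_integral[of \<omega> "\<lambda>v. hermite (\<beta> v) * shifted_hermite (signal \<sigma> \<omega> v) (\<gamma> v)"]
  by (simp add: gauss_fun_hermite_shifted noise_prod_def hermite_prod_altdef[of _ _ \<omega>] prod.distrib mult.assoc)

lemma noise_noise_integral:
  assumes "\<beta> \<in> extensional V" "\<gamma> \<in> extensional V"
  shows "has_bochner_integral (law \<omega>) (\<lambda>Y. noise_prod \<beta> \<omega> Y * noise_prod \<gamma> \<omega> Y)
    (if \<beta> = \<gamma> then \<Prod>v\<in>V. fact (\<gamma> v) else 0)"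
proof -
  have "(\<Prod>v\<in>V. gauss_fun (hermite (\<beta> v) * hermite (\<gamma> v))) = (if \<beta> = \<gamma> then \<Prod>v\<in>V. fact (\<gamma> v) else 0)"
  proof (cases "\<beta> = \<gamma>")
    case False
    then obtain v where "v \<in> V" "\<beta> v \<noteq> \<gamma> v" using assms extensionalityI by blast
    then have "\<exists>v\<in>V. gauss_fun (hermite (\<beta> v) * hermite (\<gamma> v)) = 0" by (auto simp: gauss_fun_hermite_orthogonal)
    then show ?thesis using False by (simp add: prod_zero_iff)
  qed (simp add: gauss_fun_hermite_orthogonal)
  then show ?thesis
    using product_integral[of \<omega> "\<lambda>v. hermite (\<beta> v) * hermite (\<gamma> v)"]
    by (simp add: noise_prod_def prod.distrib)
qed

lemma hermite_combination_integrable: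
  assumes "finite G"
  shows "has_bochner_integral (law \<omega>) (\<lambda>Y. \<Sum>\<gamma>\<in>G. d \<gamma> * hermite_prod n p \<sigma> \<gamma> Y) (\<Sum>\<gamma>\<in>G. d \<gamma> * (\<Prod>v\<in>V. signal \<sigma> \<omega> v ^ \<gamma> v))"
    "integrable (law \<omega>) (\<lambda>Y. (\<Sum>\<gamma>\<in>G. d \<gamma> * hermite_prod n p \<sigma> \<gamma> Y)\<^sup>2)"
proof -
  show "has_bochner_integral (law \<omega>) (\<lambda>Y. \<Sum>\<gamma>\<in>G. d \<gamma> * hermite_prod n p \<sigma> \<gamma> Y) (\<Sum>\<gamma>\<in>G. d \<gamma> * (\<Prod>v\<in>V. signal \<sigma> \<omega> v ^ \<gamma> v))"
    by (intro has_bochner_integral_sum has_bochner_integral_mult_right hermite_prod_integral)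
  have "has_bochner_integral (law \<omega>) (\<lambda>Y. (\<Sum>\<gamma>\<in>G. d \<gamma> * hermite_prod n p \<sigma> \<gamma> Y) * (\<Sum>\<gamma>\<in>G. d \<gamma> * hermite_prod n p \<sigma> \<gamma> Y))
    (\<Sum>i\<in>G. \<Sum>j\<in>G. d i * d j * (\<integral>Y. hermite_prod n p \<sigma> i Y * hermite_prod n p \<sigma> j Y \<partial>law \<omega>))"
    by (intro has_bochner_integral_sum_mult_sum) (simp add: has_bochner_integral_iff hermite_prod_mult_integrable)
  then show "integrable (law \<omega>) (\<lambda>Y. (\<Sum>\<gamma>\<in>G. d \<gamma> * hermite_prod n p \<sigma> \<gamma> Y)\<^sup>2)"
    by (simp add: has_bochner_integral_iff power2_eq_square)
qed

text \<open>After integrating the noise, the certificate reproduces the correlation of the target with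
  \<open>He\<^sub>\<gamma>(Y / \<sigma>)\<close>; this is the recursion defining the cumulants, extended by zero terms to all
  exponents of degree at most \<open>D\<close>.\<close>

lemma noise_hermite_mean:
  assumes \<gamma>: "\<gamma> \<in> exponents_le n p D"
  shows "(\<Sum>\<beta>\<in>exponents_le n p D. cumulant \<beta> * ((\<Prod>v\<in>V. real (\<gamma> v choose \<beta> v)) * signal_moment (\<lambda>v. \<gamma> v - \<beta> v))) = target_moment \<gamma>"
proof -
  let ?t = "\<lambda>\<beta>. cumulant \<beta> * ((\<Prod>v\<in>V. real (\<gamma> v choose \<beta> v)) * signal_moment (\<lambda>v. \<gamma> v - \<beta> v))"
  have "sum ?t (exponents_le n p D) =
     sum ?t {\<beta> \<in> exponents_le n p D. \<forall>v\<in>V. \<beta> v \<le> \<gamma> v}"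
  proof (rule sum.mono_neutral_right)
    show "\<forall>\<beta>\<in>exponents_le n p D - {\<beta> \<in> exponents_le n p D. \<forall>v\<in>V. \<beta> v \<le> \<gamma> v}.
       ?t \<beta> = 0"
    proof
      fix \<beta> assume "\<beta> \<in> exponents_le n p D - {\<beta> \<in> exponents_le n p D. \<forall>v\<in>V. \<beta> v \<le> \<gamma> v}"
      then obtain v where "v \<in> V" "\<gamma> v < \<beta> v" by (auto simp: not_le)
      then have "(\<Prod>v\<in>V. real (\<gamma> v choose \<beta> v)) = 0" by (auto simp: prod_zero_iff binomial_eq_0)
      then show "?t \<beta> = 0" by simp
    qed
  qed (auto simp: finite_exponents_le)
  also have "\<dots> = target_moment \<gamma>"
    unfolding exponents_le_downward[OF \<gamma>] cumulant_def
    using \<gamma> by (intro multi_cumulant_convolution) (auto simp: exponents_le_entries signal_moment_def latent_mean_const[OF K])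
  finally show ?thesis .
qed

text \<open>The duality bound. Pointwise in the latent state, nonnegativity of \<open>E (f - W)\<^sup>2\<close> gives
  \<open>E f\<^sup>2 \<ge> 2 E[f W] - E W\<^sup>2\<close>; on average \<open>E[f W]\<close> equals \<open>E[f x]\<close>, so the terms that are linear in \<open>f\<close>
  cancel in \<open>E (f - x)\<^sup>2\<close>.\<close>

lemma mean_square_error_ge:
  fixes D :: nat
  defines "G \<equiv> exponents_le n p D"
  shows "mean (\<lambda>\<omega>. \<integral>Y. ((\<Sum>\<gamma>\<in>G. d \<gamma> * hermite_prod n p \<sigma> \<gamma> Y) - Mstar (fst \<omega>) a b)\<^sup>2 \<partial>law \<omega>)
    \<ge> mean (\<lambda>\<omega>. (Mstar (fst \<omega>) a b)\<^sup>2) - (\<Sum>\<beta>\<in>G. (cumulant \<beta>)\<^sup>2 / (\<Prod>v\<in>V. fact (\<beta> v)))"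
proof -
  have fG: "finite G" by (simp add: G_def finite_exponents_le)
  define f where "f Y = (\<Sum>\<gamma>\<in>G. d \<gamma> * hermite_prod n p \<sigma> \<gamma> Y)" for Y
  define w where "w \<beta> = cumulant \<beta> / (\<Prod>v\<in>V. fact (\<beta> v))" for \<beta> :: "nat \<times> nat \<Rightarrow> nat"
  define W where "W \<omega> Y = (\<Sum>\<beta>\<in>G. w \<beta> * noise_prod \<beta> \<omega> Y)" for \<omega> Y
  define M where "M \<omega> = Mstar (fst \<omega>) a b" for \<omega> :: "(nat \<Rightarrow> nat) \<times> (nat \<Rightarrow> nat \<Rightarrow> real)"
  define S where "S \<omega> \<gamma> = (\<Prod>v\<in>V. signal \<sigma> \<omega> v ^ \<gamma> v)" for \<omega> and \<gamma> :: "nat \<times> nat \<Rightarrow> nat"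
  define bin where "bin \<gamma> \<beta> = (\<Prod>v\<in>V. real (\<gamma> v choose \<beta> v))" for \<gamma> \<beta> :: "nat \<times> nat \<Rightarrow> nat"
  define cross where "cross \<omega> = (\<Sum>\<gamma>\<in>G. d \<gamma> * (\<Sum>\<beta>\<in>G. cumulant \<beta> * (bin \<gamma> \<beta> * S \<omega> (\<lambda>v. \<gamma> v - \<beta> v))))" for \<omega>
  define N where "N = (\<Sum>\<beta>\<in>G. (cumulant \<beta>)\<^sup>2 / (\<Prod>v\<in>V. fact (\<beta> v)))"
  have fact_nz: "(\<Prod>v\<in>V. fact (\<beta> v) :: real) \<noteq> 0" for \<beta> :: "nat \<times> nat \<Rightarrow> nat" by (simp add: prod_zero_iff)
  have ptwise: "(\<integral>Y. (f Y - M \<omega>)\<^sup>2 \<partial>law \<omega>) \<ge> (M \<omega>)\<^sup>2 - 2 * (M \<omega> * (\<Sum>\<gamma>\<in>G. d \<gamma> * S \<omega> \<gamma>)) + 2 * cross \<omega> - N" for \<omega>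
  proof -
    interpret P: prob_space "law \<omega>" by (rule prob_space_data_law[OF s])
    have f1: "has_bochner_integral (law \<omega>) f (\<Sum>\<gamma>\<in>G. d \<gamma> * S \<omega> \<gamma>)"
      using hermite_combination_integrable(1)[OF fG, of \<omega> d] by (simp add: f_def[abs_def] S_def)
    have f2: "integrable (law \<omega>) (\<lambda>Y. (f Y)\<^sup>2)"
      using hermite_combination_integrable(2)[OF fG, of \<omega> d] by (simp add: f_def[abs_def])
    have "has_bochner_integral (law \<omega>) (\<lambda>Y. f Y * W \<omega> Y)
      (\<Sum>\<gamma>\<in>G. \<Sum>\<beta>\<in>G. d \<gamma> * w \<beta> * ((\<Prod>v\<in>V. fact (\<beta> v)) * (bin \<gamma> \<beta> * S \<omega> (\<lambda>v. \<gamma> v - \<beta> v))))"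
      unfolding f_def W_def bin_def S_def
      by (intro has_bochner_integral_sum_mult_sum) (subst mult.commute, rule noise_hermite_integral)
    moreover have "d \<gamma> * w \<beta> * ((\<Prod>v\<in>V. fact (\<beta> v)) * (bin \<gamma> \<beta> * S \<omega> (\<lambda>v. \<gamma> v - \<beta> v))) = d \<gamma> * (cumulant \<beta> * (bin \<gamma> \<beta> * S \<omega> (\<lambda>v. \<gamma> v - \<beta> v)))" for \<gamma> \<beta>
      using fact_nz[of \<beta>] by (simp add: w_def)
    ultimately have fW: "has_bochner_integral (law \<omega>) (\<lambda>Y. f Y * W \<omega> Y) (cross \<omega>)"
      by (simp add: cross_def sum_distrib_left)
    have "has_bochner_integral (law \<omega>) (\<lambda>Y. W \<omega> Y * W \<omega> Y)
      (\<Sum>\<beta>\<in>G. \<Sum>\<gamma>\<in>G. w \<beta> * w \<gamma> * (if \<beta> = \<gamma> then \<Prod>v\<in>V. fact (\<gamma> v) else 0))"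
      unfolding W_def
      by (intro has_bochner_integral_sum_mult_sum noise_noise_integral) (auto simp: G_def exponents_le_entries)
    moreover have "(\<Sum>\<gamma>\<in>G. w \<beta> * w \<gamma> * (if \<beta> = \<gamma> then \<Prod>v\<in>V. fact (\<gamma> v) else 0)) = (cumulant \<beta>)\<^sup>2 / (\<Prod>v\<in>V. fact (\<beta> v))" if "\<beta> \<in> G" for \<beta>
    proof -
      have "(\<Sum>\<gamma>\<in>G. w \<beta> * w \<gamma> * (if \<beta> = \<gamma> then \<Prod>v\<in>V. fact (\<gamma> v) else 0)) = (\<Sum>\<gamma>\<in>G. if \<beta> = \<gamma> then w \<beta> * w \<gamma> * (\<Prod>v\<in>V. fact (\<gamma> v)) else 0)"
        by (intro sum.cong) auto
      also have "\<dots> = w \<beta> * w \<beta> * (\<Prod>v\<in>V. fact (\<beta> v))" using fG that by simp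
      finally show ?thesis using fact_nz[of \<beta>] by (simp add: w_def power2_eq_square)
    qed
    ultimately have WW: "has_bochner_integral (law \<omega>) (\<lambda>Y. W \<omega> Y * W \<omega> Y) N"
      by (simp add: N_def)
    have "0 \<le> (\<integral>Y. (f Y - W \<omega> Y)\<^sup>2 \<partial>law \<omega>)" by (rule integral_nonneg_AE) auto
    also have "(\<integral>Y. (f Y - W \<omega> Y)\<^sup>2 \<partial>law \<omega>) = (\<integral>Y. ((f Y)\<^sup>2 - 2 * (f Y * W \<omega> Y)) + W \<omega> Y * W \<omega> Y \<partial>law \<omega>)"
      by (intro Bochner_Integration.integral_cong) (auto simp: power2_eq_square algebra_simps)
    also have "\<dots> = (\<integral>Y. (f Y)\<^sup>2 \<partial>law \<omega>) - 2 * cross \<omega> + N"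
      using f2 fW WW by (simp add: has_bochner_integral_iff)
    finally have 1: "(\<integral>Y. (f Y)\<^sup>2 \<partial>law \<omega>) \<ge> 2 * cross \<omega> - N" by simp
    have "(\<integral>Y. (f Y - M \<omega>)\<^sup>2 \<partial>law \<omega>) = (\<integral>Y. ((f Y)\<^sup>2 - 2 * M \<omega> * f Y) + (M \<omega>)\<^sup>2 \<partial>law \<omega>)"
      by (intro Bochner_Integration.integral_cong) (auto simp: power2_eq_square algebra_simps)
    also have "\<dots> = (\<integral>Y. (f Y)\<^sup>2 \<partial>law \<omega>) - 2 * M \<omega> * (\<Sum>\<gamma>\<in>G. d \<gamma> * S \<omega> \<gamma>) + (M \<omega>)\<^sup>2"
      using f2 f1 by (simp add: has_bochner_integral_iff P.prob_space)
    finally show ?thesis using 1 by simp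
  qed
  have m1: "mean (\<lambda>\<omega>. M \<omega> * (\<Sum>\<gamma>\<in>G. d \<gamma> * S \<omega> \<gamma>)) = (\<Sum>\<gamma>\<in>G. d \<gamma> * target_moment \<gamma>)"
  proof -
    have "mean (\<lambda>\<omega>. M \<omega> * (\<Sum>\<gamma>\<in>G. d \<gamma> * S \<omega> \<gamma>)) = mean (\<lambda>\<omega>. \<Sum>\<gamma>\<in>G. d \<gamma> * (M \<omega> * S \<omega> \<gamma>))"
      by (simp add: sum_distrib_left mult_ac)
    then show ?thesis by (simp add: latent_mean_sum latent_mean_cmult target_moment_def M_def S_def)
  qed
  have m2: "mean cross = (\<Sum>\<gamma>\<in>G. d \<gamma> * target_moment \<gamma>)"
  proof -
    have "mean cross = (\<Sum>\<gamma>\<in>G. d \<gamma> * (\<Sum>\<beta>\<in>G. cumulant \<beta> * (bin \<gamma> \<beta> * mean (\<lambda>\<omega>. S \<omega> (\<lambda>v. \<gamma> v - \<beta> v)))))"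
      unfolding cross_def[abs_def] by (simp only: latent_mean_sum latent_mean_cmult)
    also have "\<dots> = (\<Sum>\<gamma>\<in>G. d \<gamma> * target_moment \<gamma>)"
      using noise_hermite_mean[of _ D] by (intro sum.cong refl) (simp add: G_def bin_def S_def signal_moment_def[symmetric])
    finally show ?thesis .
  qed
  have "mean (\<lambda>\<omega>. (M \<omega>)\<^sup>2) - N = mean (\<lambda>\<omega>. (M \<omega>)\<^sup>2 - 2 * (M \<omega> * (\<Sum>\<gamma>\<in>G. d \<gamma> * S \<omega> \<gamma>)) + 2 * cross \<omega> - N)"
    unfolding latent_mean_diff latent_mean_add latent_mean_cmult m1 m2 latent_mean_const[OF K] by simp
  also have "\<dots> \<le> mean (\<lambda>\<omega>. \<integral>Y. (f Y - M \<omega>)\<^sup>2 \<partial>law \<omega>)"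
    by (rule latent_mean_mono) (rule ptwise)
  finally show ?thesis by (simp add: N_def f_def M_def)
qed

end

lemma model_mean_square_error:
  assumes s: "\<sigma> > 0" and K: "K \<ge> 1" and f: "f \<in> polys_le n p D"
  shows "(\<integral>((k, \<mu>), Y). (f Y - Mstar k a b)\<^sup>2 \<partial>model n p K \<sigma> \<Delta>) =
    latent_mean n p K (centre_eps p \<sigma> \<Delta>) (\<lambda>\<omega>. \<integral>Y. (f Y - Mstar (fst \<omega>) a b)\<^sup>2 \<partial>data_law n p \<sigma> (fst \<omega>) (snd \<omega>))"
proof -
  interpret latent_gaussian n p K \<sigma> "centre_eps p \<sigma> \<Delta>" a b by standard (use s K in auto)
  obtain d where d: "f = (\<lambda>Y. \<Sum>\<gamma>\<in>exponents_le n p D. d \<gamma> * hermite_prod n p \<sigma> \<gamma> Y)"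
    using polys_le_hermite_span[OF s f] by blast
  let ?F = "\<lambda>z. (f (snd z) - Mstar (fst (fst z)) a b)\<^sup>2"
  have int1: "integrable (law \<omega>) f" for \<omega>
    using hermite_combination_integrable(1)[OF finite_exponents_le, of \<omega> d] unfolding d has_bochner_integral_iff by blast
  have int2: "integrable (law \<omega>) (\<lambda>Y. (f Y)\<^sup>2)" for \<omega>
    unfolding d by (rule hermite_combination_integrable(2)[OF finite_exponents_le])
  have "f \<in> borel_measurable (law undefined)" using int1 by auto
  then have fm: "f \<in> borel_measurable (observed n p)"
    using measurable_cong_sets[OF sets_data_law refl, of n p \<sigma> "fst undefined" "snd undefined"] unfolding observed_def by blast
  have "(\<lambda>z. Mstar (fst (fst z)) a b) \<in> borel_measurable (count_space UNIV \<Otimes>\<^sub>M observed n p)"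
    by (rule measurable_compose[OF measurable_fst]) simp
  moreover have "(\<lambda>z. f (snd z)) \<in> borel_measurable (count_space UNIV \<Otimes>\<^sub>M observed n p)"
    by (rule measurable_compose[OF measurable_snd fm])
  ultimately have F: "?F \<in> borel_measurable (count_space UNIV \<Otimes>\<^sub>M observed n p)" by measurable
  have "integrable (data_law n p \<sigma> k \<mu>) (\<lambda>Y. ?F ((k, \<mu>), Y))" for k \<mu>
  proof -
    interpret P: prob_space "data_law n p \<sigma> k \<mu>" by (rule prob_space_data_law[OF s])
    have "integrable (data_law n p \<sigma> k \<mu>) (\<lambda>Y. ((f Y)\<^sup>2 - 2 * Mstar k a b * f Y) + (Mstar k a b)\<^sup>2)"
      using int1[of "(k, \<mu>)"] int2[of "(k, \<mu>)"] by simp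
    then show ?thesis by (simp add: power2_diff algebra_simps)
  qed
  from model_integral[OF s K F _ this]
  have "(\<integral>z. ?F z \<partial>model n p K \<sigma> \<Delta>) = mean (\<lambda>\<omega>. \<integral>Y. (f Y - Mstar (fst \<omega>) a b)\<^sup>2 \<partial>law \<omega>)"
    by simp
  moreover have "(\<lambda>((k, \<mu> :: nat \<Rightarrow> nat \<Rightarrow> real), Y). (f Y - Mstar k a b)\<^sup>2) = ?F" by (auto simp: fun_eq_iff)
  ultimately show ?thesis by simp
qed

section \<open>From multi-indices to labelled edges\<close>

text \<open>A multi-index \<open>\<alpha>\<close> is traded for a set of labelled edges, of which \<open>v\<close> places \<open>\<alpha> w\<close> on the
  entry \<open>w\<close>.\<close>

definition edge_count :: "'v set \<Rightarrow> ('e \<Rightarrow> 'v) \<Rightarrow> 'e set \<Rightarrow> 'v \<Rightarrow> nat" where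
  "edge_count V v T = (\<lambda>w\<in>V. card {t\<in>T. v t = w})"

lemma card_subsets_edge_count:
  assumes T: "finite T" and V: "finite V" "v ` T \<subseteq> V" and \<beta>: "\<beta> \<in> extensional V"
  shows "card {U. U \<subseteq> T \<and> edge_count V v U = \<beta>} = (\<Prod>w\<in>V. edge_count V v T w choose \<beta> w)"
proof -
  let ?F = "\<lambda>w. {t\<in>T. v t = w}"
  have "bij_betw (\<lambda>U. \<lambda>w\<in>V. {t\<in>U. v t = w}) {U. U \<subseteq> T \<and> edge_count V v U = \<beta>}
      (\<Pi>\<^sub>E w\<in>V. {S. S \<subseteq> ?F w \<and> card S = \<beta> w})"
  proof (rule bij_betw_byWitness[where f'="\<lambda>S. \<Union>w\<in>V. S w"], goal_cases)
    case 1 show ?case using V(2) by (auto simp: image_subset_iff)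
  next
    case 2
    show ?case
    proof
      fix S assume S: "S \<in> (\<Pi>\<^sub>E w\<in>V. {S. S \<subseteq> ?F w \<and> card S = \<beta> w})"
      show "(\<lambda>w\<in>V. {t \<in> (\<Union>w\<in>V. S w). v t = w}) = S"
      proof (rule extensionalityI[of _ V])
        fix w assume w: "w \<in> V"
        have "S w' \<subseteq> ?F w'" if "w' \<in> V" for w' using S that by (auto simp: PiE_iff)
        then have "{t \<in> (\<Union>w\<in>V. S w). v t = w} = S w" using w by blast
        then show "(\<lambda>w\<in>V. {t \<in> (\<Union>w\<in>V. S w). v t = w}) w = S w" using w by simp
      qed (use S in \<open>auto simp: PiE_iff\<close>)
    qed
  next
    case 3
    show ?case by (auto simp: edge_count_def)
  next
    case 4
    show ?case
    proof clarify
      fix S assume S: "S \<in> (\<Pi>\<^sub>E w\<in>V. {S. S \<subseteq> ?F w \<and> card S = \<beta> w})"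
      have sub: "S w' \<subseteq> ?F w'" "card (S w') = \<beta> w'" if "w' \<in> V" for w' using S that by (auto simp: PiE_iff)
      have "{t \<in> (\<Union>w\<in>V. S w). v t = w} = S w" if "w \<in> V" for w using sub(1) that by blast
      then have "edge_count V v (\<Union>w\<in>V. S w) = \<beta>"
        using sub(2) \<beta> unfolding edge_count_def by (intro extensionalityI[of _ V]) auto
      moreover have "(\<Union>w\<in>V. S w) \<subseteq> T" using sub(1) by blast
      ultimately show "(\<Union>w\<in>V. S w) \<subseteq> T \<and> edge_count V v (\<Union>w\<in>V. S w) = \<beta>" by simp
    qed
  qed
  then have "card {U. U \<subseteq> T \<and> edge_count V v U = \<beta>} = card (\<Pi>\<^sub>E w\<in>V. {S. S \<subseteq> ?F w \<and> card S = \<beta> w})"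
    by (rule bij_betw_same_card)
  also have "\<dots> = (\<Prod>w\<in>V. card {S. S \<subseteq> ?F w \<and> card S = \<beta> w})" by (rule card_PiE[OF V(1)])
  also have "\<dots> = (\<Prod>w\<in>V. edge_count V v T w choose \<beta> w)"
    using T by (intro prod.cong refl) (simp add: n_subsets edge_count_def)
  finally show ?thesis .
qed

lemma edge_count_extensional: "edge_count V v T \<in> extensional V"
  unfolding edge_count_def by (rule restrict_extensional)

lemma edge_count_mono: "finite T \<Longrightarrow> U \<subseteq> T \<Longrightarrow> w \<in> V \<Longrightarrow> edge_count V v U w \<le> edge_count V v T w"
  unfolding edge_count_def by (auto intro!: card_mono)

lemma edge_count_Diff:
  assumes "finite T" "U \<subseteq> T" "w \<in> V"
  shows "edge_count V v (T - U) w = edge_count V v T w - edge_count V v U w"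
proof -
  have "{t\<in>T - U. v t = w} = {t\<in>T. v t = w} - {t\<in>U. v t = w}" by auto
  then show ?thesis using assms finite_subset[of U T]
    by (auto simp: edge_count_def intro!: card_Diff_subset)
qed

text \<open>The binomial coefficients of the multi-index recursion disappear when copies of an entry are
  told apart.\<close>

lemma sum_Pow_edge_count:
  fixes g :: "('v \<Rightarrow> nat) \<Rightarrow> real"
  assumes T: "finite T" and V: "finite V" "v ` T \<subseteq> V"
  shows "(\<Sum>U\<in>Pow T. g (edge_count V v U)) =
    (\<Sum>\<beta>\<in>(\<Pi>\<^sub>E w\<in>V. {..edge_count V v T w}). (\<Prod>w\<in>V. of_nat (edge_count V v T w choose \<beta> w)) * g \<beta>)"
proof -
  have "(\<Sum>U\<in>Pow T. g (edge_count V v U)) =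
    (\<Sum>\<beta>\<in>(\<Pi>\<^sub>E w\<in>V. {..edge_count V v T w}). \<Sum>U | U \<in> Pow T \<and> edge_count V v U = \<beta>. g (edge_count V v U))"
  proof (rule sum.group[symmetric])
    show "edge_count V v ` Pow T \<subseteq> (\<Pi>\<^sub>E w\<in>V. {..edge_count V v T w})"
      using edge_count_mono[OF T, of _ _ V v] by (auto simp: PiE_iff) (auto simp: edge_count_def)
  qed (use T V in \<open>auto intro!: finite_PiE\<close>)
  also have "\<dots> = (\<Sum>\<beta>\<in>(\<Pi>\<^sub>E w\<in>V. {..edge_count V v T w}). (\<Prod>w\<in>V. of_nat (edge_count V v T w choose \<beta> w)) * g \<beta>)"
  proof (rule sum.cong[OF refl])
    fix \<beta> assume "\<beta> \<in> (\<Pi>\<^sub>E w\<in>V. {..edge_count V v T w})"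
    then have "\<beta> \<in> extensional V" by (auto simp: PiE_iff)
    from card_subsets_edge_count[OF T V this]
    show "(\<Sum>U | U \<in> Pow T \<and> edge_count V v U = \<beta>. g (edge_count V v U)) = (\<Prod>w\<in>V. of_nat (edge_count V v T w choose \<beta> w)) * g \<beta>"
      by simp
  qed
  finally show ?thesis .
qed

lemma prod_edge_count:
  fixes x :: "'v \<Rightarrow> real"
  assumes "finite T" "finite V" "v ` T \<subseteq> V"
  shows "(\<Prod>t\<in>T. x (v t)) = (\<Prod>w\<in>V. x w ^ edge_count V v T w)"
proof -
  have "(\<Prod>t\<in>T. x (v t)) = (\<Prod>w\<in>V. \<Prod>t | t \<in> T \<and> v t = w. x (v t))"
    by (rule prod.group[OF assms, symmetric])
  also have "\<dots> = (\<Prod>w\<in>V. x w ^ edge_count V v T w)"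
    by (intro prod.cong refl) (simp add: edge_count_def)
  finally show ?thesis .
qed

lemma sum_sign_choices:
  fixes e :: real
  assumes e: "e \<noteq> 0"
  shows "(\<Sum>x\<in>{e, - e}. x ^ m) = 2 * e ^ m * of_bool (even m)"
proof -
  have "e \<noteq> - e" using e by simp
  then show ?thesis by (cases "even m") (simp_all add: power_minus_odd)
qed

text \<open>The sum over all sign patterns factors over the pairs of a label and a coordinate, and
  \<open>e\<^sup>m + (-e)\<^sup>m\<close> vanishes for odd \<open>m\<close>.\<close>

lemma sum_centres:
  fixes e :: real and v :: "'e \<Rightarrow> nat \<times> nat"
  assumes T: "finite T" and v: "v ` T \<subseteq> entries n p" and e: "e \<noteq> 0" and k: "k \<in> labellings n K"
  shows "(\<Sum>\<mu>\<in>({1..K} \<rightarrow>\<^sub>E ({1..p} \<rightarrow>\<^sub>E {e, - e})). \<Prod>t\<in>T. \<mu> (k (fst (v t))) (snd (v t))) =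
    real (card ({1..K} \<rightarrow>\<^sub>E ({1..p} \<rightarrow>\<^sub>E {e, - e}))) * (e ^ card T * of_bool (\<forall>c. even (card {t\<in>T. (snd (v t), k (fst (v t))) = c})))"
proof -
  define P where "P = {1..K} \<times> {1..p}"
  define m where "m c = card {t\<in>T. (k (fst (v t)), snd (v t)) = c}" for c
  define ev where "ev \<longleftrightarrow> (\<forall>c. even (card {t\<in>T. (snd (v t), k (fst (v t))) = c}))"
  have fP: "finite P" by (simp add: P_def)
  have im: "(\<lambda>t. (k (fst (v t)), snd (v t))) ` T \<subseteq> P"
    using v k by (auto simp: P_def entries_def labellings_def PiE_iff image_subset_iff)
  have grp: "(\<Prod>t\<in>T. x (k (fst (v t)), snd (v t))) = (\<Prod>c\<in>P. x c ^ m c)" for x :: "nat \<times> nat \<Rightarrow> real"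
  proof -
    have "(\<Prod>t\<in>T. x (k (fst (v t)), snd (v t))) = (\<Prod>c\<in>P. x c ^ edge_count P (\<lambda>t. (k (fst (v t)), snd (v t))) T c)"
      by (rule prod_edge_count[OF T fP im])
    then show ?thesis by (simp add: edge_count_def m_def)
  qed
  have "(\<Sum>\<mu>\<in>({1..K} \<rightarrow>\<^sub>E ({1..p} \<rightarrow>\<^sub>E {e, - e})). \<Prod>t\<in>T. \<mu> (k (fst (v t))) (snd (v t))) =
    (\<Sum>\<mu>\<in>({1..K} \<rightarrow>\<^sub>E ({1..p} \<rightarrow>\<^sub>E {e, - e})). \<Prod>c\<in>{1..K}. \<Prod>j\<in>{1..p}. \<mu> c j ^ m (c, j))"
    using grp[of "\<lambda>c. _ (fst c) (snd c)"] by (simp add: P_def prod.cartesian_product split_beta)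
  also have "\<dots> = (\<Prod>c\<in>{1..K}. \<Sum>s\<in>({1..p} \<rightarrow>\<^sub>E {e, - e}). \<Prod>j\<in>{1..p}. s j ^ m (c, j))"
    by (rule prod_sum_PiE[symmetric]) (auto intro!: finite_PiE)
  also have "\<dots> = (\<Prod>c\<in>{1..K}. \<Prod>j\<in>{1..p}. \<Sum>x\<in>{e, - e}. x ^ m (c, j))"
    by (intro prod.cong refl prod_sum_PiE[symmetric]) auto
  also have "\<dots> = (\<Prod>c\<in>P. 2 * e ^ m c * of_bool (even (m c)))"
    unfolding P_def sum_sign_choices[OF e] by (simp add: prod.cartesian_product split_beta)
  also have "\<dots> = 2 ^ card P * (\<Prod>c\<in>P. e ^ m c) * (\<Prod>c\<in>P. of_bool (even (m c)))"
    by (simp add: prod.distrib)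
  also have "(\<Prod>c\<in>P. e ^ m c) = e ^ card T" using grp[of "\<lambda>_. e"] by simp
  also have "(\<Prod>c\<in>P. of_bool (even (m c)) :: real) = of_bool ev"
  proof -
    have "(\<Prod>c\<in>P. of_bool (even (m c)) :: real) = of_bool (\<forall>c\<in>P. even (m c))"
      using fP by (induction P rule: finite_induct) auto
    moreover have "(\<forall>c\<in>P. even (m c)) \<longleftrightarrow> ev"
    proof
      assume H: "\<forall>c\<in>P. even (m c)"
      show ev unfolding ev_def
      proof
        fix c :: "nat \<times> nat"
        obtain j l where c: "c = (j, l)" by (cases c)
        have eq: "card {t\<in>T. (snd (v t), k (fst (v t))) = c} = m (l, j)"
          unfolding m_def c by (intro arg_cong[where f=card]) auto
        show "even (card {t\<in>T. (snd (v t), k (fst (v t))) = c})"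
        proof (cases "(l, j) \<in> P")
          case False
          then have "{t\<in>T. (k (fst (v t)), snd (v t)) = (l, j)} = {}" using im by auto
          then have "m (l, j) = 0" unfolding m_def by (simp only: card.empty)
          then show ?thesis using eq by simp
        qed (use H eq in auto)
      qed
    next
      assume H: ev
      show "\<forall>c\<in>P. even (m c)"
      proof
        fix c assume "c \<in> P"
        obtain l j where c: "c = (l, j)" by (cases c)
        have "m c = card {t\<in>T. (snd (v t), k (fst (v t))) = (j, l)}"
          unfolding m_def c by (intro arg_cong[where f=card]) auto
        then show "even (m c)" using H unfolding ev_def by simp
      qed
    qed
    ultimately show ?thesis by simp
  qed
  also have "(2::real) ^ card P = real (card ({1..K} \<rightarrow>\<^sub>E ({1..p} \<rightarrow>\<^sub>E {e, - e})))"
    using e by (simp add: P_def card_PiE power_mult[symmetric] mult.commute)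
  finally show ?thesis by (simp add: ev_def mult.assoc)
qed

text \<open>Averaging over the uniform signs of the centres kills every product in which some pair of label
  and coordinate occurs an odd number of times.\<close>

lemma latent_mean_edges:
  fixes v :: "'e \<Rightarrow> nat \<times> nat"
  assumes T: "finite T" and v: "v ` T \<subseteq> entries n p" and e: "e \<noteq> 0" and K: "K \<ge> 1"
  shows "latent_mean n p K e (\<lambda>\<omega>. h (fst \<omega>) * (\<Prod>t\<in>T. signal \<sigma> \<omega> (v t))) =
    (e / \<sigma>) ^ card T * ((\<Sum>k\<in>labellings n K. h k * of_bool (\<forall>c. even (card {t\<in>T. (snd (v t), k (fst (v t))) = c}))) / real K ^ n)"
proof -
  let ?C = "{1..K} \<rightarrow>\<^sub>E ({1..p} \<rightarrow>\<^sub>E {e, - e})"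
  let ?ev = "\<lambda>k. of_bool (\<forall>c. even (card {t\<in>T. (snd (v t), k (fst (v t))) = c})) :: real"
  have C: "card ?C \<noteq> 0" using K by (auto simp: card_PiE)
  have "(\<Sum>\<omega>\<in>latent_states n p K e. h (fst \<omega>) * (\<Prod>t\<in>T. signal \<sigma> \<omega> (v t))) =
    (\<Sum>k\<in>labellings n K. \<Sum>\<mu>\<in>?C. h k / \<sigma> ^ card T * (\<Prod>t\<in>T. \<mu> (k (fst (v t))) (snd (v t))))"
    unfolding latent_states_def by (simp add: sum.cartesian_product split_beta signal_def prod_dividef)
  also have "\<dots> = (\<Sum>k\<in>labellings n K. h k / \<sigma> ^ card T * (real (card ?C) * (e ^ card T * ?ev k)))"
    unfolding sum_distrib_left[symmetric] using sum_centres[OF T v e] by (intro sum.cong refl) simp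
  also have "\<dots> = real (card ?C) * ((e / \<sigma>) ^ card T * (\<Sum>k\<in>labellings n K. h k * ?ev k))"
    unfolding sum_distrib_left by (intro sum.cong refl) (simp add: power_divide)
  finally have eq: "(\<Sum>\<omega>\<in>latent_states n p K e. h (fst \<omega>) * (\<Prod>t\<in>T. signal \<sigma> \<omega> (v t))) =
    real (card ?C) * ((e / \<sigma>) ^ card T * (\<Sum>k\<in>labellings n K. h k * ?ev k))" .
  have "real (card (latent_states n p K e)) = real K ^ n * real (card ?C)"
    by (simp add: latent_states_def card_cartesian_product card_labellings)
  then show ?thesis unfolding latent_mean_def eq using C by simp
qed

context latent_gaussian
begin

text \<open>Both sides solve the same triangular moment-cumulant system over the subsets of \<open>E\<close>, which has
  a unique solution.\<close>

lemma cumulant_eq_edge_cumulant: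
  fixes v :: "'e \<Rightarrow> nat \<times> nat"
  assumes E: "finite E" and v: "v ` E \<subseteq> V" and e: "e \<noteq> 0" and ab: "a \<in> {1..n}" "b \<in> {1..n}" and T: "T \<subseteq> E"
  shows "cumulant (edge_count V v T) =
    (e / \<sigma>) ^ card T * linked_edges.edge_cumulant n K a b (\<lambda>t. fst (v t)) (\<lambda>t. snd (v t)) T"
proof -
  have pt: "(\<lambda>t. fst (v t)) ` E \<subseteq> {1..n}" using v by (auto simp: entries_def image_subset_iff)
  interpret L: linked_edges n K a b E "\<lambda>t. fst (v t)" "\<lambda>t. snd (v t)"
    by standard (use K ab E pt in auto)
  have fin: "finite U" "v ` U \<subseteq> V" if "U \<subseteq> E" for U using that E v finite_subset by auto
  have sm: "signal_moment (edge_count V v U) = (e / \<sigma>) ^ card U * L.edge_moment U" if U: "U \<subseteq> E" for U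
    using latent_mean_edges[OF fin[OF U] e K, where h="\<lambda>_. 1" and \<sigma>=\<sigma>] prod_edge_count[OF fin(1)[OF U] finite_entries fin(2)[OF U]]
    by (simp add: signal_moment_def L.edge_moment_def)
  have tm: "target_moment (edge_count V v U) = (e / \<sigma>) ^ card U * L.linked_edge_moment U" if U: "U \<subseteq> E" for U
    using latent_mean_edges[OF fin[OF U] e K, where h="\<lambda>k. of_bool (k a = k b)" and \<sigma>=\<sigma>] prod_edge_count[OF fin(1)[OF U] finite_entries fin(2)[OF U]]
    by (simp add: target_moment_def L.linked_edge_moment_def Mstar_def)
  show ?thesis
  proof (rule convolution_unique[OF E _ _ T, where A="\<lambda>U. signal_moment (edge_count V v U)"])
    show "signal_moment (edge_count V v {}) = 1" using sm[of "{}"] L.edge_moment_empty by simp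
    fix S assume S: "S \<subseteq> E"
    have "(\<Sum>Q\<in>Pow S. cumulant (edge_count V v Q) * signal_moment (edge_count V v (S - Q))) =
      (\<Sum>Q\<in>Pow S. (\<lambda>\<beta>. cumulant \<beta> * signal_moment (\<lambda>w. edge_count V v S w - \<beta> w)) (edge_count V v Q))"
    proof (rule sum.cong[OF refl])
      fix Q assume Q: "Q \<in> Pow S"
      have "signal_moment (edge_count V v (S - Q)) = signal_moment (\<lambda>w. edge_count V v S w - edge_count V v Q w)"
        unfolding signal_moment_def using Q fin(1)[OF S] by (intro arg_cong[where f=mean] ext prod.cong refl) (simp add: edge_count_Diff)
      then show "cumulant (edge_count V v Q) * signal_moment (edge_count V v (S - Q)) =
        (\<lambda>\<beta>. cumulant \<beta> * signal_moment (\<lambda>w. edge_count V v S w - \<beta> w)) (edge_count V v Q)" by simp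
    qed
    also have "\<dots> = (\<Sum>\<beta>\<in>(\<Pi>\<^sub>E w\<in>V. {..edge_count V v S w}). (\<Prod>w\<in>V. of_nat (edge_count V v S w choose \<beta> w)) * (cumulant \<beta> * signal_moment (\<lambda>w. edge_count V v S w - \<beta> w)))"
      by (rule sum_Pow_edge_count[OF fin(1)[OF S] finite_entries fin(2)[OF S]])
    also have "\<dots> = (\<Sum>\<beta>\<in>(\<Pi>\<^sub>E w\<in>V. {..edge_count V v S w}). cumulant \<beta> * ((\<Prod>w\<in>V. of_nat (edge_count V v S w choose \<beta> w)) * signal_moment (\<lambda>w. edge_count V v S w - \<beta> w)))"
      by (simp add: mult_ac)
    also have "\<dots> = target_moment (edge_count V v S)"
      unfolding cumulant_def
      by (rule multi_cumulant_convolution) (simp_all add: edge_count_extensional signal_moment_def latent_mean_const[OF K])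
    finally have 1: "(\<Sum>Q\<in>Pow S. cumulant (edge_count V v Q) * signal_moment (edge_count V v (S - Q))) = target_moment (edge_count V v S)" .
    have "(\<Sum>Q\<in>Pow S. (e / \<sigma>) ^ card Q * L.edge_cumulant Q * signal_moment (edge_count V v (S - Q))) =
      (\<Sum>Q\<in>Pow S. (e / \<sigma>) ^ card S * (L.edge_cumulant Q * L.edge_moment (S - Q)))"
    proof (rule sum.cong[OF refl])
      fix Q assume "Q \<in> Pow S"
      then have Q: "Q \<subseteq> S" by simp
      have "card S = card Q + card (S - Q)"
        using Q fin(1)[OF S] by (metis card_Diff_subset card_mono finite_subset le_add_diff_inverse)
      moreover have "S - Q \<subseteq> E" using S by auto
      ultimately show "(e / \<sigma>) ^ card Q * L.edge_cumulant Q * signal_moment (edge_count V v (S - Q)) =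
        (e / \<sigma>) ^ card S * (L.edge_cumulant Q * L.edge_moment (S - Q))"
        by (simp add: sm power_add)
    qed
    also have "\<dots> = target_moment (edge_count V v S)"
      unfolding sum_distrib_left[symmetric] L.edge_cumulant_convolution[OF S] tm[OF S] ..
    finally show "(\<Sum>Q\<in>Pow S. cumulant (edge_count V v Q) * signal_moment (edge_count V v (S - Q))) =
      (\<Sum>Q\<in>Pow S. (e / \<sigma>) ^ card Q * L.edge_cumulant Q * signal_moment (edge_count V v (S - Q)))"
      using 1 by simp
  qed
qed

end

section \<open>Bounding the norm of the certificate\<close>

lemma fact_le_power_pred: "m \<ge> 1 \<Longrightarrow> (fact m :: real) \<le> real m ^ (m - 1)"
proof (induction m rule: dec_induct)
  case (step m)
  have "fact (Suc m) = real (Suc m) * (fact m :: real)" by simp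
  also have "\<dots> \<le> real (Suc m) * real (Suc m) ^ (m - 1)"
    using step.IH power_mono[of "real m" "real (Suc m)" "m - 1"] by (intro mult_left_mono) auto
  also have "\<dots> = real (Suc m) ^ (Suc m - 1)" using step(1) by (cases m) auto
  finally show ?case .
qed simp

text \<open>On the left, the square is the bound on the squared edge cumulant of \<open>m\<close> edges and the last
  factor is the weighted number of edge lists. After \<open>m! \<le> m\<^bsup>m-1\<^esup>\<close> the four factorials leave a
  factor \<open>m\<^sup>4\<close> to spare, more than \<open>(m + 2)(m + 1) / 2\<close>.\<close>

lemma combinatorial_factor_le:
  assumes m: "m = 2 * h" "h \<ge> 1" "m \<le> D"
  shows "(fact m * (real m + 1) ^ m)\<^sup>2 * (fact (m + 2) / 2 * fact m) \<le> (real D ^ 8 * (1 + real D) ^ 4) ^ h"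
proof -
  have m2: "real m \<ge> 2" using m by simp
  have f2: "fact (m + 2) = (real m + 2) * (real m + 1) * fact m" by (simp add: algebra_simps)
  have q: "(real m + 2) * (real m + 1) / 2 \<le> real m ^ 4"
  proof -
    have "(real m + 2) * (real m + 1) \<le> (2 * real m) * (2 * real m)" using m2 by (intro mult_mono) auto
    also have "\<dots> = 4 * (real m)\<^sup>2" by (simp add: power2_eq_square)
    also have "\<dots> \<le> (real m)\<^sup>2 * (real m)\<^sup>2"
      using power_mono[OF m2, of 2] by (intro mult_right_mono) auto
    also have "\<dots> = real m ^ 4" by (simp add: power2_eq_square power4_eq_xxxx)
    finally have "(real m + 2) * (real m + 1) \<le> real m ^ 4" .
    moreover have "0 \<le> real m ^ 4" by simp
    ultimately show ?thesis by linarith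
  qed
  have "(fact m :: real) ^ 4 \<le> (real m ^ (m - 1)) ^ 4"
    using m by (intro power_mono fact_le_power_pred) auto
  then have "(fact m :: real) ^ 4 * ((real m + 2) * (real m + 1) / 2) \<le> (real m ^ (m - 1)) ^ 4 * real m ^ 4"
    using q by (intro mult_mono) auto
  also have "\<dots> = real m ^ (4 * m)"
  proof -
    have "4 * m = (m - 1) * 4 + 4" using m by simp
    then show ?thesis by (simp only: power_mult[symmetric] power_add[symmetric])
  qed
  finally have F: "(fact m :: real) ^ 4 * ((real m + 2) * (real m + 1) / 2) \<le> real m ^ (4 * m)" .
  have "(fact m * (real m + 1) ^ m)\<^sup>2 * (fact (m + 2) / 2 * fact m) =
    (fact m :: real) ^ 4 * ((real m + 2) * (real m + 1) / 2) * (1 + real m) ^ (2 * m)"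
  proof -
    have 1: "(x * z)\<^sup>2 * (q * x / 2 * x) = x ^ 4 * (q / 2) * z\<^sup>2" for x z q :: real
      by (simp add: power2_eq_square power4_eq_xxxx)
    have 2: "((real m + 1) ^ m)\<^sup>2 = (1 + real m) ^ (2 * m)"
      by (simp add: power_mult[symmetric] add.commute mult.commute)
    show ?thesis unfolding f2 1 2 ..
  qed
  also have "\<dots> \<le> real m ^ (4 * m) * (1 + real m) ^ (2 * m)"
    using F by (intro mult_right_mono) auto
  also have "\<dots> \<le> real D ^ (4 * m) * (1 + real D) ^ (2 * m)"
    using m by (intro mult_mono power_mono) auto
  also have "\<dots> = (real D ^ 8 * (1 + real D) ^ 4) ^ h"
    unfolding m by (simp add: power_mult_distrib power_mult[symmetric])
  finally show ?thesis .
qed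

text \<open>Here \<open>r\<close> counts the points other than \<open>a\<close> and \<open>b\<close>. With \<open>M = max(n / K\<^sup>2, 1)\<close> the claim is
  \<open>(n / K\<^sup>2)\<^sup>r p\<^sup>c \<le> M\<^sup>h p\<^sup>h\<close>. If \<open>r > h\<close>, the excess \<open>M\<^bsup>r-h\<^esup>\<close> is paid for by \<open>p\<^bsup>h-c\<^esup>\<close>, since
  \<open>M \<le> p\<close>; this is where \<open>n \<le> p\<close> enters.\<close>

lemma scaling_weight_le:
  fixes \<Delta> :: real
  assumes n: "n \<ge> 1" "p \<ge> n" and K: "K \<ge> 1" and c: "c \<le> h" "r + c \<le> 2 * h"
  shows "(\<Delta>\<^sup>2 / real p) ^ (2 * h) / ((real K)\<^sup>2) ^ r \<le> (\<Delta> ^ 4 / real p * max (real n / (real K)\<^sup>2) 1) ^ h * (1 / real n ^ r * (1 / real p ^ c))"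
proof -
  define y where "y = real n / (real K)\<^sup>2"
  define M where "M = max y 1"
  have p: "real p \<ge> 1" "real n \<ge> 1" "real K \<ge> 1" using n K by auto
  have y: "0 \<le> y" "y \<le> M" "M \<ge> 1" by (auto simp: y_def M_def)
  have "y \<le> real n / 1" unfolding y_def using p by (intro divide_left_mono) auto
  then have Mp: "M \<le> real p" using n p by (simp add: M_def)
  have key: "y ^ r * real p ^ c \<le> M ^ h * real p ^ h"
  proof (cases "r \<le> h")
    case True
    have "y ^ r \<le> M ^ r" using y by (intro power_mono) auto
    also have "\<dots> \<le> M ^ h" using y True by (intro power_increasing) auto
    finally show ?thesis using p c y by (intro mult_mono power_increasing) auto
  next
    case False
    have "y ^ r \<le> M ^ r" using y by (intro power_mono) auto
    also have "\<dots> = M ^ h * M ^ (r - h)" using False by (simp add: power_add[symmetric])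
    also have "\<dots> \<le> M ^ h * real p ^ (r - h)" using Mp y by (intro mult_left_mono power_mono) auto
    finally have "y ^ r * real p ^ c \<le> M ^ h * real p ^ (r - h) * real p ^ c" by (intro mult_right_mono) auto
    also have "\<dots> = M ^ h * real p ^ (r - h + c)" by (simp add: power_add)
    also have "\<dots> \<le> M ^ h * real p ^ h"
      using p False c y by (intro mult_left_mono power_increasing) auto
    finally show ?thesis .
  qed
  have "(\<Delta>\<^sup>2 / real p) ^ (2 * h) / ((real K)\<^sup>2) ^ r = (\<Delta> ^ 4) ^ h / (real p ^ h * real p ^ h) * (1 / real n ^ r * (1 / real p ^ c)) * (y ^ r * real p ^ c)"
  proof -
    have "(\<Delta>\<^sup>2 / real p) ^ (2 * h) = ((\<Delta>\<^sup>2 / real p)\<^sup>2) ^ h" by (rule power_mult)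
    also have "(\<Delta>\<^sup>2 / real p)\<^sup>2 = \<Delta> ^ 4 / (real p * real p)"
      by (simp add: power2_eq_square power4_eq_xxxx)
    also have "(\<Delta> ^ 4 / (real p * real p)) ^ h = (\<Delta> ^ 4) ^ h / (real p ^ h * real p ^ h)"
      by (simp add: power_divide power_mult_distrib)
    finally show ?thesis using p by (simp add: y_def power_divide)
  qed
  also have "\<dots> \<le> (\<Delta> ^ 4) ^ h / (real p ^ h * real p ^ h) * (1 / real n ^ r * (1 / real p ^ c)) * (M ^ h * real p ^ h)"
    using key by (intro mult_left_mono) auto
  also have "\<dots> = (\<Delta> ^ 4 / real p * M) ^ h * (1 / real n ^ r * (1 / real p ^ c))"
    using p by (simp add: power_mult_distrib power_divide)
  finally show ?thesis by (simp add: M_def y_def)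
qed

text \<open>Either \<open>i\<close> is one of the \<open>card R\<close> old elements, or it is one of at most \<open>n\<close> new ones and the weight
  drops by the factor \<open>n\<close>.\<close>

lemma sum_new_element_weight:
  assumes R: "finite R" "q \<le> card R" and n: "n \<ge> 1"
  shows "(\<Sum>i\<in>{1..n}. 1 / real n ^ (card (insert i R) - q)) \<le> (real (card R) + 1) * (1 / real n ^ (card R - q))"
proof -
  have "(\<Sum>i\<in>{1..n}. 1 / real n ^ (card (insert i R) - q)) \<le>
    (\<Sum>i\<in>{1..n}. (if i \<in> R then 1 / real n ^ (card R - q) else 0) + 1 / real n ^ (Suc (card R - q)))"
  proof (rule sum_mono)
    fix i
    show "1 / real n ^ (card (insert i R) - q) \<le> (if i \<in> R then 1 / real n ^ (card R - q) else 0) + 1 / real n ^ (Suc (card R - q))"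
      using R by (auto simp: insert_absorb Suc_diff_le)
  qed
  also have "\<dots> = real (card ({1..n} \<inter> R)) * (1 / real n ^ (card R - q)) + 1 / real n ^ (card R - q)"
    using n by (simp add: sum.distrib sum.If_cases)
  also have "real (card ({1..n} \<inter> R)) * (1 / real n ^ (card R - q)) \<le> real (card R) * (1 / real n ^ (card R - q))"
    using R by (intro mult_right_mono) (auto intro: card_mono)
  finally show ?thesis by (simp add: algebra_simps add_divide_distrib)
qed

text \<open>For an edge list with \<open>r\<close> points besides \<open>a\<close>, \<open>b\<close> and with \<open>c\<close> coordinates, this is
  \<open>n\<^bsup>-r\<^esup> p\<^bsup>-c\<^esup>\<close>. It normalises the number of choices of these points and coordinates, so that
  summing over lists needs no case distinction on \<open>r\<close> and \<open>c\<close>.\<close>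

definition list_weight :: "nat \<Rightarrow> nat \<Rightarrow> nat \<Rightarrow> nat \<Rightarrow> (nat \<times> nat) list \<Rightarrow> real" where
  "list_weight n p a b xs = 1 / real n ^ (card (fst ` set xs \<union> {a, b}) - 2) * (1 / real p ^ card (snd ` set xs))"

lemma list_weight_nonneg: "list_weight n p a b xs \<ge> 0" by (simp add: list_weight_def)

text \<open>Prepending an edge to a list of length \<open>m\<close>, with at most \<open>m + 2\<close> points and \<open>m\<close> coordinates,
  multiplies the total weight by at most \<open>(m + 3)(m + 1)\<close>.\<close>

lemma sum_list_weight_le:
  assumes n: "n \<ge> 1" and p: "p \<ge> 1" and ab: "a \<noteq> b"
  shows "(\<Sum>xs | set xs \<subseteq> entries n p \<and> length xs = m. list_weight n p a b xs) \<le> fact (m + 2) / 2 * fact m"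
proof (induction m)
  case 0
  have "{xs. set xs \<subseteq> entries n p \<and> length xs = 0} = {[]}" by auto
  then show ?case using ab by (simp add: list_weight_def)
next
  case (Suc m)
  let ?L = "{xs. set xs \<subseteq> entries n p \<and> length xs = m}"
  have step: "(\<Sum>x\<in>entries n p. list_weight n p a b (x # xs)) \<le> (real m + 3) * (real m + 1) * list_weight n p a b xs"
    if xs: "xs \<in> ?L" for xs
  proof -
    define R where "R = fst ` set xs \<union> {a, b}"
    define C where "C = snd ` set xs"
    have fin: "finite R" "finite C" by (auto simp: R_def C_def)
    have "card (fst ` set xs) \<le> m" "card C \<le> m"
      using xs card_image_le[of "set xs" fst] card_image_le[of "set xs" snd] card_length[of xs] unfolding C_def by auto
    moreover have "card R \<le> card (fst ` set xs) + card {a, b}" unfolding R_def by (rule card_Un_le)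
    moreover have "card {a, b} = 2" using ab by simp
    moreover have "card {a, b} \<le> card R" unfolding R_def by (intro card_mono) auto
    ultimately have c: "card R \<le> m + 2" "card C \<le> m" "2 \<le> card R" by auto
    have "(\<Sum>x\<in>entries n p. list_weight n p a b (x # xs)) =
      (\<Sum>i\<in>{1..n}. 1 / real n ^ (card (insert i R) - 2)) * (\<Sum>j\<in>{1..p}. 1 / real p ^ (card (insert j C) - 0))"
      unfolding sum_product sum.cartesian_product entries_def
      by (intro sum.cong refl) (auto simp: list_weight_def R_def C_def insert_commute)
    also have "\<dots> \<le> ((real (card R) + 1) * (1 / real n ^ (card R - 2))) * ((real (card C) + 1) * (1 / real p ^ (card C - 0)))"
      using c fin n p by (intro mult_mono sum_new_element_weight) (auto intro!: sum_nonneg)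
    also have "\<dots> = (real (card R) + 1) * (real (card C) + 1) * list_weight n p a b xs"
      by (simp add: list_weight_def R_def C_def)
    also have "\<dots> \<le> (real m + 3) * (real m + 1) * list_weight n p a b xs"
      using c by (intro mult_right_mono mult_mono list_weight_nonneg) auto
    finally show ?thesis .
  qed
  have "(\<Sum>xs | set xs \<subseteq> entries n p \<and> length xs = Suc m. list_weight n p a b xs) =
    (\<Sum>(xs, x)\<in>?L \<times> entries n p. list_weight n p a b (x # xs))"
    unfolding lists_length_Suc_eq by (subst sum.reindex) (auto simp: inj_on_def split_beta)
  also have "\<dots> = (\<Sum>xs\<in>?L. \<Sum>x\<in>entries n p. list_weight n p a b (x # xs))"
    by (simp add: sum.cartesian_product)
  also have "\<dots> \<le> (\<Sum>xs\<in>?L. (real m + 3) * (real m + 1) * list_weight n p a b xs)"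
    by (rule sum_mono) (rule step)
  also have "\<dots> = (real m + 3) * (real m + 1) * (\<Sum>xs\<in>?L. list_weight n p a b xs)"
    by (simp add: sum_distrib_left)
  also have "\<dots> \<le> (real m + 3) * (real m + 1) * (fact (m + 2) / 2 * fact m)"
    using Suc by (intro mult_left_mono) auto
  also have "\<dots> = fact (Suc m + 2) / 2 * fact (Suc m)"
  proof -
    have "fact (Suc m + 2) = (real m + 3) * fact (m + 2)" "fact (Suc m) = (real m + 1) * fact m"
      by (simp_all add: algebra_simps)
    then show ?thesis by (simp only: mult_ac times_divide_eq_left times_divide_eq_right)
  qed
  finally show ?case .
qed

lemma exists_list_edge_count:
  assumes V: "finite V" and \<alpha>: "\<alpha> \<in> extensional V"
  shows "\<exists>xs. set xs \<subseteq> V \<and> length xs = (\<Sum>v\<in>V. \<alpha> v) \<and> edge_count V ((!) xs) {..<length xs} = \<alpha>"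
proof -
  have "\<exists>M. set_mset M \<subseteq> V \<and> (\<forall>v\<in>V. count M v = \<alpha> v)"
  proof (intro exI conjI ballI)
    show "set_mset (\<Sum>v\<in>V. replicate_mset (\<alpha> v) v) \<subseteq> V" using V by (auto simp: set_mset_sum split: if_splits)
    fix v assume "v \<in> V"
    then show "count (\<Sum>v\<in>V. replicate_mset (\<alpha> v) v) v = \<alpha> v"
      using V by (simp add: count_sum)
  qed
  then obtain xs where xs: "set xs \<subseteq> V" "\<And>v. v \<in> V \<Longrightarrow> count (mset xs) v = \<alpha> v"
    by (metis ex_mset set_mset_mset)
  have cnt: "card {t \<in> {..<length xs}. xs ! t = w} = count (mset xs) w" for w
  proof -
    have "card {t \<in> {..<length xs}. xs ! t = w} = length (filter (\<lambda>y. y = w) xs)"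
      unfolding length_filter_conv_card by (intro arg_cong[where f=card]) auto
    also have "\<dots> = count (mset xs) w" by (induction xs) auto
    finally show ?thesis .
  qed
  have "edge_count V ((!) xs) {..<length xs} = \<alpha>"
    using \<alpha> cnt xs(2) by (intro extensionalityI[of _ V]) (auto simp: edge_count_extensional, auto simp: edge_count_def)
  moreover have "length xs = (\<Sum>v\<in>V. \<alpha> v)"
  proof -
    have "length xs = (\<Sum>v\<in>set xs. count (mset xs) v)" by (metis size_mset size_multiset_overloaded_eq set_mset_mset)
    also have "\<dots> = (\<Sum>v\<in>V. count (mset xs) v)" using V xs(1) by (intro sum.mono_neutral_left) (auto simp: count_eq_zero_iff)
    also have "\<dots> = (\<Sum>v\<in>V. \<alpha> v)" using xs(2) by (intro sum.cong) auto
    finally show ?thesis .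
  qed
  ultimately show ?thesis using xs(1) by blast
qed

lemma agree_prob_pair:
  assumes ab: "a \<in> {1..n}" "b \<in> {1..n}" "a \<noteq> b" and K: "K \<ge> 1"
  shows "agree_prob n K {(a, b)} = 1 / real K"
proof (cases "K = 1")
  case True
  have "k a = k b" if "k \<in> respecting n K {}" for k
  proof -
    have "k a \<in> {1..K}" "k b \<in> {1..K}" using that ab by (auto simp: respecting_def labellings_def PiE_iff)
    then show ?thesis using True by simp
  qed
  then show ?thesis using agree_prob_forced[of n K "{}" a b] agree_prob_empty[OF K, of n] True by simp
next
  case False
  \<comment> \<open>separates \<open>a\<close> and \<open>b\<close>, which is possible with two labels\<close>
  define k0 where "k0 = (\<lambda>i\<in>{1..n}. if i = a then 1 else 2 :: nat)"
  have "k0 \<in> respecting n K {}" using False K by (auto simp: k0_def respecting_def labellings_def)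
  moreover have "k0 a \<noteq> k0 b" using ab by (simp add: k0_def)
  ultimately show ?thesis
    using agree_prob_free[of "{}" n a b K k0] ab K agree_prob_empty[OF K, of n] by simp
qed

lemma latent_mean_Mstar:
  assumes ab: "a \<in> {1..n}" "b \<in> {1..n}" "a \<noteq> b" and K: "K \<ge> 1" and e: "e \<noteq> 0"
  shows "latent_mean n p K e (\<lambda>\<omega>. Mstar (fst \<omega>) a b) = 1 / real K"
proof -
  have "latent_mean n p K e (\<lambda>\<omega>. Mstar (fst \<omega>) a b) = (\<Sum>k\<in>labellings n K. Mstar k a b) / real K ^ n"
    using latent_mean_edges[of "{}" "\<lambda>_. (0, 0)" n p e K "\<lambda>k. Mstar k a b" 1] K e by simp
  also have "(\<Sum>k\<in>labellings n K. Mstar k a b) = real (card (respecting n K {(a, b)}))"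
    unfolding Mstar_def by (subst sum_of_bool_eq) (auto simp: respecting_def intro!: arg_cong[where f=card])
  finally show ?thesis using agree_prob_pair[OF ab K] by (simp add: agree_prob_def)
qed

context latent_gaussian
begin

lemma cumulant_zero:
  assumes ab: "a \<in> {1..n}" "b \<in> {1..n}" "a \<noteq> b" and e: "e \<noteq> 0" and \<alpha>: "\<alpha> \<in> extensional V" "(\<Sum>v\<in>V. \<alpha> v) = 0"
  shows "cumulant \<alpha> = 1 / real K"
proof -
  have z: "\<alpha> v = 0" if "v \<in> V" for v using \<alpha>(2) that by simp
  have one: "(\<Pi>\<^sub>E v\<in>V. {..\<alpha> v}) = {\<alpha>}"
  proof (intro set_eqI iffI)
    fix \<beta> assume "\<beta> \<in> (\<Pi>\<^sub>E v\<in>V. {..\<alpha> v})"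
    then show "\<beta> \<in> {\<alpha>}" using z \<alpha>(1) by (auto simp: PiE_iff intro!: extensionalityI[of _ V])
  qed (use \<alpha>(1) in \<open>auto simp: PiE_iff\<close>)
  have s1: "signal_moment (\<lambda>v. \<alpha> v - \<alpha> v) = 1" "signal_moment (\<lambda>v. 0) = 1"
    by (simp_all add: signal_moment_def latent_mean_const[OF K])
  have "cumulant \<alpha> = target_moment \<alpha>"
    using multi_cumulant_convolution[of V \<alpha> signal_moment target_moment, OF finite_entries \<alpha>(1) s1(2)] s1(1) unfolding one
    by (simp add: cumulant_def)
  also have "\<dots> = 1 / real K"
    using latent_mean_Mstar[OF ab K e, of p] by (simp add: target_moment_def z)
  finally show ?thesis .
qed

lemma cumulant_list_square_le:
  assumes ab: "a \<in> {1..n}" "b \<in> {1..n}" "a \<noteq> b" and e: "e \<noteq> 0" "(e / \<sigma>)\<^sup>2 = \<Delta>\<^sup>2 / real p"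
    and np: "n \<ge> 1" "p \<ge> n" and K2: "K \<ge> 2" and xs: "set xs \<subseteq> V" "length xs = m"
  shows "(cumulant (edge_count V ((!) xs) {..<m}))\<^sup>2 \<le>
    of_bool (even m) * ((fact m * (real m + 1) ^ m)\<^sup>2 / (real K)\<^sup>2 * (\<Delta> ^ 4 / real p * max (real n / (real K)\<^sup>2) 1) ^ (m div 2) * list_weight n p a b xs)"
proof -
  let ?E = "{..<m}"
  let ?pt = "\<lambda>t. fst (xs ! t)" and ?col = "\<lambda>t. snd (xs ! t)"
  have im: "(!) xs ` ?E = set xs" using xs(2) by (auto simp: set_conv_nth)
  have pt: "?pt ` ?E = fst ` set xs" "?col ` ?E = snd ` set xs" using im by (auto simp: image_image[symmetric])
  interpret L: linked_edges n K a b ?E ?pt ?col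
    by standard (use K ab xs(1) pt in \<open>auto simp: entries_def\<close>)
  have cum: "cumulant (edge_count V ((!) xs) ?E) = (e / \<sigma>) ^ m * L.edge_cumulant ?E"
    using cumulant_eq_edge_cumulant[of ?E "(!) xs" ?E] im xs(1) e ab by simp
  show ?thesis
  proof (cases "L.edge_cumulant ?E = 0")
    case True
    then show ?thesis unfolding cum by (simp add: list_weight_nonneg)
  next
    case False
    define R where "R = card (fst ` set xs \<union> {a, b})"
    define c where "c = card (snd ` set xs)"
    note nz = L.edge_cumulant_nonzero[OF subset_refl False K2, unfolded pt card_lessThan]
    obtain h where h: "m = 2 * h" using nz(1) by (elim evenE)
    have "card {a, b} \<le> R" unfolding R_def by (intro card_mono) auto
    then have R2: "R \<ge> 2" using ab by simp
    have c: "c \<le> h" "(R - 2) + c \<le> 2 * h" using nz(2,3) h R2 by (auto simp: R_def c_def)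
    have "\<bar>L.edge_cumulant ?E\<bar> \<le> fact m * (real m + 1) ^ m / real K ^ (R - 1)"
      using L.abs_edge_cumulant_le[OF subset_refl] unfolding pt R_def by simp
    then have "(L.edge_cumulant ?E)\<^sup>2 \<le> (fact m * (real m + 1) ^ m / real K ^ (R - 1))\<^sup>2"
      unfolding abs_le_square_iff[symmetric] by simp
    then have "(cumulant (edge_count V ((!) xs) ?E))\<^sup>2 \<le> ((e / \<sigma>) ^ m)\<^sup>2 * (fact m * (real m + 1) ^ m / real K ^ (R - 1))\<^sup>2"
      unfolding cum power_mult_distrib[of _ _ 2] by (intro mult_left_mono) auto
    also have "((e / \<sigma>) ^ m)\<^sup>2 = (\<Delta>\<^sup>2 / real p) ^ (2 * h)"
      unfolding e(2)[symmetric] h by (simp add: power_mult[symmetric] mult.commute)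
    also have "(fact m * (real m + 1) ^ m / real K ^ (R - 1))\<^sup>2 = (fact m * (real m + 1) ^ m)\<^sup>2 / (real K)\<^sup>2 * (1 / ((real K)\<^sup>2) ^ (R - 2))"
    proof -
      have "R - 1 = Suc (R - 2)" using R2 by simp
      then show ?thesis by (simp add: power_divide power_mult_distrib power_mult[symmetric] mult.commute)
    qed
    also have "(\<Delta>\<^sup>2 / real p) ^ (2 * h) * ((fact m * (real m + 1) ^ m)\<^sup>2 / (real K)\<^sup>2 * (1 / ((real K)\<^sup>2) ^ (R - 2))) =
       (fact m * (real m + 1) ^ m)\<^sup>2 / (real K)\<^sup>2 * ((\<Delta>\<^sup>2 / real p) ^ (2 * h) / ((real K)\<^sup>2) ^ (R - 2))" by simp
    also have "\<dots> \<le> (fact m * (real m + 1) ^ m)\<^sup>2 / (real K)\<^sup>2 * ((\<Delta> ^ 4 / real p * max (real n / (real K)\<^sup>2) 1) ^ h * (1 / real n ^ (R - 2) * (1 / real p ^ c)))"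
      by (intro mult_left_mono scaling_weight_le np K c) auto
    finally show ?thesis using nz(1) h by (simp add: list_weight_def R_def c_def mult.assoc)
  qed
qed

text \<open>Level \<open>m\<close> is summed over edge lists instead of multi-indices: every multi-index of size \<open>m\<close> comes
  from at least one list. Only even \<open>m = 2h\<close> contribute, each at most \<open>\<zeta>\<^sup>h / K\<^sup>2\<close>.\<close>

lemma cumulant_norm_le:
  assumes ab: "a \<in> {1..n}" "b \<in> {1..n}" "a \<noteq> b" and e: "e \<noteq> 0" "(e / \<sigma>)\<^sup>2 = \<Delta>\<^sup>2 / real p"
    and np: "n \<ge> 1" "p \<ge> n" and K2: "K \<ge> 2" and z: "zeta D n p K \<Delta> < 1"
  shows "(\<Sum>\<alpha>\<in>exponents_le n p D. (cumulant \<alpha>)\<^sup>2 / (\<Prod>v\<in>V. fact (\<alpha> v))) \<le>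
    1 / (real K)\<^sup>2 * (1 + zeta D n p K \<Delta> / (1 - zeta D n p K \<Delta>))"
proof -
  let ?w = "\<lambda>\<alpha>. (cumulant \<alpha>)\<^sup>2 / (\<Prod>v\<in>V. fact (\<alpha> v))"
  let ?lev = "\<lambda>m. {\<alpha> \<in> exponents_le n p D. (\<Sum>v\<in>V. \<alpha> v) = m}"
  let ?\<zeta> = "zeta D n p K \<Delta>" and ?G = "exponents_le n p D"
  let ?x = "\<Delta> ^ 4 / real p * max (real n / (real K)\<^sup>2) 1"
  let ?size = "\<lambda>\<alpha>. \<Sum>v\<in>V. \<alpha> v :: nat"
  have x0: "?x \<ge> 0" by (simp add: le_max_iff_disj)
  have zx: "?\<zeta> = real D ^ 8 * (1 + real D) ^ 4 * ?x" by (simp add: zeta_def)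
  have z0: "?\<zeta> \<ge> 0" unfolding zx using x0 by simp
  have term_le: "?w \<alpha> \<le> (cumulant \<alpha>)\<^sup>2" for \<alpha> :: "nat \<times> nat \<Rightarrow> nat"
  proof -
    have "(1::real) \<le> (\<Prod>v\<in>V. fact (\<alpha> v))" by (intro prod_ge_1) simp
    then show ?thesis using mult_left_mono[of 1 "\<Prod>v\<in>V. fact (\<alpha> v)" "(cumulant \<alpha>)\<^sup>2"]
      by (simp add: divide_le_eq)
  qed
  have level: "(sum ?w (?lev m)) \<le> of_bool (even m) * (?\<zeta> ^ (m div 2) / (real K)\<^sup>2)"
    if m: "1 \<le> m" "m \<le> D" for m
  proof -
    let ?L = "{xs. set xs \<subseteq> V \<and> length xs = m}"
    let ?c = "\<lambda>xs. edge_count V ((!) xs) {..<m}"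
    have fL: "finite ?L" by (rule finite_lists_length_eq) simp
    have "(sum ?w (?lev m)) \<le> (\<Sum>\<alpha>\<in>?lev m. (cumulant \<alpha>)\<^sup>2)"
      by (rule sum_mono) (rule term_le)
    also have "\<dots> \<le> (\<Sum>\<alpha>\<in>?c ` ?L. (cumulant \<alpha>)\<^sup>2)"
    proof (rule sum_mono2)
      show "?lev m \<subseteq> ?c ` ?L"
      proof
        fix \<alpha> assume \<alpha>: "\<alpha> \<in> ?lev m"
        then have "\<alpha> \<in> extensional V" by (simp add: exponents_le_entries)
        from exists_list_edge_count[OF finite_entries this]
        obtain xs where "set xs \<subseteq> V" "length xs = m" "edge_count V ((!) xs) {..<length xs} = \<alpha>" using \<alpha> by auto
        then show "\<alpha> \<in> ?c ` ?L" by (intro image_eqI[of _ _ xs]) auto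
      qed
    qed (use fL in auto)
    also have "\<dots> \<le> (\<Sum>xs\<in>?L. (cumulant (?c xs))\<^sup>2)"
      using sum_image_le[OF fL, of "\<lambda>\<alpha>. (cumulant \<alpha>)\<^sup>2" ?c] by (simp add: o_def)
    also have "\<dots> \<le> (\<Sum>xs\<in>?L. of_bool (even m) * ((fact m * (real m + 1) ^ m)\<^sup>2 / (real K)\<^sup>2 * ?x ^ (m div 2) * list_weight n p a b xs))"
      by (intro sum_mono cumulant_list_square_le ab e np K2) auto
    also have "\<dots> = of_bool (even m) * ((fact m * (real m + 1) ^ m)\<^sup>2 / (real K)\<^sup>2 * ?x ^ (m div 2) * (\<Sum>xs\<in>?L. list_weight n p a b xs))"
      by (simp only: sum_distrib_left)
    also have "\<dots> \<le> of_bool (even m) * ((fact m * (real m + 1) ^ m)\<^sup>2 / (real K)\<^sup>2 * ?x ^ (m div 2) * (fact (m + 2) / 2 * fact m))"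
      using x0 np ab(3) by (intro mult_left_mono sum_list_weight_le mult_nonneg_nonneg zero_le_power) auto
    also have "\<dots> \<le> of_bool (even m) * (?\<zeta> ^ (m div 2) / (real K)\<^sup>2)"
    proof (cases "even m")
      case True
      then obtain h where h: "m = 2 * h" by (elim evenE)
      have "(fact m * (real m + 1) ^ m)\<^sup>2 / (real K)\<^sup>2 * ?x ^ (m div 2) * (fact (m + 2) / 2 * fact m) =
        (fact m * (real m + 1) ^ m)\<^sup>2 * (fact (m + 2) / 2 * fact m) * (?x ^ h / (real K)\<^sup>2)"
      proof -
        have "m div 2 = h" using h by simp
        then show ?thesis by (simp only: mult_ac times_divide_eq_left times_divide_eq_right)
      qed
      also have "\<dots> \<le> (real D ^ 8 * (1 + real D) ^ 4) ^ h * (?x ^ h / (real K)\<^sup>2)"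
        using x0 m h by (intro mult_right_mono combinatorial_factor_le) auto
      also have "\<dots> = ?\<zeta> ^ (m div 2) / (real K)\<^sup>2" unfolding zx power_mult_distrib[of _ ?x] using h by simp
      finally show ?thesis using True by simp
    qed simp
    finally show ?thesis .
  qed
  have level0: "(sum ?w (?lev 0)) = 1 / (real K)\<^sup>2"
  proof -
    let ?z = "\<lambda>v\<in>V. 0 :: nat"
    have "?lev 0 = {?z}"
    proof (intro set_eqI iffI)
      fix \<alpha> assume "\<alpha> \<in> ?lev 0"
      then show "\<alpha> \<in> {?z}" by (auto simp: exponents_le_entries intro!: extensionalityI[of _ V])
    qed (auto simp: exponents_le_entries)
    moreover have "cumulant ?z = 1 / real K" by (rule cumulant_zero[OF ab e(1)]) auto
    ultimately show ?thesis by (simp add: power_divide)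
  qed
  have "sum ?w ?G =
    (\<Sum>m\<in>{..D}. sum ?w (?lev m))"
    by (rule sum.group[symmetric]) (auto simp: finite_exponents_le, auto simp: exponents_le_entries)
  also have "\<dots> = 1 / (real K)\<^sup>2 + (\<Sum>m\<in>{1..D}. sum ?w (?lev m))"
  proof -
    have D: "{..D} = insert 0 {1..D}" by auto
    have "sum g {..D} = g 0 + sum g {1..D}" for g :: "nat \<Rightarrow> real" unfolding D by simp
    then show ?thesis by (simp only: level0)
  qed
  finally have total: "sum ?w ?G =
    1 / (real K)\<^sup>2 + (\<Sum>m\<in>{1..D}. sum ?w (?lev m))" .
  have "(\<Sum>m\<in>{1..D}. sum ?w (?lev m)) \<le>
    (\<Sum>m\<in>{1..D}. of_bool (even m) * (?\<zeta> ^ (m div 2) / (real K)\<^sup>2))"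
    by (intro sum_mono level) auto
  also have "\<dots> = (\<Sum>m\<in>{m\<in>{1..D}. even m}. ?\<zeta> ^ (m div 2) / (real K)\<^sup>2)"
    by (subst sum.inter_filter) (auto intro!: sum.cong)
  also have "\<dots> = (\<Sum>h\<in>(\<lambda>m. m div 2) ` {m\<in>{1..D}. even m}. ?\<zeta> ^ h / (real K)\<^sup>2)"
    by (subst sum.reindex) (auto simp: inj_on_def elim!: evenE)
  also have "\<dots> \<le> (\<Sum>h\<in>{1..D}. ?\<zeta> ^ h / (real K)\<^sup>2)"
    using z0 by (intro sum_mono2) (auto elim!: evenE)
  also have "\<dots> = (\<Sum>h\<in>{1..D}. ?\<zeta> ^ h) / (real K)\<^sup>2" by (rule sum_divide_distrib[symmetric])
  also have "\<dots> \<le> (?\<zeta> / (1 - ?\<zeta>)) / (real K)\<^sup>2"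
  proof (rule divide_right_mono)
    have "(1 - y) * (\<Sum>h\<in>{1..d}. y ^ h) = y - y ^ Suc d" for y :: real and d
    proof (induction d)
      case (Suc d)
      have "(\<Sum>h\<in>{1..Suc d}. y ^ h) = (\<Sum>h\<in>{1..d}. y ^ h) + y ^ Suc d" by simp
      then have "(1 - y) * (\<Sum>h\<in>{1..Suc d}. y ^ h) = (1 - y) * (\<Sum>h\<in>{1..d}. y ^ h) + (1 - y) * y ^ Suc d"
        by (simp only: distrib_left)
      also have "\<dots> = (y - y ^ Suc d) + (1 - y) * y ^ Suc d" by (simp only: Suc)
      also have "\<dots> = y - y ^ Suc (Suc d)" by (simp add: algebra_simps)
      finally show ?case .
    qed simp
    then have "(1 - ?\<zeta>) * (\<Sum>h\<in>{1..D}. ?\<zeta> ^ h) = ?\<zeta> - ?\<zeta> ^ Suc D" .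
    also have "\<dots> \<le> ?\<zeta>" using z0 by simp
    finally show "(\<Sum>h\<in>{1..D}. ?\<zeta> ^ h) \<le> ?\<zeta> / (1 - ?\<zeta>)" using z by (simp add: field_simps)
  qed simp
  finally show ?thesis unfolding total by (simp add: distrib_left mult.commute)
qed

end

section \<open>Bounds on the minimum mean squared error\<close>

lemma polys_le_const: "(\<lambda>_. r) \<in> polys_le n p D"
proof -
  let ?z = "\<lambda>v\<in>entries n p. 0 :: nat"
  have z: "?z \<in> exponents_le n p D" by (simp add: exponents_le_entries)
  have "(\<lambda>_. r) = (\<lambda>Y. \<Sum>\<alpha>\<in>exponents_le n p D. (if \<alpha> = ?z then r else 0) * (\<Prod>(i, j)\<in>{1..n} \<times> {1..p}. Y i j ^ \<alpha> (i, j)))"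
  proof
    fix Y :: "nat \<Rightarrow> nat \<Rightarrow> real"
    have "(\<Prod>(i, j)\<in>{1..n} \<times> {1..p}. Y i j ^ ?z (i, j)) = 1"
      by (intro prod.neutral) (auto simp: entries_def)
    moreover have "(\<Sum>\<alpha>\<in>exponents_le n p D. (if \<alpha> = ?z then r else 0) * (\<Prod>(i, j)\<in>{1..n} \<times> {1..p}. Y i j ^ \<alpha> (i, j))) =
       (\<Sum>\<alpha>\<in>exponents_le n p D. if \<alpha> = ?z then r * (\<Prod>(i, j)\<in>{1..n} \<times> {1..p}. Y i j ^ ?z (i, j)) else 0)"
      by (intro sum.cong) auto
    ultimately show "r = (\<Sum>\<alpha>\<in>exponents_le n p D. (if \<alpha> = ?z then r else 0) * (\<Prod>(i, j)\<in>{1..n} \<times> {1..p}. Y i j ^ \<alpha> (i, j)))"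
      using z finite_exponents_le by simp
  qed
  then show ?thesis unfolding polys_le_def mem_Collect_eq
    by (intro exI[of _ "\<lambda>\<alpha>. if \<alpha> = ?z then r else 0"])
qed

definition off_diagonal :: "nat \<Rightarrow> (nat \<times> nat) set" where
  "off_diagonal n = {(i, j) \<in> {1..n} \<times> {1..n}. i \<noteq> j}"

lemma card_off_diagonal: "real (card (off_diagonal n)) = real n * (real n - 1)"
proof -
  have "off_diagonal n = {1..n} \<times> {1..n} - (\<lambda>i. (i, i)) ` {1..n}" by (auto simp: off_diagonal_def)
  moreover have "card ({1..n} \<times> {1..n} - (\<lambda>i. (i, i)) ` {1..n}) = card ({1..n} \<times> {1..n}) - card ((\<lambda>i. (i, i)) ` {1..n})"
    by (rule card_Diff_subset) auto
  moreover have "card ((\<lambda>i. (i, i)) ` {1..n}) = n" by (subst card_image) (auto simp: inj_on_def)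
  ultimately show ?thesis by (cases n) (simp_all add: algebra_simps)
qed

definition pair_error :: "nat \<Rightarrow> nat \<Rightarrow> nat \<Rightarrow> real \<Rightarrow> real \<Rightarrow> ((nat \<Rightarrow> nat \<Rightarrow> real) \<Rightarrow> real) \<Rightarrow> nat \<Rightarrow> nat \<Rightarrow> real" where
  "pair_error n p K \<sigma> \<Delta> f i j = (\<integral>((k, \<mu>), Y). (f Y - Mstar k i j)\<^sup>2 \<partial>model n p K \<sigma> \<Delta>)"

lemma pair_error_nonneg: "pair_error n p K \<sigma> \<Delta> f i j \<ge> 0"
  unfolding pair_error_def by (rule integral_nonneg_AE) (auto simp: split_beta)

lemma MMSE_le_altdef:
  "MMSE_le D n p K \<sigma> \<Delta> = (INF f \<in> {f. \<forall>i j. f i j \<in> polys_le n p D}.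
     1 / (real n * (real n - 1)) * (\<Sum>(i, j)\<in>off_diagonal n. pair_error n p K \<sigma> \<Delta> (f i j) i j))"
  unfolding MMSE_le_def off_diagonal_def pair_error_def ..

lemma MMSE_le_ge:
  assumes n: "n \<ge> 2"
    and c: "\<And>i j f. i \<in> {1..n} \<Longrightarrow> j \<in> {1..n} \<Longrightarrow> i \<noteq> j \<Longrightarrow> f \<in> polys_le n p D \<Longrightarrow> c \<le> pair_error n p K \<sigma> \<Delta> f i j"
  shows "c \<le> MMSE_le D n p K \<sigma> \<Delta>"
  unfolding MMSE_le_altdef
proof (rule cINF_greatest)
  show "{f :: nat \<Rightarrow> nat \<Rightarrow> (nat \<Rightarrow> nat \<Rightarrow> real) \<Rightarrow> real. \<forall>i j. f i j \<in> polys_le n p D} \<noteq> {}"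
    by (rule ex_in_conv[THEN iffD1, OF exI[of _ "\<lambda>_ _ _. 0"]]) (simp add: polys_le_const)
  fix f :: "nat \<Rightarrow> nat \<Rightarrow> (nat \<Rightarrow> nat \<Rightarrow> real) \<Rightarrow> real" assume f: "f \<in> {f. \<forall>i j. f i j \<in> polys_le n p D}"
  have pos: "real n * (real n - 1) > 0" using n by simp
  have "real n * (real n - 1) * c = (\<Sum>(i, j)\<in>off_diagonal n. c)" by (simp add: card_off_diagonal split_beta)
  also have "\<dots> \<le> (\<Sum>(i, j)\<in>off_diagonal n. pair_error n p K \<sigma> \<Delta> (f i j) i j)"
    using c f by (intro sum_mono) (auto simp: off_diagonal_def)
  finally show "c \<le> 1 / (real n * (real n - 1)) * (\<Sum>(i, j)\<in>off_diagonal n. pair_error n p K \<sigma> \<Delta> (f i j) i j)"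
    using pos by (simp add: pos_le_divide_eq mult.commute)
qed

lemma MMSE_le_le:
  assumes n: "n \<ge> 2" and f: "f \<in> polys_le n p D"
    and c: "\<And>i j. i \<in> {1..n} \<Longrightarrow> j \<in> {1..n} \<Longrightarrow> i \<noteq> j \<Longrightarrow> pair_error n p K \<sigma> \<Delta> f i j \<le> c"
  shows "MMSE_le D n p K \<sigma> \<Delta> \<le> c"
proof -
  have pos: "real n * (real n - 1) > 0" using n by simp
  have "MMSE_le D n p K \<sigma> \<Delta> \<le> 1 / (real n * (real n - 1)) * (\<Sum>(i, j)\<in>off_diagonal n. pair_error n p K \<sigma> \<Delta> f i j)"
    unfolding MMSE_le_altdef
  proof (rule cINF_lower2[where x="\<lambda>i j. f"])
    show "bdd_below ((\<lambda>f. 1 / (real n * (real n - 1)) * (\<Sum>(i, j)\<in>off_diagonal n. pair_error n p K \<sigma> \<Delta> (f i j) i j)) ` {f. \<forall>i j. f i j \<in> polys_le n p D})"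
      using n by (intro bdd_belowI[of _ 0]) (auto intro!: mult_nonneg_nonneg divide_nonneg_nonneg sum_nonneg pair_error_nonneg)
  qed (use f in auto)
  also have "\<dots> \<le> 1 / (real n * (real n - 1)) * (\<Sum>(i, j)\<in>off_diagonal n. c)"
    using c pos by (intro mult_left_mono sum_mono) (auto simp: off_diagonal_def)
  also have "(\<Sum>(i, j)\<in>off_diagonal n. c) = real n * (real n - 1) * c" by (simp add: card_off_diagonal split_beta)
  also have "1 / (real n * (real n - 1)) * (real n * (real n - 1) * c) = c" using pos by (cases "n = 1") auto
  finally show ?thesis .
qed

lemma centre_eps_pos: "p \<ge> 1 \<Longrightarrow> \<sigma> > 0 \<Longrightarrow> \<Delta> > 0 \<Longrightarrow> centre_eps p \<sigma> \<Delta> > 0"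
  by (simp add: centre_eps_def)

lemma centre_eps_scaled: "p \<ge> 1 \<Longrightarrow> \<sigma> > 0 \<Longrightarrow> (centre_eps p \<sigma> \<Delta> / \<sigma>)\<^sup>2 = \<Delta>\<^sup>2 / real p"
  by (simp add: centre_eps_def power_divide)

lemma Mstar_square: "(Mstar k i j)\<^sup>2 = Mstar k i j"
  by (cases "k i = k j") (simp_all add: Mstar_def)

text \<open>Since \<open>x\<^sup>2 = x\<close> and \<open>E x = 1 / K\<close>, the variance of \<open>x\<close> is \<open>1 / K - 1 / K\<^sup>2\<close>.\<close>

lemma pair_error_const:
  assumes "p \<ge> 1" "K \<ge> 1" "\<sigma> > 0" "\<Delta> > 0" and ab: "a \<in> {1..n}" "b \<in> {1..n}" "a \<noteq> b"
  shows "pair_error n p K \<sigma> \<Delta> (\<lambda>_. 1 / real K) a b = 1 / real K - 1 / (real K)\<^sup>2"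
proof -
  let ?e = "centre_eps p \<sigma> \<Delta>"
  have e: "?e \<noteq> 0" using centre_eps_pos[of p \<sigma> \<Delta>] assms by simp
  have "pair_error n p K \<sigma> \<Delta> (\<lambda>_. 1 / real K) a b =
    latent_mean n p K ?e (\<lambda>\<omega>. \<integral>Y. (1 / real K - Mstar (fst \<omega>) a b)\<^sup>2 \<partial>data_law n p \<sigma> (fst \<omega>) (snd \<omega>))"
    unfolding pair_error_def by (rule model_mean_square_error[OF assms(3,2) polys_le_const[of _ n p 0]])
  also have "\<dots> = latent_mean n p K ?e (\<lambda>\<omega>. (1 / real K)\<^sup>2 + (1 - 2 / real K) * Mstar (fst \<omega>) a b)"
  proof -
    have "(\<integral>Y. (1 / real K - Mstar (fst \<omega>) a b)\<^sup>2 \<partial>data_law n p \<sigma> (fst \<omega>) (snd \<omega>)) = (1 / real K)\<^sup>2 + (1 - 2 / real K) * Mstar (fst \<omega>) a b"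
      for \<omega> :: "(nat \<Rightarrow> nat) \<times> (nat \<Rightarrow> nat \<Rightarrow> real)"
    proof -
      interpret P: prob_space "data_law n p \<sigma> (fst \<omega>) (snd \<omega>)" by (rule prob_space_data_law[OF assms(3)])
      have "(\<integral>Y. (1 / real K - Mstar (fst \<omega>) a b)\<^sup>2 \<partial>data_law n p \<sigma> (fst \<omega>) (snd \<omega>)) = (1 / real K - Mstar (fst \<omega>) a b)\<^sup>2"
        by (simp add: P.prob_space)
      also have "\<dots> = (1 / real K)\<^sup>2 + (1 - 2 / real K) * Mstar (fst \<omega>) a b"
        unfolding power2_diff Mstar_square by (simp add: algebra_simps)
      finally show ?thesis .
    qed
    then show ?thesis by simp
  qed
  also have "\<dots> = (1 / real K)\<^sup>2 + (1 - 2 / real K) * (1 / real K)"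
    unfolding latent_mean_add latent_mean_cmult latent_mean_const[OF assms(2)] latent_mean_Mstar[OF ab assms(2) e] ..
  also have "\<dots> = 1 / real K - 1 / (real K)\<^sup>2" using assms(2) by (simp add: field_simps power2_eq_square)
  finally show ?thesis .
qed

lemma pair_error_ge:
  assumes np: "n \<ge> 1" "p \<ge> n" and K2: "K \<ge> 2" and s: "\<sigma> > 0" "\<Delta> > 0"
    and ab: "a \<in> {1..n}" "b \<in> {1..n}" "a \<noteq> b" and z: "zeta D n p K \<Delta> < 1" and f: "f \<in> polys_le n p D"
  shows "pair_error n p K \<sigma> \<Delta> f a b \<ge> 1 / real K - 1 / (real K)\<^sup>2 * (1 + zeta D n p K \<Delta> / (1 - zeta D n p K \<Delta>))"
proof -
  let ?e = "centre_eps p \<sigma> \<Delta>"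
  have K1: "K \<ge> 1" and p1: "p \<ge> 1" using K2 np by auto
  have e: "?e \<noteq> 0" using centre_eps_pos[of p \<sigma> \<Delta>] p1 s by simp
  interpret latent_gaussian n p K \<sigma> ?e a b by standard (use s K1 in auto)
  obtain d where d: "f = (\<lambda>Y. \<Sum>\<gamma>\<in>exponents_le n p D. d \<gamma> * hermite_prod n p \<sigma> \<gamma> Y)"
    using polys_le_hermite_span[OF s(1) f] by blast
  have "mean (\<lambda>\<omega>. (Mstar (fst \<omega>) a b)\<^sup>2) = 1 / real K"
    using latent_mean_Mstar[OF ab K1 e, of p] by (simp add: Mstar_square)
  moreover have "pair_error n p K \<sigma> \<Delta> f a b = mean (\<lambda>\<omega>. \<integral>Y. (f Y - Mstar (fst \<omega>) a b)\<^sup>2 \<partial>law \<omega>)"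
    unfolding pair_error_def by (rule model_mean_square_error[OF s(1) K1 f])
  moreover have "mean (\<lambda>\<omega>. \<integral>Y. (f Y - Mstar (fst \<omega>) a b)\<^sup>2 \<partial>law \<omega>) \<ge>
     mean (\<lambda>\<omega>. (Mstar (fst \<omega>) a b)\<^sup>2) - (\<Sum>\<beta>\<in>exponents_le n p D. (cumulant \<beta>)\<^sup>2 / (\<Prod>v\<in>V. fact (\<beta> v)))"
    unfolding d by (rule mean_square_error_ge)
  moreover have "(\<Sum>\<beta>\<in>exponents_le n p D. (cumulant \<beta>)\<^sup>2 / (\<Prod>v\<in>V. fact (\<beta> v))) \<le> 1 / (real K)\<^sup>2 * (1 + zeta D n p K \<Delta> / (1 - zeta D n p K \<Delta>))"
    by (rule cumulant_norm_le[OF ab e centre_eps_scaled[OF p1 s(1)] np K2 z])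
  ultimately show ?thesis by linarith
qed

lemma zeta_nonneg: "zeta D n p K \<Delta> \<ge> 0"
  by (simp add: zeta_def le_max_iff_disj)

lemma zeta_ratio_le:
  assumes "0 \<le> z" "z < 1"
  shows "z / (1 - z) \<le> z / (1 - sqrt z) ^ 3"
proof -
  define t where "t = sqrt z"
  have t: "0 \<le> t" "t < 1" "z = t\<^sup>2" using assms by (auto simp: t_def real_sqrt_lt_1_iff)
  have "(1 - t) ^ 3 \<le> (1 - t) ^ 1" using t by (intro power_decreasing) auto
  also have "\<dots> \<le> 1 - t\<^sup>2" using t mult_left_mono[of t 1 t] by (simp add: power2_eq_square)
  finally have "(1 - t) ^ 3 \<le> 1 - z" using t(3) by simp
  then show ?thesis using t assms unfolding t_def[symmetric] by (intro divide_left_mono) auto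
qed

text \<open>For \<open>K = 1\<close> the claimed bound is not positive; otherwise the bound holds for each pair of points.\<close>

lemma MMSE_le_lower:
  assumes n: "n \<ge> 2" "p \<ge> n" and K: "K \<ge> 1" and s: "\<sigma> > 0" "\<Delta> > 0" and z: "zeta D n p K \<Delta> < 1"
  shows "MMSE_le D n p K \<sigma> \<Delta> \<ge> 1 / real K - 1 / (real K)\<^sup>2 * (1 + zeta D n p K \<Delta> / (1 - sqrt (zeta D n p K \<Delta>)) ^ 3)"
proof (rule MMSE_le_ge[OF n(1)])
  fix a b f assume ab: "a \<in> {1..n}" "b \<in> {1..n}" "a \<noteq> b" and f: "f \<in> polys_le n p D"
  let ?z = "zeta D n p K \<Delta>"
  note z0 = zeta_nonneg[of D n p K \<Delta>]
  show "1 / real K - 1 / (real K)\<^sup>2 * (1 + ?z / (1 - sqrt ?z) ^ 3) \<le> pair_error n p K \<sigma> \<Delta> f a b"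
  proof (cases "K = 1")
    case True
    have "?z / (1 - sqrt ?z) ^ 3 \<ge> 0" using z0 z by (intro divide_nonneg_nonneg zero_le_power) auto
    then show ?thesis using True pair_error_nonneg[of n p K \<sigma> \<Delta> f a b] by simp
  next
    case False
    have "1 / (real K)\<^sup>2 * (1 + ?z / (1 - ?z)) \<le> 1 / (real K)\<^sup>2 * (1 + ?z / (1 - sqrt ?z) ^ 3)"
      using zeta_ratio_le[OF z0 z] by (intro mult_left_mono) auto
    moreover have "1 / real K - 1 / (real K)\<^sup>2 * (1 + ?z / (1 - ?z)) \<le> pair_error n p K \<sigma> \<Delta> f a b"
      using n False K by (intro pair_error_ge s ab z f) auto
    ultimately show ?thesis by linarith
  qed
qed

lemma MMSE_le_upper:
  assumes "n \<ge> 2" "p \<ge> n" "K \<ge> 1" "\<sigma> > 0" "\<Delta> > 0"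
  shows "MMSE_le D n p K \<sigma> \<Delta> \<le> 1 / real K - 1 / (real K)\<^sup>2"
proof (rule MMSE_le_le[OF assms(1) polys_le_const])
  fix i j assume "i \<in> {1..n}" "j \<in> {1..n}" "i \<noteq> j"
  then show "pair_error n p K \<sigma> \<Delta> (\<lambda>_. 1 / real K) i j \<le> 1 / real K - 1 / (real K)\<^sup>2"
    using assms by (subst pair_error_const) auto
qed

text \<open>The minimum of the two square roots is \<open>\<surd>(p / M)\<close> with \<open>M = max(n / K\<^sup>2, 1)\<close>, and
  \<open>(1 + D)\<^sup>4 \<le> 16 D\<^sup>4\<close> since \<open>D \<ge> 1\<close>.\<close>

lemma zeta_le_ratio_square:
  assumes "D \<ge> 1" "n \<ge> 1" "p \<ge> 1" "K \<ge> 1"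
  shows "zeta D n p K \<Delta> \<le> 16 * (\<Delta>\<^sup>2 / (1 / real D ^ 6 * min (sqrt (real p * (real K)\<^sup>2 / real n)) (sqrt (real p))))\<^sup>2"
proof -
  let ?ratio = "\<Delta>\<^sup>2 / (1 / real D ^ 6 * min (sqrt (real p * (real K)\<^sup>2 / real n)) (sqrt (real p)))"
  define M where "M = max (real n / (real K)\<^sup>2) 1"
  have pos: "real D \<ge> 1" "real n > 0" "real p > 0" "real K > 0" using assms by auto
  have M: "M > 0" by (simp add: M_def less_max_iff_disj)
  have "min (real p * (real K)\<^sup>2 / real n) (real p) = real p / M"
  proof (cases "real n \<le> (real K)\<^sup>2")
    case True
    then have "real n / (real K)\<^sup>2 \<le> 1" using pos by simp
    then have "M = 1" by (simp add: M_def)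
    moreover have "real p \<le> real p * (real K)\<^sup>2 / real n" using True pos by (simp add: le_divide_eq mult_left_mono)
    ultimately show ?thesis by simp
  next
    case False
    then have "real n / (real K)\<^sup>2 \<ge> 1" using pos by (simp add: le_divide_eq)
    then have "M = real n / (real K)\<^sup>2" by (simp add: M_def)
    moreover have "real p * (real K)\<^sup>2 / real n \<le> real p" using False pos by (simp add: divide_le_eq mult_left_mono)
    ultimately show ?thesis by simp
  qed
  then have "min (sqrt (real p * (real K)\<^sup>2 / real n)) (sqrt (real p)) = sqrt (real p / M)"
    by (metis min_def real_sqrt_le_iff)
  then have "?ratio\<^sup>2 =
     (\<Delta>\<^sup>2 * real D ^ 6)\<^sup>2 / (sqrt (real p / M))\<^sup>2"
    by (simp add: power_divide power_mult_distrib)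
  also have "(sqrt (real p / M))\<^sup>2 = real p / M" using pos M by simp
  also have "(\<Delta>\<^sup>2 * real D ^ 6)\<^sup>2 / (real p / M) = \<Delta> ^ 4 * real D ^ 12 / real p * M"
    by (simp add: power_mult_distrib power_mult[symmetric])
  finally have eq: "?ratio\<^sup>2 = \<Delta> ^ 4 * real D ^ 12 / real p * M" .
  have "(1 + real D) ^ 4 \<le> (2 * real D) ^ 4" using pos by (intro power_mono) auto
  then have "real D ^ 8 * (1 + real D) ^ 4 \<le> real D ^ 8 * (16 * real D ^ 4)"
    by (intro mult_left_mono) (auto simp: power_mult_distrib)
  also have "\<dots> = 16 * real D ^ 12" by (simp add: power_add[symmetric])
  finally have "(\<Delta> ^ 4 / real p * M) * (real D ^ 8 * (1 + real D) ^ 4) \<le> (\<Delta> ^ 4 / real p * M) * (16 * real D ^ 12)"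
    using M by (intro mult_left_mono) auto
  then show ?thesis unfolding eq by (simp add: zeta_def M_def mult_ac)
qed

theorem theorem1:
  shows
    "(\<forall>(D::nat) (n::nat) (p::nat) (K::nat) (\<sigma>::real) (\<Delta>::real).
        n \<ge> 2 \<longrightarrow> p \<ge> n \<longrightarrow> K \<ge> 1 \<longrightarrow> \<sigma> > 0 \<longrightarrow> \<Delta> > 0 \<longrightarrow> zeta D n p K \<Delta> < 1 \<longrightarrow>
        MMSE_le D n p K \<sigma> \<Delta> \<ge>
          1 / real K -
          1 / (real K)\<^sup>2 * (1 + zeta D n p K \<Delta> / (1 - sqrt (zeta D n p K \<Delta>)) ^ 3))
     \<and>
     (\<forall>(D::nat \<Rightarrow> nat) (n::nat \<Rightarrow> nat) (p::nat \<Rightarrow> nat) (K::nat \<Rightarrow> nat)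
        (\<sigma>::nat \<Rightarrow> real) (\<Delta>::nat \<Rightarrow> real).
        (\<forall>m. n m \<ge> 2 \<and> p m \<ge> n m \<and> K m \<ge> 1 \<and> \<sigma> m > 0 \<and> \<Delta> m > 0 \<and> D m \<ge> 1) \<longrightarrow>
        (\<lambda>m. (\<Delta> m)\<^sup>2 /
             (1 / real (D m) ^ 6 *
              min (sqrt (real (p m) * (real (K m))\<^sup>2 / real (n m))) (sqrt (real (p m)))))
          \<longlonglongrightarrow> 0 \<longrightarrow>
        (\<exists>e :: nat \<Rightarrow> real. e \<longlonglongrightarrow> 0 \<and>
          (\<forall>m. MMSE_le (D m) (n m) (p m) (K m) (\<sigma> m) (\<Delta> m) =
               1 / real (K m) - (1 + e m) / (real (K m))\<^sup>2)))"
proof (intro conjI allI impI)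
  fix D n p K :: nat and \<sigma> \<Delta> :: real
  assume "n \<ge> 2" "p \<ge> n" "K \<ge> 1" "\<sigma> > 0" "\<Delta> > 0" "zeta D n p K \<Delta> < 1"
  then show "MMSE_le D n p K \<sigma> \<Delta> \<ge>
      1 / real K - 1 / (real K)\<^sup>2 * (1 + zeta D n p K \<Delta> / (1 - sqrt (zeta D n p K \<Delta>)) ^ 3)"
    by (rule MMSE_le_lower)
next
  fix D n p K :: "nat \<Rightarrow> nat" and \<sigma> \<Delta> :: "nat \<Rightarrow> real"
  assume params: "\<forall>m. n m \<ge> 2 \<and> p m \<ge> n m \<and> K m \<ge> 1 \<and> \<sigma> m > 0 \<and> \<Delta> m > 0 \<and> D m \<ge> 1"
    and lim: "(\<lambda>m. (\<Delta> m)\<^sup>2 / (1 / real (D m) ^ 6 *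
              min (sqrt (real (p m) * (real (K m))\<^sup>2 / real (n m))) (sqrt (real (p m))))) \<longlonglongrightarrow> 0"
  define ratio where "ratio m = (\<Delta> m)\<^sup>2 / (1 / real (D m) ^ 6 *
              min (sqrt (real (p m) * (real (K m))\<^sup>2 / real (n m))) (sqrt (real (p m))))" for m
  define mm where "mm m = MMSE_le (D m) (n m) (p m) (K m) (\<sigma> m) (\<Delta> m)" for m
  define z where "z m = zeta (D m) (n m) (p m) (K m) (\<Delta> m)" for m
  \<comment> \<open>the only sequence that satisfies the claimed identity\<close>
  define e where "e m = (1 / real (K m) - mm m) * (real (K m))\<^sup>2 - 1" for m
  have K0: "real (K m) > 0" for m using params[rule_format, of m] by simp
  have z0: "0 \<le> z m" for m unfolding z_def by (rule zeta_nonneg)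
  have zlim: "z \<longlonglongrightarrow> 0"
  proof (rule tendsto_sandwich)
    show "eventually (\<lambda>m. 0 \<le> z m) sequentially" using z0 by simp
    show "eventually (\<lambda>m. z m \<le> 16 * (ratio m)\<^sup>2) sequentially"
    proof (rule always_eventually, rule allI)
      fix m
      have "D m \<ge> 1" "n m \<ge> 1" "p m \<ge> 1" "K m \<ge> 1" using params[rule_format, of m] by auto
      then show "z m \<le> 16 * (ratio m)\<^sup>2"
        unfolding z_def ratio_def by (rule zeta_le_ratio_square)
    qed
    show "(\<lambda>m. 16 * (ratio m)\<^sup>2) \<longlonglongrightarrow> 0"
      using tendsto_mult[OF tendsto_const[of 16] tendsto_power[OF lim[folded ratio_def], of 2]] by simp
  qed simp
  have e_nonneg: "0 \<le> e m" for m
  proof -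
    have "mm m \<le> 1 / real (K m) - 1 / (real (K m))\<^sup>2"
      using params[rule_format, of m] unfolding mm_def by (intro MMSE_le_upper) auto
    then have "1 / (real (K m))\<^sup>2 * (real (K m))\<^sup>2 \<le> (1 / real (K m) - mm m) * (real (K m))\<^sup>2"
      by (intro mult_right_mono) auto
    then show ?thesis using K0[of m] by (simp add: e_def)
  qed
  have e_le: "e m \<le> z m / (1 - sqrt (z m)) ^ 3" if "z m < 1" for m
  proof -
    have "mm m \<ge> 1 / real (K m) - 1 / (real (K m))\<^sup>2 * (1 + z m / (1 - sqrt (z m)) ^ 3)"
      using params[rule_format, of m] that unfolding mm_def z_def by (intro MMSE_le_lower) auto
    then have "(1 / real (K m) - mm m) * (real (K m))\<^sup>2 \<le> (1 / (real (K m))\<^sup>2 * (1 + z m / (1 - sqrt (z m)) ^ 3)) * (real (K m))\<^sup>2"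
      by (intro mult_right_mono) auto
    then show ?thesis using K0[of m] by (simp add: e_def)
  qed
  have "e \<longlonglongrightarrow> 0"
  proof (rule tendsto_sandwich)
    show "eventually (\<lambda>m. 0 \<le> e m) sequentially" using e_nonneg by simp
    have "eventually (\<lambda>m. z m < 1) sequentially" using order_tendstoD(2)[OF zlim, of 1] by simp
    then show "eventually (\<lambda>m. e m \<le> z m / (1 - sqrt (z m)) ^ 3) sequentially"
      by eventually_elim (rule e_le)
    have "(\<lambda>m. z m / (1 - sqrt (z m)) ^ 3) \<longlonglongrightarrow> 0 / (1 - sqrt 0) ^ 3"
      by (intro tendsto_intros zlim) simp
    then show "(\<lambda>m. z m / (1 - sqrt (z m)) ^ 3) \<longlonglongrightarrow> 0" by simp
  qed simp
  moreover have "mm m = 1 / real (K m) - (1 + e m) / (real (K m))\<^sup>2" for m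
    using K0[of m] by (simp add: e_def)
  ultimately show "\<exists>e :: nat \<Rightarrow> real. e \<longlonglongrightarrow> 0 \<and>
      (\<forall>m. MMSE_le (D m) (n m) (p m) (K m) (\<sigma> m) (\<Delta> m) = 1 / real (K m) - (1 + e m) / (real (K m))\<^sup>2)"
    unfolding mm_def by blast
qed

end
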